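(* Let $d\in\mathbb{N}$ and $S=\mathbb{R}^d\setminus\{0\}$. Any scale-invariant Poisson process in $S$ has the same distribution as $\eta_c^U$ for some $c>0$ and some unit random vector $U$ in $\mathbb{R}^d$. Moreover, for any random vector $V$ in $S$ with i.i.d. copies $(V_k)_{k\in\mathbb{N}}$, independent of $\eta_c$, such that, with $(Z_k)_{k\in\mathbb{N}}$ an enumeration of the points of $\eta_c$, $\mathbf{E}\sum_{k=1}^\infty\mathbf{1}\{Z_k\|V_k\|\in[a,b]\}<\infty$ for all $0<a<b<\infty$, the uplifted point process $\eta_c^V$ has the same distribution as $\eta_c^U$ with $U=V/\|V\|$.
   Context: $\|\cdot\|$ is the Euclidean norm; a unit random vector takes values in the unit sphere $\{x\in\mathbb{R}^d:\|x\|=1\}$. For $c>0$, $\eta_c$ is the Poisson process on $(0,\infty)$ with intensity measure $ct^{-1}\,dt$. For a random vector $V$ in $S$, the uplifted process is $\eta_c^V=\sum_{k=1}^\infty\delta_{V_kZ_k}$, where $(Z_k)_{k\in\mathbb{N}}$ enumerates the points of $\eta_c$, $(V_k)_{k\in\mathbb{N}}$ are i.i.d. copies of $V$ independent of $\eta_c$, and $\delta_x$ is the Dirac measure at $x$. Point processes on $S$ are random locally finite counting measures (finite on relatively compact subsets of $S$, that is, on sets that are bounded and bounded away from $0$); Poisson processes have locally finite intensity measure. A point process $\nu$ on $S$ is scale-invariant if for every $t>0$ the process $A\mapsto\nu(t^{-1}A)$ has the same distribution as $\nu$.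
   Formalization: In the first claim the scale-invariant Poisson process is additionally assumed not to be almost surely the null measure, since the zero-intensity Poisson process is scale-invariant but is not distributed as η_c^U for any c>0. *)

theory Defs
  imports "HOL-Probability.Probability"
begin

abbreviation borel_on :: "'a::topological_space set \<Rightarrow> 'a measure" where
  "borel_on S \<equiv> restrict_space borel S"

text \<open>
  The state spaces S in use are the positive half-line and the punctured space \<^term>\<open>- {0}\<close>.
  In both of them, the relatively compact subsets are the bounded ones that are bounded away from 0.
\<close>

definition bounded_away :: "'a::euclidean_space set \<Rightarrow> bool" where
  "bounded_away A \<longleftrightarrow> bounded A \<and> (\<exists>r>0. \<forall>x\<in>A. r \<le> norm x)"

definition locally_finite_on :: "'a::euclidean_space set \<Rightarrow> 'a measure \<Rightarrow> bool" where
  "locally_finite_on S \<mu> \<longleftrightarrow> sets \<mu> = sets (borel_on S) \<and>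
     (\<forall>A\<in>sets (borel_on S). bounded_away A \<longrightarrow> emeasure \<mu> A < \<infinity>)"

definition counting_on :: "'a::euclidean_space set \<Rightarrow> 'a measure \<Rightarrow> bool" where
  "counting_on S \<mu> \<longleftrightarrow> sets \<mu> = sets (borel_on S) \<and>
     (\<forall>A\<in>sets (borel_on S). emeasure \<mu> A = \<infinity> \<or> (\<exists>n::nat. emeasure \<mu> A = of_nat n))"

text \<open>
  All measures on S, with the \<open>\<sigma>\<close>-algebra generated by the evaluations \<open>\<mu> \<mapsto> \<mu> A\<close>.
  Point processes take values here and are required to be locally finite counting measures only
  almost surely: a sum of Dirac measures at random points may fail to be locally finite on a null
  set.
\<close>

definition measures_on :: "'a::euclidean_space set \<Rightarrow> 'a measure measure" where
  "measures_on S = (SUP A \<in> sets (borel_on S).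
     vimage_algebra {\<mu>. sets \<mu> = sets (borel_on S)} (\<lambda>\<mu>. emeasure \<mu> A) borel)"

lemma space_measures_on: "space (measures_on S) = {\<mu>. sets \<mu> = sets (borel_on S)}"
  by (auto simp add: measures_on_def space_Sup_eq_UN)

lemma measurable_emeasure_measures_on:
  "A \<in> sets (borel_on S) \<Longrightarrow> (\<lambda>\<mu>. emeasure \<mu> A) \<in> borel_measurable (measures_on S)"
  by (auto intro!: measurable_Sup1 measurable_vimage_algebra1 simp: measures_on_def)

definition point_process ::
    "'a::euclidean_space set \<Rightarrow> 'w measure \<Rightarrow> ('w \<Rightarrow> 'a measure) \<Rightarrow> bool" where
  "point_process S M N \<longleftrightarrow> prob_space M \<and> N \<in> measurable M (measures_on S) \<and>
     (AE \<omega> in M. locally_finite_on S (N \<omega>) \<and> counting_on S (N \<omega>))"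

definition same_distribution ::
    "'a::euclidean_space set \<Rightarrow> 'v measure \<Rightarrow> ('v \<Rightarrow> 'a measure) \<Rightarrow>
     'w measure \<Rightarrow> ('w \<Rightarrow> 'a measure) \<Rightarrow> bool" where
  "same_distribution S M N M' N' \<longleftrightarrow> point_process S M N \<and> point_process S M' N' \<and>
     distr M (measures_on S) N = distr M' (measures_on S) N'"

text \<open>
  The Poisson probabilities are written out since \<^const>\<open>poisson_pmf\<close> is specified for
  positive rates only; rate 0 gives the point mass at 0, by \<^prop>\<open>(0::real) ^ 0 = 1\<close>.
\<close>

definition poisson_process ::
    "'a::euclidean_space set \<Rightarrow> 'a measure \<Rightarrow> 'w measure \<Rightarrow> ('w \<Rightarrow> 'a measure) \<Rightarrow> bool" where
  "poisson_process S \<Lambda> M N \<longleftrightarrow>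
     point_process S M N \<and> locally_finite_on S \<Lambda> \<and>
     (\<forall>A\<in>sets (borel_on S). emeasure \<Lambda> A < \<infinity> \<longrightarrow>
        (\<forall>n::nat. measure M {\<omega>\<in>space M. emeasure (N \<omega>) A = of_nat n} =
           measure \<Lambda> A ^ n / fact n * exp (- measure \<Lambda> A))) \<and>
     (\<forall>A\<in>sets (borel_on S). emeasure \<Lambda> A = \<infinity> \<longrightarrow> (AE \<omega> in M. emeasure (N \<omega>) A = \<infinity>)) \<and>
     (\<forall>(m::nat) B. (\<forall>i<m. B i \<in> sets (borel_on S)) \<and> disjoint_family_on B {..<m} \<longrightarrow>
        prob_space.indep_vars M (\<lambda>_. borel) (\<lambda>i \<omega>. emeasure (N \<omega>) (B i)) {..<m})"

text \<open>The push-forward under \<open>x \<mapsto> t x\<close> is the measure \<open>A \<mapsto> \<nu>(t\<inverse> A)\<close>.\<close>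

definition scale_invariant ::
    "'a::euclidean_space set \<Rightarrow> 'w measure \<Rightarrow> ('w \<Rightarrow> 'a measure) \<Rightarrow> bool" where
  "scale_invariant S M N \<longleftrightarrow>
     (\<forall>t>0. same_distribution S M (\<lambda>\<omega>. distr (N \<omega>) (borel_on S) (\<lambda>x. t *\<^sub>R x)) M N)"

definition dirac_sum :: "'a::euclidean_space set \<Rightarrow> (nat \<Rightarrow> 'a) \<Rightarrow> 'a measure" where
  "dirac_sum S x =
     measure_of S (sets (borel_on S)) (\<lambda>A. \<Sum>k. emeasure (return (borel_on S) (x k)) A)"

lemma sets_dirac_sum: "sets (dirac_sum S x) = sets (borel_on S)"
proof -
  have "space (borel_on S) = S"
    by (simp add: space_restrict_space)
  then show ?thesis
    using sets.space_closed[of "borel_on S"] sets.sigma_sets_eq[of "borel_on S"]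
    by (simp add: dirac_sum_def del: space_restrict_space2)
qed

lemma emeasure_dirac_sum:
  assumes "A \<in> sets (borel_on S)"
  shows "emeasure (dirac_sum S x) A = (\<Sum>k. indicator A (x k))"
proof -
  have "emeasure (dirac_sum S x) A = (\<Sum>k. emeasure (return (borel_on S) (x k)) A)"
    unfolding dirac_sum_def
  proof (rule emeasure_measure_of[OF refl])
    show "sets (borel_on S) \<subseteq> Pow S"
      using sets.space_closed[of "borel_on S"] by (simp add: space_restrict_space)
    show "A \<in> sets (measure_of S (sets (borel_on S))
        (\<lambda>A. \<Sum>k. emeasure (return (borel_on S) (x k)) A))"
      using assms sets_dirac_sum[of S x] unfolding dirac_sum_def by simp
    show "positive (sets (measure_of S (sets (borel_on S))
        (\<lambda>A. \<Sum>k. emeasure (return (borel_on S) (x k)) A)))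
        (\<lambda>A. \<Sum>k. emeasure (return (borel_on S) (x k)) A)"
      by (simp add: positive_def)
    show "countably_additive (sets (measure_of S (sets (borel_on S))
        (\<lambda>A. \<Sum>k. emeasure (return (borel_on S) (x k)) A)))
        (\<lambda>A. \<Sum>k. emeasure (return (borel_on S) (x k)) A)"
      unfolding sets_dirac_sum[unfolded dirac_sum_def]
    proof (rule countably_additiveI)
      fix B :: "nat \<Rightarrow> 'a set"
      assume B: "range B \<subseteq> sets (borel_on S)" "disjoint_family B"
      have "(\<Sum>i. \<Sum>k. emeasure (return (borel_on S) (x k)) (B i)) =
            (\<Sum>k. \<Sum>i. emeasure (return (borel_on S) (x k)) (B i))"
        using nn_integral_suminf[of "\<lambda>i k. emeasure (return (borel_on S) (x k)) (B i)" "count_space UNIV"]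
        by (simp add: nn_integral_count_space_nat)
      also have "\<dots> = (\<Sum>k. emeasure (return (borel_on S) (x k)) (\<Union>i. B i))"
        by (intro suminf_cong suminf_emeasure) (use B in auto)
      finally show "(\<Sum>i. \<Sum>k. emeasure (return (borel_on S) (x k)) (B i)) =
        (\<Sum>k. emeasure (return (borel_on S) (x k)) (\<Union>i. B i))" .
    qed
  qed
  then show ?thesis
    using assms by simp
qed

definition eta_intensity :: "real \<Rightarrow> real measure" where
  "eta_intensity c = density (restrict_space lborel {0<..}) (\<lambda>t. ennreal (c / t))"

definition uplift :: "(nat \<Rightarrow> 'w \<Rightarrow> real) \<Rightarrow> (nat \<Rightarrow> 'w \<Rightarrow> 'a::euclidean_space) \<Rightarrow> 'w \<Rightarrow> 'a measure" where
  "uplift Z Vs \<omega> = dirac_sum (- {0}) (\<lambda>k. Z k \<omega> *\<^sub>R Vs k \<omega>)"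

text \<open>
  \<open>Z\<close> enumerates the points of a process \<open>\<eta>\<^sub>c\<close> on M, and \<open>Vs\<close> are
  i.i.d. copies of the random vector \<open>V\<close> (living on W), independent of that process; then
  \<^term>\<open>uplift Z Vs\<close> is the process uplifted by \<open>V\<close>. Independence is required of the
  enumerating sequence, not only of the random measure, since otherwise the order of enumeration
  could depend on the marks.
\<close>

definition uplift_data ::
    "real \<Rightarrow> 'v measure \<Rightarrow> ('v \<Rightarrow> 'a::euclidean_space) \<Rightarrow>
     'w measure \<Rightarrow> (nat \<Rightarrow> 'w \<Rightarrow> real) \<Rightarrow> (nat \<Rightarrow> 'w \<Rightarrow> 'a) \<Rightarrow> bool" where
  "uplift_data c W V M Z Vs \<longleftrightarrow>
     prob_space M \<and>
     (\<forall>k. Z k \<in> measurable M (borel_on {0<..})) \<and>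
     poisson_process {0<..} (eta_intensity c) M (\<lambda>\<omega>. dirac_sum {0<..} (\<lambda>k. Z k \<omega>)) \<and>
     (\<forall>k. Vs k \<in> measurable M (borel_on (- {0})) \<and>
          distr M (borel_on (- {0})) (Vs k) = distr W (borel_on (- {0})) V) \<and>
     prob_space.indep_vars M (\<lambda>_. borel_on (- {0})) Vs UNIV \<and>
     prob_space.indep_set M
       (sets (vimage_algebra (space M) (\<lambda>\<omega> k. Z k \<omega>) (\<Pi>\<^sub>M k\<in>UNIV. borel_on {0<..})))
       (sets (vimage_algebra (space M) (\<lambda>\<omega> k. Vs k \<omega>) (\<Pi>\<^sub>M k\<in>UNIV. borel_on (- {0}))))"

end

theory Submission
  imports Defs
begin

text \<open>
  The proof is driven by the Laplace functional. Write \<open>expneg\<close> for \<open>x \<mapsto> e\<^sup>-\<^sup>x\<close> on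
  \<open>[0, \<infinity>]\<close>, with value 0 at \<open>\<infinity>\<close>. A point process N is Poisson with
  locally finite intensity \<open>\<Lambda>\<close> exactly when
  \<open>E e\<^sup>-\<^sup>N\<^sup>f = exp (- \<integral> (1 - e\<^sup>-\<^sup>f) d\<Lambda>)\<close> for all measurable f with values in \<open>[0, \<infinity>]\<close>
  (lemmas \<open>poisson_process_imp_laplace\<close> and \<open>laplace_imp_poisson_process\<close>), and the Laplace
  functional determines the distribution of a point process (lemma \<open>distr_measures_on_eqI\<close>). So two
  Poisson processes with the same intensity have the same distribution, and everything becomes a
  statement about intensities. That Laplace transforms determine laws is elementary here, because
  counts take values in the natural numbers and \<open>\<infinity>\<close>: the transform is a power series in
  \<open>s = e\<^sup>-\<^sup>t\<close>, and its coefficients are the probabilities.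

  Uplifting a Poisson process by independent marks yields a Poisson process whose intensity is the
  image of \<open>c dt/t \<otimes> P\<^sub>V\<close> under \<open>(t, v) \<mapsto> t v\<close> (lemma \<open>poisson_process_uplift\<close>): given the
  points, the marks are integrated out one factor at a time, and what remains is the Laplace
  functional of the process on the half-line. As \<open>dt/t\<close> is invariant under scaling, the factor
  \<open>\<parallel>v\<parallel>\<close> can be absorbed into t, so the image intensity depends on V only through its direction
  (lemma \<open>uplift_intensity_normalize\<close>). This is the second claim.

  For the first claim, the void probabilities \<open>P(N A = 0) = e\<^sup>-\<^sup>\<Lambda>\<^sup>A\<close> show that the intensity of a
  scale-invariant Poisson process is itself scale-invariant. Averaging over dilations with respect to
  \<open>dt/t\<close> and exchanging the order of integration then writes \<open>\<Lambda>\<close> as the image of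
  \<open>dt/t \<otimes> \<Lambda>\<^sub>K\<close>, where \<open>\<Lambda>\<^sub>K\<close> is the restriction of \<open>\<Lambda>\<close> to the annulus
  \<open>K = {x. 1 \<le> \<parallel>x\<parallel> \<le> e}\<close> (lemma \<open>scale_invariant_polar\<close>). Hence \<open>\<Lambda>\<close> is an uplifted
  intensity with \<open>c = \<Lambda> K\<close> and V distributed as the normalized restriction. It remains to exhibit
  a realization of the uplifted process: the half-line is cut into the blocks
  \<open>[e\<^sup>i, e\<^sup>i\<^sup>+\<^sup>1)\<close> for integers i, each block receives a Poisson number of independent points, and the
  infinitely many points so obtained are enumerated measurably and marked independently
  (lemma \<open>uplift_data_exists\<close>).
\<close>

section \<open>The exponential of minus an extended nonnegative number\<close>

definition expneg :: "ennreal \<Rightarrow> ennreal" where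
  "expneg x = (if x = \<top> then 0 else ennreal (exp (- enn2real x)))"

lemma expneg_0 [simp]: "expneg 0 = 1"
  by (simp add: expneg_def)

lemma expneg_top [simp]: "expneg \<top> = 0"
  by (simp add: expneg_def)

lemma expneg_ennreal: "0 \<le> r \<Longrightarrow> expneg (ennreal r) = ennreal (exp (- r))"
  by (simp add: expneg_def)

lemma expneg_le_1 [simp]: "expneg x \<le> 1"
  by (cases x) (auto simp: expneg_ennreal)

lemma expneg_neq_top [simp]: "expneg x \<noteq> \<top>" "expneg x < \<top>"
  by (simp_all add: expneg_def)

lemma expneg_eq_1_iff [simp]: "expneg x = 1 \<longleftrightarrow> x = 0"
  by (cases x) (auto simp: expneg_ennreal)

lemma expneg_inj: "expneg x = expneg y \<Longrightarrow> x = y"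
  by (cases x; cases y) (auto simp: expneg_ennreal)

lemma expneg_antimono: "x \<le> y \<Longrightarrow> expneg y \<le> expneg x"
  by (cases x; cases y) (auto simp: expneg_ennreal top_unique)

lemma expneg_add: "expneg (x + y) = expneg x * expneg y"
proof (cases "x = \<top> \<or> y = \<top>")
  case False
  then obtain r s where "x = ennreal r" "y = ennreal s" "0 \<le> r" "0 \<le> s"
    by (metis ennreal_cases)
  moreover from this have "expneg (ennreal r + ennreal s) = expneg (ennreal (r + s))"
    by simp
  ultimately show ?thesis
    by (simp only: expneg_ennreal add_nonneg_nonneg minus_add_distrib exp_add ennreal_mult exp_ge_zero)
qed auto

lemma expneg_sum: "expneg (\<Sum>i\<in>I. f i) = (\<Prod>i\<in>I. expneg (f i))"
  by (induction I rule: infinite_finite_induct) (simp_all add: expneg_add)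

lemma expneg_of_nat_mult: "expneg (of_nat n * x) = expneg x ^ n"
  by (induction n) (simp_all add: expneg_add distrib_right)

lemma tendsto_expneg:
  assumes "(f \<longlongrightarrow> l) F"
  shows "((\<lambda>i. expneg (f i)) \<longlongrightarrow> expneg l) F"
proof (cases l)
  case (real r)
  have "\<forall>\<^sub>F i in F. f i < \<top>"
    using assms real by (intro order_tendstoD) auto
  then have "\<forall>\<^sub>F i in F. ennreal (exp (- enn2real (f i))) = expneg (f i)"
    by eventually_elim (auto simp: expneg_def)
  moreover have "((\<lambda>i. ennreal (exp (- enn2real (f i)))) \<longlongrightarrow> ennreal (exp (- r))) F"
    using assms real by (intro tendsto_intros) auto
  ultimately show ?thesis
    using real by (simp add: expneg_ennreal tendsto_cong)
next
  case top
  show ?thesis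
  proof (rule order_tendstoI)
    fix a assume "expneg l < a"
    then have "0 < a" using top by simp
    then obtain e where e: "0 < e" "ennreal e < a"
      by (metis dense ennreal_cases ennreal_less_zero_iff less_top_ennreal not_less_iff_gr_or_eq top.extremum_strict)
    have "\<forall>\<^sub>F i in F. ennreal (max 0 (- ln e)) < f i"
      using assms top by (intro order_tendstoD) auto
    then show "\<forall>\<^sub>F i in F. expneg (f i) < a"
    proof eventually_elim
      case (elim i)
      have "expneg (f i) \<le> expneg (ennreal (max 0 (- ln e)))"
        using elim by (intro expneg_antimono) auto
      also have "\<dots> = ennreal (exp (- max 0 (- ln e)))"
        by (rule expneg_ennreal) simp
      also have "\<dots> \<le> ennreal e"
        using e by (intro ennreal_leI) (metis exp_le_cancel_iff exp_ln max.cobounded2 minus_le_iff)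
      finally show ?case using e by simp
    qed
  qed (use top in auto)
qed

lemma measurable_expneg [measurable]: "expneg \<in> borel_measurable borel"
  unfolding expneg_def by measurable

lemma expneg_suminf: "(\<lambda>n. \<Prod>k<n. expneg (f k)) \<longlonglongrightarrow> expneg (\<Sum>k. f k)"
  unfolding expneg_sum[symmetric] by (intro tendsto_expneg summable_LIMSEQ) auto

text \<open>The inverse of \<^const>\<open>expneg\<close> on [0, 1]; it turns products back into exponentials of sums.\<close>

definition neglog :: "ennreal \<Rightarrow> ennreal" where
  "neglog y = (if y = 0 then \<top> else ennreal (- ln (enn2real y)))"

lemma expneg_neglog:
  assumes "y \<le> 1" shows "expneg (neglog y) = y"
proof (cases y)
  case (real r)
  then have "r \<le> 1" using assms by simp
  then show ?thesis
    using real by (auto simp: neglog_def expneg_ennreal)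
qed (use assms in \<open>simp add: top_unique\<close>)

lemma measurable_neglog [measurable]: "neglog \<in> borel_measurable borel"
  unfolding neglog_def by measurable

section \<open>Poisson laws with rate in [0, \<infinity>]\<close>

text \<open>The law of the number of points in a set of intensity \<open>\<rho>\<close>. The rates 0 and \<open>\<infinity>\<close>, for which
  \<^const>\<open>poisson_pmf\<close> is unspecified, give point masses.\<close>

definition poisson_law :: "ennreal \<Rightarrow> ennreal measure" where
  "poisson_law \<rho> =
     (if \<rho> = 0 then return borel 0 else if \<rho> = \<top> then return borel \<top>
      else distr (measure_pmf (poisson_pmf (enn2real \<rho>))) borel of_nat)"

lemma sets_poisson_law [simp, measurable_cong]: "sets (poisson_law \<rho>) = sets borel"
  by (simp add: poisson_law_def)

lemma space_poisson_law [simp]: "space (poisson_law \<rho>) = UNIV"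
  by (simp add: poisson_law_def)

lemma prob_space_poisson_law: "prob_space (poisson_law \<rho>)"
  unfolding poisson_law_def
  by (auto intro!: prob_space_return measure_pmf.prob_space_distr)

text \<open>The possible values of a counting measure.\<close>

definition extended_nats :: "ennreal set" where
  "extended_nats = insert \<top> (range of_nat)"

lemma countable_extended_nats: "countable extended_nats"
  by (simp add: extended_nats_def)

lemma sets_extended_nats [measurable]: "extended_nats \<in> sets borel"
  by (rule sets.countable[OF _ countable_extended_nats]) simp

lemma AE_poisson_law_extended_nats: "AE x in poisson_law \<rho>. x \<in> extended_nats"
proof -
  have "of_nat n \<in> extended_nats" "\<top> \<in> extended_nats" for n
    by (simp_all add: extended_nats_def)
  moreover from this(1)[of 0] have "0 \<in> extended_nats" by simp
  moreover have "{x. x \<in> extended_nats} \<in> sets borel" by simp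
  ultimately show ?thesis
    unfolding poisson_law_def by (auto simp: AE_return AE_distr_iff)
qed

lemma emeasure_poisson_law_of_nat:
  assumes "\<rho> \<noteq> \<top>"
  shows "emeasure (poisson_law \<rho>) {of_nat n} =
    ennreal (enn2real \<rho> ^ n / fact n * exp (- enn2real \<rho>))"
proof (cases "\<rho> = 0")
  case True
  then show ?thesis by (cases n) (auto simp: poisson_law_def)
next
  case False
  then have pos: "0 < enn2real \<rho>"
    using assms by (simp add: enn2real_positive_iff less_top zero_less_iff_neq_zero)
  have "of_nat -` {of_nat n :: ennreal} = {n}" by auto
  then show ?thesis using False assms pos
    by (simp add: poisson_law_def emeasure_distr emeasure_pmf_single)
qed

lemma emeasure_poisson_law_infinity:
  "emeasure (poisson_law \<rho>) {\<top>} = (if \<rho> = \<top> then 1 else 0)"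
proof -
  have "of_nat -` {\<top> :: ennreal} = {}" by auto
  then show ?thesis by (auto simp: poisson_law_def emeasure_distr)
qed

text \<open>The probability generating function: the exponential series in \<open>l a\<close>.\<close>

lemma nn_integral_power_poisson_pmf:
  assumes l: "0 < l" and a: "a \<le> (1::ennreal)"
  shows "(\<integral>\<^sup>+n. a ^ n \<partial>measure_pmf (poisson_pmf l)) = expneg (ennreal l * (1 - a))"
proof -
  obtain r where r: "a = ennreal r" "0 \<le> r" "r \<le> 1"
    using a by (cases a) (auto simp: top_unique)
  have "(\<integral>\<^sup>+n. a ^ n \<partial>measure_pmf (poisson_pmf l)) =
      (\<Sum>n. ennreal (exp (- l) * ((l * r) ^ n /\<^sub>R fact n)))"
    using l r unfolding nn_integral_measure_pmf nn_integral_count_space_nat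
    by (intro suminf_cong)
       (simp add: ennreal_power ennreal_mult[symmetric] power_mult_distrib field_simps)
  also have "\<dots> = ennreal (exp (- l) * exp (l * r))"
    using l r by (intro suminf_ennreal_eq sums_mult exp_converges) auto
  also have "\<dots> = expneg (ennreal l * (1 - a))"
    using l r
    by (simp add: ennreal_minus ennreal_mult[symmetric] expneg_ennreal mult_exp_exp algebra_simps
        flip: ennreal_1)
  finally show ?thesis .
qed

text \<open>With \<open>a = e\<^sup>-\<^sup>t\<close> this is the generating function of a Poisson variable. The conventions at \<open>\<infinity>\<close>
  are consistent: for \<open>\<rho> = \<infinity>\<close> both sides are 0 unless \<open>t = 0\<close>, where both are 1.\<close>

lemma laplace_poisson_law:
  "(\<integral>\<^sup>+x. expneg (t * x) \<partial>poisson_law \<rho>) = expneg ((1 - expneg t) * \<rho>)"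
proof -
  consider "\<rho> = 0" | "\<rho> = \<top>" | "\<rho> \<noteq> 0" "\<rho> \<noteq> \<top>" by auto
  then show ?thesis
  proof cases
    case 1
    then show ?thesis by (simp add: poisson_law_def nn_integral_return)
  next
    case 2
    have "1 - expneg t = 0 \<longleftrightarrow> t = 0"
      using antisym[OF expneg_le_1[of t]] by (auto dest: ennreal_minus_eq_0)
    then show ?thesis using 2
      by (auto simp: poisson_law_def nn_integral_return ennreal_mult_top)
  next
    case 3
    then have pos: "0 < enn2real \<rho>"
      by (simp add: enn2real_positive_iff less_top zero_less_iff_neq_zero)
    have "(\<integral>\<^sup>+x. expneg (t * x) \<partial>poisson_law \<rho>) =
        (\<integral>\<^sup>+n. expneg t ^ n \<partial>measure_pmf (poisson_pmf (enn2real \<rho>)))"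
      using 3 by (simp add: poisson_law_def nn_integral_distr mult.commute[of t] expneg_of_nat_mult)
    also have "\<dots> = expneg (ennreal (enn2real \<rho>) * (1 - expneg t))"
      by (intro nn_integral_power_poisson_pmf pos) simp
    finally show ?thesis using 3 by (simp add: mult.commute less_top)
  qed
qed

section \<open>Laplace transforms determine counting laws\<close>

text \<open>A version of the identity theorem that needs the series only to the right of 0, which is where
  Laplace transforms live. After division by \<open>s\<^sup>n\<close> the first coefficient that is not yet known to
  vanish is the limit of the series at 0.\<close>

lemma power_series_zero_unique:
  fixes d :: "nat \<Rightarrow> real"
  assumes sums: "\<And>s. 0 < s \<Longrightarrow> s < 1 \<Longrightarrow> (\<lambda>n. d n * s ^ n) sums 0"
  shows "d n = 0"
proof (induction n rule: less_induct)
  case (less n)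
  have shifted: "(\<lambda>k. d (k + n) * s ^ k) sums 0" if s: "0 < s" "s < 1" for s
  proof -
    have "(\<lambda>k. d (k + n) * s ^ (k + n)) sums (0 - (\<Sum>i<n. d i * s ^ i))"
      using sums[OF s] by (subst sums_iff_shift) simp
    also have "(\<Sum>i<n. d i * s ^ i) = 0"
      using less by simp
    finally have "(\<lambda>k. inverse (s ^ n) * (d (k + n) * s ^ (k + n))) sums 0"
      using sums_mult[of _ 0 "inverse (s ^ n)"] by simp
    then show ?thesis
      using s by (simp add: power_add field_simps)
  qed
  define f where "f x = (\<Sum>k. d (k + n) * x ^ k)" for x :: real
  have "(f \<longlongrightarrow> d (0 + n)) (at 0)"
  proof (rule powser_limit_0[of "1 / 2"])
    fix x :: real assume "norm x < 1 / 2"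
    then have "summable (\<lambda>k. d (k + n) * x ^ k)"
      using powser_inside[of "\<lambda>k. d (k + n)" "1 / 2" x] sums_summable[OF shifted[of "1 / 2"]] by simp
    then show "(\<lambda>k. d (k + n) * x ^ k) sums f x"
      by (simp add: f_def summable_sums)
  qed simp
  then have "(f \<longlongrightarrow> d n) (at_right 0)"
    by (simp add: filterlim_at_split)
  moreover have "\<forall>\<^sub>F x in at_right 0. f x = 0"
    unfolding f_def using shifted by (auto simp: eventually_at_right_field sums_iff intro!: exI[of _ 1])
  then have "(f \<longlongrightarrow> 0) (at_right 0)"
    by (rule tendsto_eventually)
  ultimately show "d n = 0"
    by (intro tendsto_unique) auto
qed

lemma measure_eqI_extended_nats:
  fixes \<mu> \<nu> :: "ennreal measure"
  assumes sets [measurable_cong]: "sets \<mu> = sets borel" "sets \<nu> = sets borel"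
    and fin: "finite_measure \<mu>"
    and ae: "AE x in \<mu>. x \<in> extended_nats" "AE x in \<nu>. x \<in> extended_nats"
    and total: "emeasure \<mu> UNIV = emeasure \<nu> UNIV"
    and nats: "\<And>n. emeasure \<mu> {of_nat n} = emeasure \<nu> {of_nat n}"
  shows "\<mu> = \<nu>"
proof -
  interpret \<mu>: finite_measure \<mu> by fact
  have range: "emeasure \<mu> (range of_nat) = emeasure \<nu> (range of_nat)"
    by (subst (1 2) emeasure_countable_singleton) (auto simp: sets nats intro!: nn_integral_cong)
  have "emeasure \<kappa> UNIV = emeasure \<kappa> (range of_nat) + emeasure \<kappa> {\<top>}"
    if \<kappa>: "sets \<kappa> = sets borel" "AE x in \<kappa>. x \<in> extended_nats" for \<kappa> :: "ennreal measure"
  proof -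
    have [measurable]: "range (of_nat :: nat \<Rightarrow> ennreal) \<in> sets borel"
      by (rule sets.countable) auto
    have "emeasure \<kappa> UNIV = emeasure \<kappa> (range of_nat \<union> {\<top>})"
      using \<kappa> by (intro emeasure_eq_AE) (auto simp: extended_nats_def)
    also have "\<dots> = emeasure \<kappa> (range of_nat) + emeasure \<kappa> {\<top>}"
      using \<kappa> by (intro plus_emeasure[symmetric]) auto
    finally show ?thesis .
  qed
  from this[OF sets(1) ae(1)] this[OF sets(2) ae(2)]
  have top: "emeasure \<mu> {\<top>} = emeasure \<nu> {\<top>}"
    using total range \<mu>.emeasure_finite[of "range of_nat"] by (auto simp: ennreal_add_left_cancel)
  show ?thesis
  proof (rule measure_eqI)
    fix A assume "A \<in> sets \<mu>"
    then have [measurable]: "A \<in> sets borel" by (simp add: sets)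
    have "emeasure \<mu> A = emeasure \<mu> (A \<inter> extended_nats)"
      using ae(1) by (intro emeasure_eq_AE) (auto simp: sets)
    also have "\<dots> = (\<integral>\<^sup>+x. emeasure \<mu> {x} \<partial>count_space (A \<inter> extended_nats))"
      using countable_extended_nats by (intro emeasure_countable_singleton) (auto simp: sets)
    also have "\<dots> = (\<integral>\<^sup>+x. emeasure \<nu> {x} \<partial>count_space (A \<inter> extended_nats))"
      using nats top by (intro nn_integral_cong) (auto simp: extended_nats_def)
    also have "\<dots> = emeasure \<nu> (A \<inter> extended_nats)"
      using countable_extended_nats by (intro emeasure_countable_singleton[symmetric]) (auto simp: sets)
    also have "\<dots> = emeasure \<nu> A"
      using ae(2) by (intro emeasure_eq_AE) (auto simp: sets)
    finally show "emeasure \<mu> A = emeasure \<nu> A" .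
  qed (simp add: sets)
qed

text \<open>For \<open>t > 0\<close> the transform is the power series in \<open>s = e\<^sup>-\<^sup>t\<close> whose coefficients are the masses of the
  natural numbers, as \<open>\<infinity>\<close> contributes nothing. The value \<open>t = 0\<close> gives the total mass, and
  hence the mass at \<open>\<infinity>\<close>.\<close>

lemma measure_eqI_laplace:
  fixes \<mu> \<nu> :: "ennreal measure"
  assumes sets [measurable_cong]: "sets \<mu> = sets borel" "sets \<nu> = sets borel"
    and fin: "finite_measure \<mu>"
    and ae: "AE x in \<mu>. x \<in> extended_nats" "AE x in \<nu>. x \<in> extended_nats"
    and laplace: "\<And>t::real. 0 \<le> t \<Longrightarrow>
      (\<integral>\<^sup>+x. expneg (ennreal t * x) \<partial>\<mu>) = (\<integral>\<^sup>+x. expneg (ennreal t * x) \<partial>\<nu>)"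
  shows "\<mu> = \<nu>"
proof -
  have space: "space \<mu> = UNIV" "space \<nu> = UNIV"
    using sets[THEN sets_eq_imp_space_eq] by simp_all
  have total: "emeasure \<mu> UNIV = emeasure \<nu> UNIV"
    using laplace[of 0] by (simp add: space)
  interpret \<mu>: finite_measure \<mu> by fact
  interpret \<nu>: finite_measure \<nu>
    using total \<mu>.emeasure_finite[of UNIV] by (intro finite_measureI) (simp add: space)
  have series: "(\<lambda>n. measure \<kappa> {of_nat n} * s ^ n) sums
      enn2real (\<integral>\<^sup>+x. expneg (ennreal (- ln s) * x) \<partial>\<kappa>)"
    if s: "0 < s" "s < 1" and \<kappa>: "sets \<kappa> = sets borel" "finite_measure \<kappa>"
      "AE x in \<kappa>. x \<in> extended_nats" for \<kappa> s
  proof -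
    interpret finite_measure \<kappa> by fact
    note [measurable_cong] = \<kappa>(1)
    have s': "expneg (ennreal (- ln s)) = ennreal s"
      using s by (simp add: expneg_ennreal)
    have "AE x in \<kappa>. expneg (ennreal (- ln s) * x) =
        (\<Sum>n. ennreal s ^ n * indicator {of_nat n} x)"
      using \<kappa>(3)
    proof eventually_elim
      case (elim x)
      show ?case
      proof (cases "x = \<top>")
        case True
        then show ?thesis using s by (simp add: ennreal_mult_top)
      next
        case False
        then obtain m where m: "x = of_nat m" using elim by (auto simp: extended_nats_def)
        have "(\<Sum>n. ennreal s ^ n * indicator {of_nat n} x) =
            (\<Sum>n\<in>{m}. ennreal s ^ n * indicator {of_nat n} x)"
          by (rule suminf_finite) (auto simp: m)
        then show ?thesis
          by (simp add: m mult.commute[of _ "of_nat m"] expneg_of_nat_mult s')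
      qed
    qed
    then have "(\<integral>\<^sup>+x. expneg (ennreal (- ln s) * x) \<partial>\<kappa>) =
        (\<integral>\<^sup>+x. (\<Sum>n. ennreal s ^ n * indicator {of_nat n} x) \<partial>\<kappa>)"
      by (rule nn_integral_cong_AE)
    also have "\<dots> = (\<Sum>n. ennreal s ^ n * emeasure \<kappa> {of_nat n})"
      by (subst nn_integral_suminf) (auto simp: nn_integral_cmult)
    also have "\<dots> = (\<Sum>n. ennreal (measure \<kappa> {of_nat n} * s ^ n))"
      using s by (intro suminf_cong)
        (simp add: emeasure_eq_measure ennreal_power ennreal_mult' mult.commute)
    finally have eq: "(\<integral>\<^sup>+x. expneg (ennreal (- ln s) * x) \<partial>\<kappa>) =
        (\<Sum>n. ennreal (measure \<kappa> {of_nat n} * s ^ n))" .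
    have "summable (\<lambda>n. measure \<kappa> {of_nat n} * s ^ n)"
    proof (rule summable_comparison_test'[where N = 0])
      show "summable (\<lambda>n. measure \<kappa> (space \<kappa>) * s ^ n)"
        using s by (intro summable_mult summable_geometric) auto
      show "norm (measure \<kappa> {of_nat n} * s ^ n) \<le> measure \<kappa> (space \<kappa>) * s ^ n" for n
        using s by (auto simp: abs_mult intro!: mult_right_mono bounded_measure)
    qed
    then show ?thesis
      unfolding eq using s by (simp add: suminf_ennreal2 suminf_nonneg summable_sums)
  qed
  have "measure \<mu> {of_nat n} - measure \<nu> {of_nat n} = 0" for n
  proof (rule power_series_zero_unique)
    fix s :: real assume s: "0 < s" "s < 1"
    show "(\<lambda>n. (measure \<mu> {of_nat n} - measure \<nu> {of_nat n}) * s ^ n) sums 0"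
      using sums_diff[OF series[OF s, of \<mu>] series[OF s, of \<nu>]] laplace[of "- ln s"] s
        sets ae \<mu>.finite_measure_axioms \<nu>.finite_measure_axioms
      by (simp add: left_diff_distrib)
  qed
  then have nats: "emeasure \<mu> {of_nat n} = emeasure \<nu> {of_nat n}" for n
    by (simp add: \<mu>.emeasure_eq_measure \<nu>.emeasure_eq_measure)
  then show ?thesis
    using sets fin ae total by (intro measure_eqI_extended_nats)
qed

text \<open>The joint version. The exponential factors \<open>e\<^sup>-\<^sup>t\<^sup>X\<close> are replaced by indicators \<open>1\<^sub>B(X)\<close> one
  coordinate at a time: with all other factors collected into a density, the one-dimensional
  uniqueness applies to the coordinate in question.\<close>

lemma emeasure_boxes_eqI_laplace:
  fixes X :: "'i \<Rightarrow> 'v \<Rightarrow> ennreal" and Y :: "'i \<Rightarrow> 'w \<Rightarrow> ennreal"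
  assumes "finite_measure M" "finite_measure N"
    and I: "finite I"
    and X [measurable]: "\<And>i. i \<in> I \<Longrightarrow> X i \<in> borel_measurable M"
    and Y [measurable]: "\<And>i. i \<in> I \<Longrightarrow> Y i \<in> borel_measurable N"
    and aeX: "\<And>i. i \<in> I \<Longrightarrow> AE \<omega> in M. X i \<omega> \<in> extended_nats"
    and aeY: "\<And>i. i \<in> I \<Longrightarrow> AE \<omega> in N. Y i \<omega> \<in> extended_nats"
    and laplace: "\<And>t :: 'i \<Rightarrow> real. (\<And>i. 0 \<le> t i) \<Longrightarrow>
      (\<integral>\<^sup>+\<omega>. expneg (\<Sum>i\<in>I. ennreal (t i) * X i \<omega>) \<partial>M) =
      (\<integral>\<^sup>+\<omega>. expneg (\<Sum>i\<in>I. ennreal (t i) * Y i \<omega>) \<partial>N)"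
    and B [measurable]: "\<And>i. i \<in> I \<Longrightarrow> B i \<in> sets borel"
  shows "emeasure M {\<omega>\<in>space M. \<forall>i\<in>I. X i \<omega> \<in> B i} =
    emeasure N {\<omega>\<in>space N. \<forall>i\<in>I. Y i \<omega> \<in> B i}"
proof -
  interpret M: finite_measure M by fact
  interpret N: finite_measure N by fact
  define h :: "(('i \<Rightarrow> ennreal) \<Rightarrow> 'i set \<Rightarrow> 'i set \<Rightarrow> ('i \<Rightarrow> real) \<Rightarrow> ennreal)" where
    "h x J K t = (\<Prod>i\<in>J. indicator (B i) (x i)) * expneg (\<Sum>i\<in>K. ennreal (t i) * x i)" for x J K t
  have h_le_1: "h x J K t \<le> 1" for x J K t
    unfolding h_def
    by (intro mult_le_one prod_le_1 conjI) (auto simp: indicator_def)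
  have meas: "(\<lambda>\<omega>. h (\<lambda>i. X i \<omega>) J K t) \<in> borel_measurable M"
     "(\<lambda>\<omega>. h (\<lambda>i. Y i \<omega>) J K t) \<in> borel_measurable N" if "J \<subseteq> I" "K \<subseteq> I" for J K t
    using that unfolding h_def
    by (auto intro!: borel_measurable_times_ennreal borel_measurable_prod_ennreal
        measurable_compose[OF _ measurable_expneg] borel_measurable_sum
        measurable_compose[OF _ borel_measurable_indicator[OF B]])
  have "(\<integral>\<^sup>+\<omega>. h (\<lambda>i. X i \<omega>) J (I - J) t \<partial>M) = (\<integral>\<^sup>+\<omega>. h (\<lambda>i. Y i \<omega>) J (I - J) t \<partial>N)"
    if "J \<subseteq> I" "\<And>i. 0 \<le> t i" for J t
    using finite_subset[OF that(1) I] that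
  proof (induction J arbitrary: t rule: finite_induct)
    case empty
    then show ?case using laplace by (simp add: h_def)
  next
    case (insert j J)
    define K where "K = I - insert j J"
    have j: "j \<in> I" "j \<notin> J" "j \<notin> K" "I - J = insert j K" "J \<subseteq> I" "K \<subseteq> I" "finite K" "finite J"
      using insert I by (auto simp: K_def)
    have split: "h x J (I - J) (t(j := s)) = h x J K t * expneg (ennreal s * x j)" for x s
    proof -
      have "(\<Sum>i\<in>K. ennreal ((t(j := s)) i) * x i) = (\<Sum>i\<in>K. ennreal (t i) * x i)"
        using j by (intro sum.cong) auto
      then show ?thesis
        using j by (simp add: h_def expneg_add mult_ac)
    qed
    have split': "h x (insert j J) K t = h x J K t * indicator (B j) (x j)" for x
      using j by (simp add: h_def mult_ac)
    note [measurable] = meas[OF j(5,6)] X[OF j(1)] Y[OF j(1)] B[OF j(1)]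
    define \<mu> where "\<mu> = distr (density M (\<lambda>\<omega>. h (\<lambda>i. X i \<omega>) J K t)) borel (X j)"
    define \<nu> where "\<nu> = distr (density N (\<lambda>\<omega>. h (\<lambda>i. Y i \<omega>) J K t)) borel (Y j)"
    have int: "(\<integral>\<^sup>+x. g x \<partial>\<mu>) = (\<integral>\<^sup>+\<omega>. h (\<lambda>i. X i \<omega>) J K t * g (X j \<omega>) \<partial>M)"
      "(\<integral>\<^sup>+x. g x \<partial>\<nu>) = (\<integral>\<^sup>+\<omega>. h (\<lambda>i. Y i \<omega>) J K t * g (Y j \<omega>) \<partial>N)"
      if [measurable]: "g \<in> borel_measurable borel" for g
      by (simp_all add: \<mu>_def \<nu>_def nn_integral_distr nn_integral_density)
    have "\<mu> = \<nu>"
    proof (rule measure_eqI_laplace)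
      have "(\<integral>\<^sup>+x. 1 \<partial>\<mu>) \<le> (\<integral>\<^sup>+\<omega>. 1 \<partial>M)"
        unfolding int(1)[OF borel_measurable_const] by (intro nn_integral_mono) (simp add: h_le_1)
      also have "\<dots> < \<infinity>"
        by (simp add: less_top[symmetric])
      finally show "finite_measure \<mu>"
        by (intro finite_measureI) simp
      show "AE x in \<mu>. x \<in> extended_nats"
        using aeX[OF j(1)] unfolding \<mu>_def by (subst AE_distr_iff) (auto simp: AE_density)
      show "AE x in \<nu>. x \<in> extended_nats"
        using aeY[OF j(1)] unfolding \<nu>_def by (subst AE_distr_iff) (auto simp: AE_density)
      show "(\<integral>\<^sup>+x. expneg (ennreal s * x) \<partial>\<mu>) = (\<integral>\<^sup>+x. expneg (ennreal s * x) \<partial>\<nu>)"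
        if "0 \<le> s" for s
      proof -
        have "(\<integral>\<^sup>+\<omega>. h (\<lambda>i. X i \<omega>) J (I - J) (t(j := s)) \<partial>M) =
            (\<integral>\<^sup>+\<omega>. h (\<lambda>i. Y i \<omega>) J (I - J) (t(j := s)) \<partial>N)"
          using insert.prems that by (intro insert.IH) auto
        then show ?thesis by (simp add: int split)
      qed
    qed (simp_all add: \<mu>_def \<nu>_def)
    then show ?case
      using int[of "indicator (B j)"] by (simp add: split' K_def[symmetric])
  qed
  from this[of I "\<lambda>_. 0"]
  have "(\<integral>\<^sup>+\<omega>. (\<Prod>i\<in>I. indicator (B i) (X i \<omega>)) \<partial>M) = (\<integral>\<^sup>+\<omega>. (\<Prod>i\<in>I. indicator (B i) (Y i \<omega>)) \<partial>N)"
    by (simp add: h_def)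
  moreover have prod: "(\<Prod>i\<in>I. indicator (B i) (x i)) = (if \<forall>i\<in>I. x i \<in> B i then 1 else 0 :: ennreal)" for x
    using I by (auto simp: indicator_def)
  have boxes: "{\<omega>\<in>space M. \<forall>i\<in>I. X i \<omega> \<in> B i} \<in> sets M"
    "{\<omega>\<in>space N. \<forall>i\<in>I. Y i \<omega> \<in> B i} \<in> sets N"
    using I by (auto intro!: sets.sets_Collect_finite_All' measurable_sets_Collect
        simp: pred_def[symmetric] intro: measurable_compose[OF X] measurable_compose[OF Y])
  have "emeasure M {\<omega>\<in>space M. \<forall>i\<in>I. X i \<omega> \<in> B i} = (\<integral>\<^sup>+\<omega>. (\<Prod>i\<in>I. indicator (B i) (X i \<omega>)) \<partial>M)"
    unfolding nn_integral_indicator[OF boxes(1), symmetric] prod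
    by (intro nn_integral_cong) (simp add: indicator_def)
  moreover have "emeasure N {\<omega>\<in>space N. \<forall>i\<in>I. Y i \<omega> \<in> B i} = (\<integral>\<^sup>+\<omega>. (\<Prod>i\<in>I. indicator (B i) (Y i \<omega>)) \<partial>N)"
    unfolding nn_integral_indicator[OF boxes(2), symmetric] prod
    by (intro nn_integral_cong) (simp add: indicator_def)
  ultimately show ?thesis
    by simp
qed

section \<open>Laplace functionals determine point processes\<close>

text \<open>An event for random measures is a preimage, under the map that evaluates a measure at all sets, of
  an event in the product space. This reduces the distribution of a point process to its
  finite-dimensional distributions.\<close>

lemma sets_measures_on_vimage:
  fixes S :: "'a::euclidean_space set"
  assumes E: "E \<in> sets (measures_on S)"
  obtains F where "F \<in> sets (PiM (sets (borel_on S)) (\<lambda>_. borel))"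
    "E = (\<lambda>\<mu>. \<lambda>A\<in>sets (borel_on S). emeasure \<mu> A) -` F \<inter> space (measures_on S)"
proof -
  define ev :: "'a measure \<Rightarrow> 'a set \<Rightarrow> ennreal" where
    "ev = (\<lambda>\<mu>. \<lambda>A\<in>sets (borel_on S). emeasure \<mu> A)"
  define P :: "('a set \<Rightarrow> ennreal) measure" where "P = PiM (sets (borel_on S)) (\<lambda>_. borel)"
  define Sp where "Sp = {\<mu> :: 'a measure. sets \<mu> = sets (borel_on S)}"
  have ev: "ev \<in> Sp \<rightarrow> space P"
    by (auto simp: ev_def P_def space_PiM)
  have "sets (measures_on S) \<subseteq> sets (vimage_algebra Sp ev P)"
    unfolding measures_on_def
  proof (rule sets_Sup_in_sets)
    fix m assume "m \<in> (\<lambda>A. vimage_algebra {\<mu>. sets \<mu> = sets (borel_on S)} (\<lambda>\<mu>. emeasure \<mu> A) borel)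
      ` sets (borel_on S)"
    then obtain A where A: "A \<in> sets (borel_on S)"
      and m: "m = vimage_algebra Sp (\<lambda>\<mu>. emeasure \<mu> A) borel"
      by (auto simp: Sp_def)
    show "space m = space (vimage_algebra Sp ev P)"
      by (simp add: m)
    have "(\<lambda>\<mu>. ev \<mu> A) \<in> borel_measurable (vimage_algebra Sp ev P)"
      using A by (intro measurable_compose[OF measurable_vimage_algebra1[OF ev]])
        (simp add: P_def)
    then have "(\<lambda>\<mu>. emeasure \<mu> A) \<in> borel_measurable (vimage_algebra Sp ev P)"
      using A by (simp add: ev_def)
    then show "sets m \<subseteq> sets (vimage_algebra Sp ev P)"
      unfolding m by (intro sets_image_in_sets) (auto simp: measurable_def)
  qed auto
  with E obtain F where "F \<in> sets P" "E = ev -` F \<inter> Sp"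
    by (auto simp: sets_vimage_algebra2[OF ev])
  then show ?thesis
    using that by (auto simp: P_def ev_def Sp_def space_measures_on)
qed

lemma counting_on_extended_nats:
  "counting_on S \<mu> \<Longrightarrow> A \<in> sets (borel_on S) \<Longrightarrow> emeasure \<mu> A \<in> extended_nats"
  by (auto simp: counting_on_def extended_nats_def)

text \<open>Applied to nonnegative linear combinations of indicators, the Laplace functional yields the joint
  Laplace transforms of the counts of finitely many sets, and hence the finite-dimensional
  distributions.\<close>

lemma distr_measures_on_eqI:
  fixes N :: "'v \<Rightarrow> 'a::euclidean_space measure" and N' :: "'w \<Rightarrow> 'a measure"
  assumes "finite_measure M" "finite_measure M'"
    and N [measurable]: "N \<in> measurable M (measures_on S)"
    and N' [measurable]: "N' \<in> measurable M' (measures_on S)"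
    and ae: "AE \<omega> in M. counting_on S (N \<omega>)" "AE \<omega> in M'. counting_on S (N' \<omega>)"
    and laplace: "\<And>f. f \<in> borel_measurable (borel_on S) \<Longrightarrow>
      (\<integral>\<^sup>+\<omega>. expneg (\<integral>\<^sup>+x. f x \<partial>N \<omega>) \<partial>M) = (\<integral>\<^sup>+\<omega>. expneg (\<integral>\<^sup>+x. f x \<partial>N' \<omega>) \<partial>M')"
  shows "distr M (measures_on S) N = distr M' (measures_on S) N'"
proof (rule measure_eqI)
  interpret M: finite_measure M by fact
  interpret M': finite_measure M' by fact
  define ev :: "'a measure \<Rightarrow> 'a set \<Rightarrow> ennreal" where
    "ev = (\<lambda>\<mu>. \<lambda>A\<in>sets (borel_on S). emeasure \<mu> A)"
  define P :: "('a set \<Rightarrow> ennreal) measure" where "P = PiM (sets (borel_on S)) (\<lambda>_. borel)"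
  have count [measurable]: "(\<lambda>\<omega>. emeasure (N \<omega>) A) \<in> borel_measurable M"
    "(\<lambda>\<omega>. emeasure (N' \<omega>) A) \<in> borel_measurable M'" if "A \<in> sets (borel_on S)" for A
    using measurable_emeasure_measures_on[OF that] by measurable
  have ev [measurable]: "ev \<in> measurable (measures_on S) P"
    unfolding ev_def P_def using measurable_emeasure_measures_on by (intro measurable_restrict) auto
  have sets_N: "sets (N \<omega>) = sets (borel_on S)" if "\<omega> \<in> space M" for \<omega>
    using measurable_space[OF N that] by (simp add: space_measures_on)
  have sets_N': "sets (N' \<omega>) = sets (borel_on S)" if "\<omega> \<in> space M'" for \<omega>
    using measurable_space[OF N' that] by (simp add: space_measures_on)
  have fidis: "distr M P (\<lambda>\<omega>. ev (N \<omega>)) = distr M' P (\<lambda>\<omega>. ev (N' \<omega>))"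
  proof (rule measure_eqI_PiM_infinite)
    fix B :: "'a set \<Rightarrow> ennreal set" and J
    assume J: "finite J" "J \<subseteq> sets (borel_on S)" and B: "\<And>A. A \<in> J \<Longrightarrow> B A \<in> sets borel"
    let ?E = "prod_emb (sets (borel_on S)) (\<lambda>_. borel) J (Pi\<^sub>E J B)"
    have E: "?E \<in> sets P"
      unfolding P_def using J B by (intro sets_PiM_I) auto
    have pre: "(\<lambda>\<omega>. ev (N \<omega>)) -` ?E \<inter> space M = {\<omega>\<in>space M. \<forall>A\<in>J. emeasure (N \<omega>) A \<in> B A}"
      "(\<lambda>\<omega>. ev (N' \<omega>)) -` ?E \<inter> space M' = {\<omega>\<in>space M'. \<forall>A\<in>J. emeasure (N' \<omega>) A \<in> B A}"
      using J by (auto simp: prod_emb_def ev_def PiE_iff subset_eq)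
    have sum: "(\<Sum>A\<in>J. ennreal (t A) * emeasure \<mu> A) = (\<integral>\<^sup>+x. (\<Sum>A\<in>J. ennreal (t A) * indicator A x) \<partial>\<mu>)"
      if "sets \<mu> = sets (borel_on S)" for \<mu> and t :: "'a set \<Rightarrow> real"
      using J that by (subst nn_integral_sum) (auto simp: nn_integral_cmult_indicator subset_eq)
    have "emeasure M {\<omega>\<in>space M. \<forall>A\<in>J. emeasure (N \<omega>) A \<in> B A} =
        emeasure M' {\<omega>\<in>space M'. \<forall>A\<in>J. emeasure (N' \<omega>) A \<in> B A}"
    proof (rule emeasure_boxes_eqI_laplace)
      fix A assume "A \<in> J"
      then have A: "A \<in> sets (borel_on S)" using J by auto
      then show "(\<lambda>\<omega>. emeasure (N \<omega>) A) \<in> borel_measurable M"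
        "(\<lambda>\<omega>. emeasure (N' \<omega>) A) \<in> borel_measurable M'" by measurable
      show "AE \<omega> in M. emeasure (N \<omega>) A \<in> extended_nats"
        using ae(1) by eventually_elim (rule counting_on_extended_nats[OF _ A])
      show "AE \<omega> in M'. emeasure (N' \<omega>) A \<in> extended_nats"
        using ae(2) by eventually_elim (rule counting_on_extended_nats[OF _ A])
    next
      fix t :: "'a set \<Rightarrow> real"
      have "(\<lambda>x. \<Sum>A\<in>J. ennreal (t A) * indicator A x) \<in> borel_measurable (borel_on S)"
        using J by (intro borel_measurable_sum borel_measurable_times) auto
      from laplace[OF this]
      show "(\<integral>\<^sup>+\<omega>. expneg (\<Sum>A\<in>J. ennreal (t A) * emeasure (N \<omega>) A) \<partial>M) =
          (\<integral>\<^sup>+\<omega>. expneg (\<Sum>A\<in>J. ennreal (t A) * emeasure (N' \<omega>) A) \<partial>M')"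
        by (simp add: sum sets_N sets_N' cong: nn_integral_cong)
    qed (use J B assms in auto)
    then show "emeasure (distr M P (\<lambda>\<omega>. ev (N \<omega>))) ?E = emeasure (distr M' P (\<lambda>\<omega>. ev (N' \<omega>))) ?E"
      using E by (simp add: emeasure_distr pre)
  next
    show "finite_measure (distr M P (\<lambda>\<omega>. ev (N \<omega>)))"
      by (intro M.finite_measure_distr) measurable
  qed (simp_all add: P_def)
  fix E assume "E \<in> sets (distr M (measures_on S) N)"
  then have E: "E \<in> sets (measures_on S)" by simp
  then obtain F where F: "F \<in> sets P" "E = ev -` F \<inter> space (measures_on S)"
    unfolding P_def ev_def by (rule sets_measures_on_vimage)
  have pre: "N -` E \<inter> space M = (\<lambda>\<omega>. ev (N \<omega>)) -` F \<inter> space M"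
    "N' -` E \<inter> space M' = (\<lambda>\<omega>. ev (N' \<omega>)) -` F \<inter> space M'"
    using measurable_space[OF N] measurable_space[OF N'] by (auto simp: F(2))
  show "emeasure (distr M (measures_on S) N) E = emeasure (distr M' (measures_on S) N') E"
    using arg_cong[OF fidis, of "\<lambda>m. emeasure m F"] E F(1) by (simp add: emeasure_distr pre)
qed simp

lemma space_borel_on: "space (borel_on S) = S"
  by (simp add: space_restrict_space)

lemma measurable_nn_integral_measures_on:
  assumes f: "f \<in> borel_measurable (borel_on S)"
  shows "(\<lambda>\<mu>. \<integral>\<^sup>+x. f x \<partial>\<mu>) \<in> borel_measurable (measures_on S)"
proof -
  obtain F where F: "\<And>i. simple_function (borel_on S) (F i)" "incseq F" "\<And>i x. F i x < \<top>"
      "\<And>x. (SUP i. F i x) = f x"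
    using borel_measurable_implies_simple_function_sequence'[OF f] by metis
  have "(\<integral>\<^sup>+x. f x \<partial>\<mu>) = (SUP i. \<Sum>y\<in>F i ` S. y * emeasure \<mu> (F i -` {y} \<inter> S))"
    if "\<mu> \<in> space (measures_on S)" for \<mu>
  proof -
    have \<mu>: "sets \<mu> = sets (borel_on S)" "space \<mu> = S"
      using that sets_eq_imp_space_eq[of \<mu> "borel_on S"]
      by (simp_all add: space_measures_on space_borel_on)
    have simple: "simple_function \<mu> (F i)" for i
      using F(1)[of i] \<mu> simple_function_cong_algebra[of \<mu> "borel_on S" "F i"]
      by (simp add: space_borel_on)
    have "(\<integral>\<^sup>+x. f x \<partial>\<mu>) = (SUP i. \<integral>\<^sup>+x. F i x \<partial>\<mu>)"
      unfolding F(4)[symmetric] using F(2) borel_measurable_simple_function[OF simple]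
      by (intro nn_integral_monotone_convergence_SUP) auto
    also have "\<dots> = (SUP i. \<Sum>y\<in>F i ` S. y * emeasure \<mu> (F i -` {y} \<inter> S))"
      using simple by (simp add: nn_integral_eq_simple_integral simple_integral_def \<mu>)
    finally show ?thesis .
  qed
  moreover have "(\<lambda>\<mu>. SUP i. \<Sum>y\<in>F i ` S. y * emeasure \<mu> (F i -` {y} \<inter> S)) \<in>
      borel_measurable (measures_on S)"
    using F(1) by (intro borel_measurable_SUP borel_measurable_sum borel_measurable_times_ennreal
        borel_measurable_const measurable_emeasure_measures_on)
      (auto simp: simple_function_def space_borel_on)
  ultimately show ?thesis
    by (simp cong: measurable_cong)
qed

text \<open>An exhaustion of the punctured space by relatively compact sets: a set is bounded and bounded away
  from 0 if and only if it lies in some shell. Local finiteness need only be checked on shells, and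
  countably many almost sure statements can be combined.\<close>

definition shell :: "nat \<Rightarrow> 'a::euclidean_space set" where
  "shell n = {x. 1 / real (Suc n) \<le> norm x \<and> norm x \<le> real (Suc n)}"

lemma sets_shell [measurable]: "shell n \<in> sets borel"
  unfolding shell_def by measurable

lemma bounded_away_shell: "bounded_away (S \<inter> shell n)"
  unfolding bounded_away_def
proof
  show "bounded (S \<inter> shell n)"
    by (auto simp: bounded_iff shell_def)
  show "\<exists>r>0. \<forall>x\<in>S \<inter> shell n. r \<le> norm x"
    by (rule exI[of _ "1 / real (Suc n)"]) (simp add: shell_def)
qed

lemma bounded_away_subset_shell:
  assumes "bounded_away A" obtains n where "A \<subseteq> shell n"
proof -
  obtain K r where K: "\<And>x. x \<in> A \<Longrightarrow> norm x \<le> K" and r: "0 < r" "\<And>x. x \<in> A \<Longrightarrow> r \<le> norm x"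
    using assms by (auto simp: bounded_away_def bounded_iff)
  obtain n :: nat where n: "max K (1 / r) \<le> real n" using real_arch_simple by blast
  then have "1 / real (Suc n) \<le> r"
    using r(1) by (simp add: field_simps)
  then have "A \<subseteq> shell n"
    using K r n by (fastforce simp: shell_def)
  then show ?thesis by (rule that)
qed

lemma UN_shell: "(\<Union>n. shell n) = - {0}"
proof -
  have "x \<in> (\<Union>n. shell n)" if "x \<noteq> 0" for x :: 'a
  proof -
    have "bounded_away {x}"
      using that by (auto simp: bounded_away_def intro!: exI[of _ "norm x"])
    then show ?thesis by (metis UN_I UNIV_I bounded_away_subset_shell insert_subset)
  qed
  then show ?thesis by (auto simp: shell_def)
qed

lemma sets_Int_shell: "S \<inter> shell n \<in> sets (borel_on S)"
  by (auto simp: sets_restrict_space)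

lemma locally_finite_on_iff_shell:
  "locally_finite_on S \<mu> \<longleftrightarrow>
     sets \<mu> = sets (borel_on S) \<and> (\<forall>n. emeasure \<mu> (S \<inter> shell n) < \<infinity>)"
proof safe
  assume *: "sets \<mu> = sets (borel_on S)" "\<forall>n. emeasure \<mu> (S \<inter> shell n) < \<infinity>"
  show "locally_finite_on S \<mu>"
    unfolding locally_finite_on_def
  proof (safe del: notI)
    fix A assume A: "A \<in> sets (borel_on S)" "bounded_away A"
    then obtain n where "A \<subseteq> shell n" by (metis bounded_away_subset_shell)
    then have "A \<subseteq> S \<inter> shell n"
      using sets.sets_into_space[OF A(1)] by (auto simp: space_borel_on)
    then have "emeasure \<mu> A \<le> emeasure \<mu> (S \<inter> shell n)"
      using sets_Int_shell[of S n] by (intro emeasure_mono) (simp_all add: *(1))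
    then show "emeasure \<mu> A < \<infinity>" using *(2) by (auto intro: le_less_trans)
  qed (use * in auto)
next
  show "emeasure \<mu> (S \<inter> shell n) < \<infinity>" if "locally_finite_on S \<mu>" for n
    using that sets_Int_shell[of S n] bounded_away_shell[of S n] unfolding locally_finite_on_def by blast
qed (auto simp: locally_finite_on_def)

lemma point_process_sets:
  assumes "N \<in> measurable M (measures_on S)" "\<omega> \<in> space M"
  shows "sets (N \<omega>) = sets (borel_on S)" "space (N \<omega>) = S"
proof -
  show "sets (N \<omega>) = sets (borel_on S)"
    using measurable_space[OF assms] by (simp add: space_measures_on)
  from sets_eq_imp_space_eq[OF this] show "space (N \<omega>) = S"
    by (simp add: space_borel_on)
qed

lemma measurable_count:
  "N \<in> measurable M (measures_on S) \<Longrightarrow> A \<in> sets (borel_on S) \<Longrightarrow>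
     (\<lambda>\<omega>. emeasure (N \<omega>) A) \<in> borel_measurable M"
  using measurable_emeasure_measures_on measurable_compose by blast

section \<open>The Laplace functional of a Poisson process\<close>

definition poisson_laplace ::
    "'a::euclidean_space set \<Rightarrow> 'a measure \<Rightarrow> 'w measure \<Rightarrow> ('w \<Rightarrow> 'a measure) \<Rightarrow> bool" where
  "poisson_laplace S \<Lambda> M N \<longleftrightarrow> (\<forall>f\<in>borel_measurable (borel_on S).
     (\<integral>\<^sup>+\<omega>. expneg (\<integral>\<^sup>+x. f x \<partial>N \<omega>) \<partial>M) = expneg (\<integral>\<^sup>+x. (1 - expneg (f x)) \<partial>\<Lambda>))"

text \<open>The definition of a Poisson process prescribes the probabilities of finite counts; since counts are
  natural numbers or \<open>\<infinity>\<close>, this fixes the whole law.\<close>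

lemma distr_poisson_count:
  assumes P: "poisson_process S \<Lambda> M N" and A: "A \<in> sets (borel_on S)"
  shows "distr M borel (\<lambda>\<omega>. emeasure (N \<omega>) A) = poisson_law (emeasure \<Lambda> A)"
proof -
  have pp: "prob_space M" and N: "N \<in> measurable M (measures_on S)"
    and ae: "AE \<omega> in M. counting_on S (N \<omega>)"
    using P by (auto simp: poisson_process_def point_process_def)
  interpret prob_space M by fact
  note [measurable] = measurable_count[OF N A]
  show ?thesis
  proof (cases "emeasure \<Lambda> A = \<infinity>")
    case True
    then have "AE \<omega> in M. emeasure (N \<omega>) A = \<top>"
      using P A by (simp add: poisson_process_def)
    then have "distr M borel (\<lambda>\<omega>. emeasure (N \<omega>) A) = distr M borel (\<lambda>\<omega>. \<top>)"
      by (intro distr_cong_AE) auto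
    then show ?thesis
      using True by (simp add: poisson_law_def)
  next
    case False
    show ?thesis
    proof (rule measure_eqI_extended_nats)
      interpret D: prob_space "distr M borel (\<lambda>\<omega>. emeasure (N \<omega>) A)"
        by (rule prob_space_distr) measurable
      interpret L: prob_space "poisson_law (emeasure \<Lambda> A)"
        by (rule prob_space_poisson_law)
      show "finite_measure (distr M borel (\<lambda>\<omega>. emeasure (N \<omega>) A))"
        by (rule D.finite_measure_axioms)
      show "emeasure (distr M borel (\<lambda>\<omega>. emeasure (N \<omega>) A)) UNIV =
          emeasure (poisson_law (emeasure \<Lambda> A)) UNIV"
        using D.emeasure_space_1 L.emeasure_space_1 by simp
      show "AE x in distr M borel (\<lambda>\<omega>. emeasure (N \<omega>) A). x \<in> extended_nats"
        using ae by (subst AE_distr_iff) (auto elim: eventually_mono intro: counting_on_extended_nats[OF _ A])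
      fix n
      have "emeasure (distr M borel (\<lambda>\<omega>. emeasure (N \<omega>) A)) {of_nat n} =
          measure M {\<omega>\<in>space M. emeasure (N \<omega>) A = of_nat n}"
        by (simp add: emeasure_distr emeasure_eq_measure vimage_def Int_def conj_commute)
      also have "\<dots> = emeasure (poisson_law (emeasure \<Lambda> A)) {of_nat n}"
        using P A False
        by (simp add: poisson_process_def emeasure_poisson_law_of_nat less_top measure_def)
      finally show "emeasure (distr M borel (\<lambda>\<omega>. emeasure (N \<omega>) A)) {of_nat n} =
          emeasure (poisson_law (emeasure \<Lambda> A)) {of_nat n}" .
    qed (simp_all add: AE_poisson_law_extended_nats)
  qed
qed

text \<open>On the level sets of f the counts are independent Poisson variables, so that the expectation
  factorizes.\<close>

lemma laplace_poisson_process_simple: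
  assumes P: "poisson_process S \<Lambda> M N" and f: "simple_function (borel_on S) f"
  shows "(\<integral>\<^sup>+\<omega>. expneg (\<integral>\<^sup>+x. f x \<partial>N \<omega>) \<partial>M) = expneg (\<integral>\<^sup>+x. (1 - expneg (f x)) \<partial>\<Lambda>)"
proof -
  have pp: "prob_space M" and N: "N \<in> measurable M (measures_on S)"
    and \<Lambda>: "sets \<Lambda> = sets (borel_on S)"
    using P by (auto simp: poisson_process_def point_process_def locally_finite_on_def)
  interpret prob_space M by fact
  define m where "m = card (f ` S)"
  have fin: "finite (f ` S)" using f by (simp add: simple_function_def space_borel_on)
  then obtain h where h: "bij_betw h {..<m} (f ` S)"
    unfolding m_def using ex_bij_betw_nat_finite[of "f ` S"] by (auto simp: atLeast0LessThan)
  define B where "B i = {x\<in>S. f x = h i}" for i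
  have B: "B i \<in> sets (borel_on S)" for i
    using simple_functionD(2)[OF f, of "{h i}"]
    by (simp add: B_def space_borel_on vimage_def Int_def conj_commute)
  have disj: "disjoint_family_on B {..<m}"
    using h by (auto simp: disjoint_family_on_def B_def bij_betw_def inj_on_def)
  have int: "(\<integral>\<^sup>+x. g (f x) \<partial>\<mu>) = (\<Sum>i<m. g (h i) * emeasure \<mu> (B i))"
    if "sets \<mu> = sets (borel_on S)" for \<mu> and g :: "ennreal \<Rightarrow> ennreal"
  proof -
    have sp: "space \<mu> = S"
      using sets_eq_imp_space_eq[OF that] by (simp add: space_borel_on)
    have simple: "simple_function \<mu> f"
      using f that sp simple_function_cong_algebra[of \<mu> "borel_on S" f]
      by (simp add: space_borel_on)
    have "(\<integral>\<^sup>+x. g (f x) \<partial>\<mu>) = integral\<^sup>S \<mu> (\<lambda>x. g (f x))"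
      by (rule nn_integral_eq_simple_integral[OF simple_function_compose1[OF simple]])
    also have "\<dots> = (\<Sum>y\<in>f ` space \<mu>. g y * emeasure \<mu> {x\<in>space \<mu>. f x = y})"
      by (rule simple_function_partition[OF simple_function_compose1[OF simple] simple]) auto
    also have "\<dots> = (\<Sum>i<m. g (h i) * emeasure \<mu> (B i))"
      unfolding sp B_def by (rule sum.reindex_bij_betw[OF h, symmetric])
    finally show ?thesis .
  qed
  have "(\<integral>\<^sup>+\<omega>. expneg (\<integral>\<^sup>+x. f x \<partial>N \<omega>) \<partial>M) =
      (\<integral>\<^sup>+\<omega>. (\<Prod>i<m. expneg (h i * emeasure (N \<omega>) (B i))) \<partial>M)"
    using int[of _ "\<lambda>x. x"] point_process_sets(1)[OF N]
    by (intro nn_integral_cong) (simp add: expneg_sum)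
  also have "\<dots> = (\<Prod>i<m. \<integral>\<^sup>+\<omega>. expneg (h i * emeasure (N \<omega>) (B i)) \<partial>M)"
  proof (rule indep_vars_nn_integral)
    have "indep_vars (\<lambda>_. borel) (\<lambda>i \<omega>. emeasure (N \<omega>) (B i)) {..<m}"
      using P B disj by (simp add: poisson_process_def)
    then show "indep_vars (\<lambda>_. borel) (\<lambda>i \<omega>. expneg (h i * emeasure (N \<omega>) (B i))) {..<m}"
      by (rule indep_vars_compose2) measurable
  qed auto
  also have "\<dots> = (\<Prod>i<m. expneg ((1 - expneg (h i)) * emeasure \<Lambda> (B i)))"
  proof (rule prod.cong[OF refl])
    fix i
    have "(\<integral>\<^sup>+\<omega>. expneg (h i * emeasure (N \<omega>) (B i)) \<partial>M) =
        (\<integral>\<^sup>+x. expneg (h i * x) \<partial>distr M borel (\<lambda>\<omega>. emeasure (N \<omega>) (B i)))"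
      using measurable_count[OF N B] by (simp add: nn_integral_distr)
    then show "(\<integral>\<^sup>+\<omega>. expneg (h i * emeasure (N \<omega>) (B i)) \<partial>M) =
        expneg ((1 - expneg (h i)) * emeasure \<Lambda> (B i))"
      by (simp add: distr_poisson_count[OF P B] laplace_poisson_law)
  qed
  also have "\<dots> = expneg (\<integral>\<^sup>+x. (1 - expneg (f x)) \<partial>\<Lambda>)"
    using int[OF \<Lambda>, of "\<lambda>y. 1 - expneg y"] by (simp add: expneg_sum)
  finally show ?thesis .
qed

text \<open>Passage to the limit along simple functions increasing to f: dominated convergence on the left,
  monotone convergence on the right.\<close>

lemma poisson_process_imp_laplace:
  assumes P: "poisson_process S \<Lambda> M N"
  shows "poisson_laplace S \<Lambda> M N"
  unfolding poisson_laplace_def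
proof
  fix f :: "'a \<Rightarrow> ennreal" assume f: "f \<in> borel_measurable (borel_on S)"
  have pp: "prob_space M" and N: "N \<in> measurable M (measures_on S)"
    and \<Lambda>: "sets \<Lambda> = sets (borel_on S)"
    using P by (auto simp: poisson_process_def point_process_def locally_finite_on_def)
  interpret prob_space M by fact
  obtain F where F: "\<And>i. simple_function (borel_on S) (F i)" "incseq F" "\<And>i x. F i x < \<top>"
      "\<And>x. (SUP i. F i x) = f x"
    using borel_measurable_implies_simple_function_sequence'[OF f] by metis
  have Fm: "F i \<in> borel_measurable (borel_on S)" for i
    by (intro borel_measurable_simple_function F)
  have lim: "(\<lambda>i. F i x) \<longlonglongrightarrow> f x" for x
    unfolding F(4)[symmetric] using F(2) by (intro LIMSEQ_SUP) (auto simp: incseq_def le_fun_def)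
  have "(\<lambda>i. \<integral>\<^sup>+\<omega>. expneg (\<integral>\<^sup>+x. F i x \<partial>N \<omega>) \<partial>M) \<longlonglongrightarrow> (\<integral>\<^sup>+\<omega>. expneg (\<integral>\<^sup>+x. f x \<partial>N \<omega>) \<partial>M)"
  proof (rule nn_integral_dominated_convergence[where w="\<lambda>_. 1"])
    show "(\<lambda>\<omega>. expneg (\<integral>\<^sup>+x. F i x \<partial>N \<omega>)) \<in> borel_measurable M" for i
      using measurable_compose[OF N measurable_nn_integral_measures_on[OF Fm]] by measurable
    show "(\<lambda>\<omega>. expneg (\<integral>\<^sup>+x. f x \<partial>N \<omega>)) \<in> borel_measurable M"
      using measurable_compose[OF N measurable_nn_integral_measures_on[OF f]] by measurable
    show "AE \<omega> in M. (\<lambda>i. expneg (\<integral>\<^sup>+x. F i x \<partial>N \<omega>)) \<longlonglongrightarrow> expneg (\<integral>\<^sup>+x. f x \<partial>N \<omega>)"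
    proof (rule AE_I2)
      fix \<omega> assume "\<omega> \<in> space M"
      from point_process_sets(1)[OF N this]
      have "F i \<in> borel_measurable (N \<omega>)" for i
        using Fm[of i] by (simp cong: measurable_cong_sets)
      then show "(\<lambda>i. expneg (\<integral>\<^sup>+x. F i x \<partial>N \<omega>)) \<longlonglongrightarrow> expneg (\<integral>\<^sup>+x. f x \<partial>N \<omega>)"
        by (intro tendsto_expneg nn_integral_LIMSEQ F lim)
    qed
  qed (auto simp: emeasure_space_1)
  moreover have "(\<lambda>i. \<integral>\<^sup>+\<omega>. expneg (\<integral>\<^sup>+x. F i x \<partial>N \<omega>) \<partial>M) \<longlonglongrightarrow>
      expneg (\<integral>\<^sup>+x. (1 - expneg (f x)) \<partial>\<Lambda>)"
    unfolding laplace_poisson_process_simple[OF P F(1)]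
  proof (intro tendsto_expneg nn_integral_LIMSEQ)
    show "incseq (\<lambda>i x. 1 - expneg (F i x))"
      using F(2) by (auto simp: incseq_def le_fun_def intro!: ennreal_minus_mono expneg_antimono)
    show "(\<lambda>x. 1 - expneg (F i x)) \<in> borel_measurable \<Lambda>" for i
      using Fm[of i] by (simp cong: measurable_cong_sets[OF \<Lambda> refl])
    show "(\<lambda>i. 1 - expneg (F i x)) \<longlonglongrightarrow> 1 - expneg (f x)" for x
      by (intro tendsto_diff_ennreal tendsto_expneg lim tendsto_const) simp_all
  qed
  ultimately show "(\<integral>\<^sup>+\<omega>. expneg (\<integral>\<^sup>+x. f x \<partial>N \<omega>) \<partial>M) = expneg (\<integral>\<^sup>+x. (1 - expneg (f x)) \<partial>\<Lambda>)"
    by (rule LIMSEQ_unique)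
qed

text \<open>The Laplace functional at \<open>f = \<Sum> t\<^sub>i 1\<^bsub>B i\<^esub>\<close> is the Laplace transform of independent Poisson
  variables, so the joint law of the counts is the product of Poisson laws.\<close>

lemma poisson_laplace_boxes:
  fixes N :: "'w \<Rightarrow> 'a::euclidean_space measure" and B :: "nat \<Rightarrow> 'a set"
  assumes "prob_space M" and N: "N \<in> measurable M (measures_on S)"
    and ae: "AE \<omega> in M. counting_on S (N \<omega>)"
    and \<Lambda>: "sets \<Lambda> = sets (borel_on S)"
    and laplace: "poisson_laplace S \<Lambda> M N"
    and B: "\<And>i. i < m \<Longrightarrow> B i \<in> sets (borel_on S)" "disjoint_family_on B {..<m}"
    and C: "\<And>i. i < m \<Longrightarrow> C i \<in> sets borel"
  shows "emeasure M {\<omega>\<in>space M. \<forall>i<m. emeasure (N \<omega>) (B i) \<in> C i} =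
    (\<Prod>i<m. emeasure (poisson_law (emeasure \<Lambda> (B i))) (C i))"
proof -
  interpret prob_space M by fact
  define P where "P i = poisson_law (emeasure \<Lambda> (B i))" for i
  have [simp, measurable_cong]: "sets (P i) = sets borel" for i by (simp add: P_def)
  have [simp]: "space (P i) = UNIV" for i by (simp add: P_def)
  have probP: "prob_space (P i)" for i by (simp add: P_def prob_space_poisson_law)
  interpret P: product_prob_space P "{..<m}"
    by (intro product_prob_spaceI probP)
  have "emeasure M {\<omega>\<in>space M. \<forall>i\<in>{..<m}. emeasure (N \<omega>) (B i) \<in> C i} =
    emeasure (PiM {..<m} P) {x\<in>space (PiM {..<m} P). \<forall>i\<in>{..<m}. x i \<in> C i}"
  proof (rule emeasure_boxes_eqI_laplace)
    show "finite_measure (PiM {..<m} P)"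
      using prob_space_PiM[of "{..<m}" P] probP by (simp add: prob_space.finite_measure)
    fix i assume i: "i \<in> {..<m}"
    show "(\<lambda>\<omega>. emeasure (N \<omega>) (B i)) \<in> borel_measurable M"
      using measurable_count[OF N] B i by simp
    show "(\<lambda>x. x i) \<in> borel_measurable (PiM {..<m} P)"
      using measurable_component_singleton[OF i, of P] measurable_cong_sets[of "PiM {..<m} P" "PiM {..<m} P" "P i" borel] by simp
    show "AE \<omega> in M. emeasure (N \<omega>) (B i) \<in> extended_nats"
      using ae B i by (auto elim!: eventually_mono intro!: counting_on_extended_nats)
    show "AE x in PiM {..<m} P. x i \<in> extended_nats"
      by (rule AE_PiM_component[OF probP i]) (unfold P_def, rule AE_poisson_law_extended_nats)
  next
    fix t :: "nat \<Rightarrow> real"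
    define f where "f x = (\<Sum>i<m. ennreal (t i) * indicator (B i) x)" for x
    have f: "f \<in> borel_measurable (borel_on S)"
      unfolding f_def using B(1) by (intro borel_measurable_sum borel_measurable_times_ennreal) auto
    have int: "(\<integral>\<^sup>+x. (\<Sum>i<m. g i * indicator (B i) x) \<partial>\<mu>) = (\<Sum>i<m. g i * emeasure \<mu> (B i))"
      if "sets \<mu> = sets (borel_on S)" for \<mu> and g :: "nat \<Rightarrow> ennreal"
    proof -
      have "B i \<in> sets \<mu>" if "i < m" for i
        using B(1)[OF that] \<open>sets \<mu> = _\<close> by simp
      then show ?thesis
        by (subst nn_integral_sum) (auto simp: nn_integral_cmult_indicator)
    qed
    have "1 - expneg (f x) = (\<Sum>i<m. (1 - expneg (ennreal (t i))) * indicator (B i) x)" for x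
    proof (cases "\<exists>i<m. x \<in> B i")
      case True
      then obtain i where i: "i < m" "x \<in> B i" by auto
      then have "j < m \<Longrightarrow> x \<in> B j \<longleftrightarrow> j = i" for j
        using B(2) by (auto simp: disjoint_family_on_def)
      then have ind: "j < m \<Longrightarrow> indicator (B j) x = (if j = i then 1 else 0 :: ennreal)" for j
        by (auto simp: indicator_def)
      have "(\<Sum>j<m. g j * indicator (B j) x) = g i" for g :: "nat \<Rightarrow> ennreal"
      proof -
        have "(\<Sum>j<m. g j * indicator (B j) x) = (\<Sum>j<m. if j = i then g j else 0)"
          by (intro sum.cong) (auto simp: ind)
        then show ?thesis using i by simp
      qed
      then show ?thesis by (simp add: f_def)
    qed (auto simp: f_def)
    then have "(\<integral>\<^sup>+x. (1 - expneg (f x)) \<partial>\<Lambda>) = (\<Sum>i<m. (1 - expneg (ennreal (t i))) * emeasure \<Lambda> (B i))"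
      by (simp only: int[OF \<Lambda>])
    then have \<Lambda>_f: "expneg (\<integral>\<^sup>+x. (1 - expneg (f x)) \<partial>\<Lambda>) =
        expneg (\<Sum>i<m. (1 - expneg (ennreal (t i))) * emeasure \<Lambda> (B i))"
      by simp
    have N_f: "(\<integral>\<^sup>+x. f x \<partial>N \<omega>) = (\<Sum>i<m. ennreal (t i) * emeasure (N \<omega>) (B i))"
      if "\<omega> \<in> space M" for \<omega>
      unfolding f_def by (rule int[OF point_process_sets(1)[OF N that]])
    have "(\<integral>\<^sup>+\<omega>. expneg (\<Sum>i<m. ennreal (t i) * emeasure (N \<omega>) (B i)) \<partial>M) =
        (\<integral>\<^sup>+\<omega>. expneg (\<integral>\<^sup>+x. f x \<partial>N \<omega>) \<partial>M)"
      by (intro nn_integral_cong) (simp only: N_f)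
    also have "\<dots> = expneg (\<Sum>i<m. (1 - expneg (ennreal (t i))) * emeasure \<Lambda> (B i))"
      using laplace f \<Lambda>_f by (simp add: poisson_laplace_def)
    also have "\<dots> = (\<Prod>i<m. \<integral>\<^sup>+x. expneg (ennreal (t i) * x) \<partial>P i)"
      by (simp add: expneg_sum P_def laplace_poisson_law)
    also have "\<dots> = (\<integral>\<^sup>+x. (\<Prod>i<m. expneg (ennreal (t i) * x i)) \<partial>PiM {..<m} P)"
      by (rule P.product_nn_integral_prod[symmetric]) (simp, measurable)
    finally show "(\<integral>\<^sup>+\<omega>. expneg (\<Sum>i<m. ennreal (t i) * emeasure (N \<omega>) (B i)) \<partial>M) =
        (\<integral>\<^sup>+x. expneg (\<Sum>i<m. ennreal (t i) * x i) \<partial>PiM {..<m} P)"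
      by (simp add: expneg_sum)
  qed (use C finite_measure_axioms in auto)
  also have "{x\<in>space (PiM {..<m} P). \<forall>i\<in>{..<m}. x i \<in> C i} = (\<Pi>\<^sub>E i\<in>{..<m}. C i)"
    by (simp add: space_PiM PiE_def Pi_def set_eq_iff conj_commute Ball_def)
  also have "emeasure (PiM {..<m} P) \<dots> = (\<Prod>i<m. emeasure (P i) (C i))"
    using C by (intro P.emeasure_PiM) auto
  finally show ?thesis by (simp add: P_def Ball_def)
qed

text \<open>The joint laws of the counts give the Poisson probabilities and the independence. Almost sure local
  finiteness follows because each of the countably many shells has finite intensity, hence almost
  surely a finite count.\<close>

lemma laplace_imp_poisson_process:
  fixes N :: "'w \<Rightarrow> 'a::euclidean_space measure"
  assumes "prob_space M" and N: "N \<in> measurable M (measures_on S)"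
    and ae: "AE \<omega> in M. counting_on S (N \<omega>)"
    and \<Lambda>: "locally_finite_on S \<Lambda>"
    and laplace: "poisson_laplace S \<Lambda> M N"
  shows "poisson_process S \<Lambda> M N"
proof -
  interpret prob_space M by fact
  have sets_\<Lambda>: "sets \<Lambda> = sets (borel_on S)"
    using \<Lambda> by (simp add: locally_finite_on_def)
  note boxes = poisson_laplace_boxes[OF \<open>prob_space M\<close> N ae sets_\<Lambda> laplace]
  have law: "emeasure M {\<omega>\<in>space M. emeasure (N \<omega>) A \<in> C} = emeasure (poisson_law (emeasure \<Lambda> A)) C"
    if "A \<in> sets (borel_on S)" "C \<in> sets borel" for A C
    using boxes[of 1 "\<lambda>_. A" "\<lambda>_. C"] that by (simp add: disjoint_family_on_def)
  have infinite: "AE \<omega> in M. emeasure (N \<omega>) A = \<top> \<longleftrightarrow> emeasure \<Lambda> A = \<top>"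
    if A: "A \<in> sets (borel_on S)" for A
  proof -
    note [measurable] = measurable_count[OF N A]
    have "emeasure M {\<omega>\<in>space M. emeasure (N \<omega>) A \<in> {\<top>}} = (if emeasure \<Lambda> A = \<top> then 1 else 0)"
      using law[OF A, of "{\<top>}"] by (simp add: emeasure_poisson_law_infinity)
    then show ?thesis
      by (cases "emeasure \<Lambda> A = \<top>") (simp_all add: emeasure_eq_measure prob_Collect_eq_1 prob_Collect_eq_0)
  qed
  have "AE \<omega> in M. \<forall>n. emeasure (N \<omega>) (S \<inter> shell n) < \<infinity>"
    unfolding AE_all_countable
  proof
    fix n
    have "emeasure \<Lambda> (S \<inter> shell n) \<noteq> \<top>"
      using \<Lambda> by (simp add: locally_finite_on_iff_shell less_top)
    then show "AE \<omega> in M. emeasure (N \<omega>) (S \<inter> shell n) < \<infinity>"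
      using infinite[OF sets_Int_shell, of n] by (auto elim: eventually_mono simp: less_top)
  qed
  with AE_space have "AE \<omega> in M. locally_finite_on S (N \<omega>)"
    by eventually_elim (simp add: locally_finite_on_iff_shell point_process_sets(1)[OF N])
  with ae N \<open>prob_space M\<close> have "point_process S M N"
    by (simp add: point_process_def)
  moreover have "measure M {\<omega>\<in>space M. emeasure (N \<omega>) A = of_nat n} =
      measure \<Lambda> A ^ n / fact n * exp (- measure \<Lambda> A)"
    if "A \<in> sets (borel_on S)" "emeasure \<Lambda> A < \<infinity>" for A n
    using law[OF that(1), of "{of_nat n}"] that(2)
    by (simp add: emeasure_poisson_law_of_nat emeasure_eq_measure measure_def[of \<Lambda>] less_top)
  moreover have "AE \<omega> in M. emeasure (N \<omega>) A = \<infinity>"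
    if "A \<in> sets (borel_on S)" "emeasure \<Lambda> A = \<infinity>" for A
    using infinite[OF that(1)] that(2) by simp
  moreover have "indep_vars (\<lambda>_. borel) (\<lambda>i \<omega>. emeasure (N \<omega>) (B i)) {..<m}"
    if B: "\<forall>i<m. B i \<in> sets (borel_on S)" "disjoint_family_on B {..<m}" for m :: nat and B
    unfolding indep_vars_def2
  proof (intro conjI ballI indep_setsI)
    show "random_variable borel (\<lambda>\<omega>. emeasure (N \<omega>) (B i))" if "i \<in> {..<m}" for i
      using that B measurable_count[OF N] by auto
    then show "{(\<lambda>\<omega>. emeasure (N \<omega>) (B i)) -` A \<inter> space M |A. A \<in> sets borel} \<subseteq> events"
      if "i \<in> {..<m}" for i
      using that by (auto intro: measurable_sets)
    fix A J assume J: "J \<noteq> {}" "J \<subseteq> {..<m}" "finite J"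
      and "\<forall>j\<in>J. A j \<in> {(\<lambda>\<omega>. emeasure (N \<omega>) (B j)) -` A \<inter> space M |A. A \<in> sets borel}"
    then have "\<forall>j\<in>J. \<exists>C. C \<in> sets borel \<and> A j = {\<omega>\<in>space M. emeasure (N \<omega>) (B j) \<in> C}"
      by (auto simp: vimage_def Int_def conj_commute)
    then obtain C where C: "j \<in> J \<Longrightarrow> C j \<in> sets borel"
      "j \<in> J \<Longrightarrow> A j = {\<omega>\<in>space M. emeasure (N \<omega>) (B j) \<in> C j}" for j
      by metis
    \<comment> \<open>A subfamily is handled by leaving the other coordinates unrestricted.\<close>
    define D where "D i = (if i \<in> J then C i else UNIV)" for i
    have D: "D i \<in> sets borel" for i using C by (simp add: D_def)
    have "(\<Inter>j\<in>J. A j) = {\<omega>\<in>space M. \<forall>i<m. emeasure (N \<omega>) (B i) \<in> D i}"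
      using J C(2) by (auto simp: D_def)
    then have "ennreal (prob (\<Inter>j\<in>J. A j)) = (\<Prod>i<m. emeasure (poisson_law (emeasure \<Lambda> (B i))) (D i))"
      using boxes[of m B D] B D by (simp add: emeasure_eq_measure)
    also have "\<dots> = (\<Prod>i\<in>J. emeasure (poisson_law (emeasure \<Lambda> (B i))) (D i))"
    proof (rule prod.mono_neutral_right)
      show "\<forall>i\<in>{..<m} - J. emeasure (poisson_law (emeasure \<Lambda> (B i))) (D i) = 1"
        using prob_space.emeasure_space_1[OF prob_space_poisson_law] by (simp add: D_def)
    qed (use J in auto)
    also have "\<dots> = (\<Prod>i\<in>J. ennreal (prob (A i)))"
    proof (intro prod.cong refl)
      fix i assume i: "i \<in> J"
      then have "B i \<in> sets (borel_on S)" using B J by auto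
      from law[OF this D[of i]] show "emeasure (poisson_law (emeasure \<Lambda> (B i))) (D i) = ennreal (prob (A i))"
        using i by (simp add: C(2) D_def emeasure_eq_measure)
    qed
    also have "\<dots> = ennreal (\<Prod>i\<in>J. prob (A i))"
      by (simp add: prod_ennreal)
    finally show "prob (\<Inter>j\<in>J. A j) = (\<Prod>j\<in>J. prob (A j))"
      by (simp add: prod_nonneg)
  qed
  ultimately show ?thesis
    using \<Lambda> by (auto simp: poisson_process_def)
qed

lemma poisson_process_unique:
  assumes "poisson_process S \<Lambda> M N" "poisson_process S \<Lambda> M' N'"
  shows "same_distribution S M N M' N'"
proof -
  have "point_process S M N" "point_process S M' N'"
    using assms by (simp_all add: poisson_process_def)
  moreover from this have "distr M (measures_on S) N = distr M' (measures_on S) N'"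
    using assms[THEN poisson_process_imp_laplace]
    by (intro distr_measures_on_eqI)
       (auto simp: point_process_def poisson_laplace_def prob_space.finite_measure)
  ultimately show ?thesis
    by (simp add: same_distribution_def)
qed

text \<open>Since \<^const>\<open>expneg\<close> is injective on \<open>[0, \<infinity>]\<close>, this recovers the intensity of every
  measurable set, of infinite intensity or not, from the distribution of N.\<close>

lemma void_probability:
  assumes P: "poisson_process S \<Lambda> M N" and A: "A \<in> sets (borel_on S)"
  shows "emeasure M {\<omega>\<in>space M. emeasure (N \<omega>) A = 0} = expneg (emeasure \<Lambda> A)"
proof -
  have N: "N \<in> measurable M (measures_on S)"
    using P by (simp add: poisson_process_def point_process_def)
  note [measurable] = measurable_count[OF N A]
  have "emeasure M {\<omega>\<in>space M. emeasure (N \<omega>) A = 0} =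
      emeasure (distr M borel (\<lambda>\<omega>. emeasure (N \<omega>) A)) {0}"
    by (simp add: emeasure_distr vimage_def Int_def conj_commute)
  also have "\<dots> = expneg (emeasure \<Lambda> A)"
    using emeasure_poisson_law_of_nat[of "emeasure \<Lambda> A" 0]
    by (cases "emeasure \<Lambda> A = \<top>")
       (simp_all add: distr_poisson_count[OF P A] expneg_def, simp add: poisson_law_def)
  finally show ?thesis .
qed

section \<open>Sums of Dirac measures\<close>

lemma measurable_measures_onI:
  assumes "\<And>\<omega>. \<omega> \<in> space M \<Longrightarrow> sets (N \<omega>) = sets (borel_on S)"
    and "\<And>A. A \<in> sets (borel_on S) \<Longrightarrow> (\<lambda>\<omega>. emeasure (N \<omega>) A) \<in> borel_measurable M"
  shows "N \<in> measurable M (measures_on S)"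
  unfolding measures_on_def
  using assms by (intro measurable_Sup2) (auto intro!: measurable_vimage_algebra2)

lemma measurable_dirac_sum:
  assumes "\<And>k. X k \<in> measurable M (borel_on S)"
  shows "(\<lambda>\<omega>. dirac_sum S (\<lambda>k. X k \<omega>)) \<in> measurable M (measures_on S)"
proof (rule measurable_measures_onI)
  show "(\<lambda>\<omega>. emeasure (dirac_sum S (\<lambda>k. X k \<omega>)) A) \<in> borel_measurable M"
    if A: "A \<in> sets (borel_on S)" for A
    unfolding emeasure_dirac_sum[OF A]
    by (intro borel_measurable_suminf_order measurable_compose[OF assms borel_measurable_indicator[OF A]])
qed (simp add: sets_dirac_sum)

lemma counting_on_dirac_sum: "counting_on S (dirac_sum S x)"
  unfolding counting_on_def
proof (intro conjI ballI sets_dirac_sum)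
  fix A assume A: "A \<in> sets (borel_on S)"
  have "emeasure (dirac_sum S x) A = (\<integral>\<^sup>+k. indicator A (x k) \<partial>count_space UNIV)"
    by (simp add: emeasure_dirac_sum[OF A] nn_integral_count_space_nat)
  also have "\<dots> = (\<integral>\<^sup>+k. indicator {k. x k \<in> A} k \<partial>count_space UNIV)"
    by (intro nn_integral_cong) (simp add: indicator_def)
  also have "\<dots> = emeasure (count_space UNIV) {k. x k \<in> A}"
    by (subst nn_integral_indicator) auto
  finally show "emeasure (dirac_sum S x) A = \<infinity> \<or> (\<exists>n::nat. emeasure (dirac_sum S x) A = of_nat n)"
    by (cases "finite {k. x k \<in> A}") (auto simp: emeasure_count_space_finite emeasure_count_space_infinite)
qed

text \<open>The image of counting measure under the enumeration; integrals against the process thereby become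
  series.\<close>

lemma dirac_sum_eq_distr:
  assumes "\<And>k. x k \<in> S"
  shows "dirac_sum S x = distr (count_space UNIV) (borel_on S) x"
proof (rule measure_eqI)
  fix A assume "A \<in> sets (dirac_sum S x)"
  then have A: "A \<in> sets (borel_on S)" by (simp add: sets_dirac_sum)
  have x: "x \<in> measurable (count_space UNIV) (borel_on S)"
    using assms by (auto simp: space_borel_on)
  have "emeasure (dirac_sum S x) A = (\<integral>\<^sup>+k. indicator A (x k) \<partial>count_space UNIV)"
    by (simp add: emeasure_dirac_sum[OF A] nn_integral_count_space_nat)
  also have "\<dots> = emeasure (distr (count_space UNIV) (borel_on S) x) A"
    using A x by (subst nn_integral_distr[OF x, symmetric]) auto
  finally show "emeasure (dirac_sum S x) A = emeasure (distr (count_space UNIV) (borel_on S) x) A" .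
qed (simp add: sets_dirac_sum)

lemma nn_integral_dirac_sum:
  assumes x: "\<And>k. x k \<in> S" and f: "f \<in> borel_measurable (borel_on S)"
  shows "(\<integral>\<^sup>+y. f y \<partial>dirac_sum S x) = (\<Sum>k. f (x k))"
proof -
  have "x \<in> measurable (count_space UNIV) (borel_on S)"
    using x by (auto simp: space_borel_on)
  then show ?thesis
    using f by (simp add: dirac_sum_eq_distr[OF x] nn_integral_distr nn_integral_count_space_nat)
qed

lemma sigma_finite_locally_finite:
  assumes \<Lambda>: "locally_finite_on S \<Lambda>" and S: "S \<subseteq> - {0}"
  shows "sigma_finite_measure \<Lambda>"
proof
  have sets: "sets \<Lambda> = sets (borel_on S)" and fin: "\<And>n. emeasure \<Lambda> (S \<inter> shell n) < \<infinity>"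
    using \<Lambda> by (simp_all add: locally_finite_on_iff_shell)
  have "space \<Lambda> = S"
    using sets_eq_imp_space_eq[OF sets] by (simp add: space_borel_on)
  moreover have "(\<Union>n. S \<inter> shell n) = S"
    using S UN_shell by blast
  moreover have "S \<inter> shell n \<in> sets \<Lambda>" for n
    unfolding sets by (rule sets_Int_shell)
  ultimately show "\<exists>A. countable A \<and> A \<subseteq> sets \<Lambda> \<and> \<Union> A = space \<Lambda> \<and> (\<forall>a\<in>A. emeasure \<Lambda> a \<noteq> \<infinity>)"
    using fin by (intro exI[of _ "range (\<lambda>n. S \<inter> shell n)"]) (auto simp: less_top)
qed

section \<open>The scale-invariant intensity on the half-line\<close>

lemma sets_eta_intensity [measurable_cong]: "sets (eta_intensity c) = sets (borel_on {0<..})"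
  by (simp add: eta_intensity_def sets_restrict_space)

lemma space_eta_intensity: "space (eta_intensity c) = {0<..}"
  by (simp add: eta_intensity_def space_restrict_space)

lemma nn_integral_eta_intensity:
  assumes g: "g \<in> borel_measurable (borel_on {0<..})"
  shows "(\<integral>\<^sup>+t. g t \<partial>eta_intensity c) = (\<integral>\<^sup>+t. ennreal (c / t) * (g t * indicator {0<..} t) \<partial>lborel)"
proof -
  have g': "g \<in> borel_measurable (restrict_space lborel {0<..})"
    using g measurable_cong_sets[of "borel_on {0<..}" "restrict_space lborel {0<..}" borel borel]
    by (simp add: sets_restrict_space)
  have "(\<lambda>t. ennreal (c / t)) \<in> borel_measurable (restrict_space lborel {0<..})"
    by (intro measurable_restrict_space1) measurable
  then show ?thesis
    using g' by (simp add: eta_intensity_def nn_integral_density nn_integral_restrict_space mult.assoc)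
qed

text \<open>The measure \<open>dt/t\<close> is invariant under dilations: substituting \<open>r t\<close> for t in the Lebesgue
  integral produces a factor r, which cancels against the density.\<close>

lemma eta_intensity_scale:
  assumes g: "g \<in> borel_measurable (borel_on {0<..})" and r: "0 < r" and c: "0 \<le> c"
  shows "(\<integral>\<^sup>+t. g (r * t) \<partial>eta_intensity c) = (\<integral>\<^sup>+t. g t \<partial>eta_intensity c)"
proof -
  have g' [measurable]: "(\<lambda>t. g t * indicator {0<..} t) \<in> borel_measurable borel"
    using g by (subst (asm) borel_measurable_restrict_space_iff_ennreal) auto
  have "(\<lambda>t. r * t) \<in> measurable (borel_on {0<..}) (borel_on {0<..})"
    using r by (intro measurable_restrict_space3) auto
  from measurable_compose[OF this g]
  have gr: "(\<lambda>t. g (r * t)) \<in> borel_measurable (borel_on {0<..})" .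
  have "(\<integral>\<^sup>+t. g t \<partial>eta_intensity c) = (\<integral>\<^sup>+t. ennreal (c / t) * (g t * indicator {0<..} t) \<partial>lborel)"
    by (rule nn_integral_eta_intensity[OF g])
  also have "\<dots> = ennreal r * (\<integral>\<^sup>+t. ennreal (c / (r * t)) * (g (r * t) * indicator {0<..} (r * t)) \<partial>lborel)"
    using r by (subst nn_integral_real_affine[where c=r and t=0]) auto
  also have "\<dots> = (\<integral>\<^sup>+t. ennreal r * (ennreal (c / (r * t)) * (g (r * t) * indicator {0<..} (r * t))) \<partial>lborel)"
    by (intro nn_integral_cmult[symmetric]) measurable
  also have "\<dots> = (\<integral>\<^sup>+t. ennreal (c / t) * (g (r * t) * indicator {0<..} t) \<partial>lborel)"
  proof (intro nn_integral_cong)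
    fix t :: real
    show "ennreal r * (ennreal (c / (r * t)) * (g (r * t) * indicator {0<..} (r * t))) =
        ennreal (c / t) * (g (r * t) * indicator {0<..} t)"
    proof (cases "0 < t")
      case True
      then have "ennreal r * ennreal (c / (r * t)) = ennreal (c / t)"
        using r c by (simp add: ennreal_mult[symmetric])
      then show ?thesis
        using True r by (simp add: mult.assoc[symmetric])
    qed (use r in \<open>simp add: zero_less_mult_iff\<close>)
  qed
  also have "\<dots> = (\<integral>\<^sup>+t. g (r * t) \<partial>eta_intensity c)"
    by (rule nn_integral_eta_intensity[OF gr, symmetric])
  finally show ?thesis ..
qed

lemma eta_intensity_interval:
  assumes "0 < a" "a \<le> b" "0 \<le> c"
  shows "(\<integral>\<^sup>+t. indicator {a..b} t \<partial>eta_intensity c) = ennreal (c * (ln b - ln a))"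
proof -
  have ind: "(indicator {a..b} :: real \<Rightarrow> ennreal) \<in> borel_measurable (borel_on {0<..})"
    by (intro measurable_restrict_space1) measurable
  have "(\<integral>\<^sup>+t. indicator {a..b} t \<partial>eta_intensity c) = (\<integral>\<^sup>+t. ennreal (c / t) * indicator {a..b} t \<partial>lborel)"
    unfolding nn_integral_eta_intensity[OF ind] using assms
    by (intro nn_integral_cong) (auto simp: indicator_def)
  also have "\<dots> = ennreal (c * ln b - c * ln a)"
    using assms by (intro nn_integral_FTC_Icc[where F="\<lambda>x. c * ln x"])
      (auto intro!: derivative_eq_intros)
  finally show ?thesis by (simp add: right_diff_distrib)
qed

lemma locally_finite_eta_intensity:
  assumes "0 \<le> c" shows "locally_finite_on {0<..} (eta_intensity c)"
  unfolding locally_finite_on_iff_shell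
proof (intro conjI allI)
  fix n
  have eq: "{0<..} \<inter> shell n = {1 / real (Suc n)..real (Suc n)}"
  proof -
    have "0 < t" if "1 / real (Suc n) \<le> t" for t
      using that by (rule less_le_trans[rotated]) simp
    then show ?thesis by (auto simp: shell_def abs_of_pos)
  qed
  have "emeasure (eta_intensity c) ({0<..} \<inter> shell n) =
      (\<integral>\<^sup>+t. indicator ({0<..} \<inter> shell n) t \<partial>eta_intensity c)"
    by (rule nn_integral_indicator[symmetric]) (unfold sets_eta_intensity, rule sets_Int_shell)
  also have "\<dots> = ennreal (c * (ln (real (Suc n)) - ln (1 / real (Suc n))))"
    unfolding eq using assms by (intro eta_intensity_interval) (auto simp: field_simps)
  finally show "emeasure (eta_intensity c) ({0<..} \<inter> shell n) < \<infinity>" by simp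
qed (simp add: sets_eta_intensity)

lemma sigma_finite_eta_intensity: "0 \<le> c \<Longrightarrow> sigma_finite_measure (eta_intensity c)"
  by (rule sigma_finite_locally_finite[OF locally_finite_eta_intensity]) auto

section \<open>The intensity of an uplifted process\<close>

lemma measurable_scaleR_pair:
  "(\<lambda>p. fst p *\<^sub>R snd p) \<in> measurable (borel_on {0<..} \<Otimes>\<^sub>M borel_on (- {0})) (borel_on (- {0 :: 'a::euclidean_space}))"
proof (rule measurable_restrict_space2)
  have id: "(\<lambda>x. x) \<in> measurable (borel_on A) borel" for A :: "'b::topological_space set"
    by (intro measurable_restrict_space1) simp
  have "(\<lambda>p. fst p) \<in> measurable (borel_on {0::real<..} \<Otimes>\<^sub>M borel_on (- {0 :: 'a})) borel"
    by (rule measurable_compose[OF measurable_fst id])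
  moreover have "(\<lambda>p. snd p) \<in> measurable (borel_on {0::real<..} \<Otimes>\<^sub>M borel_on (- {0 :: 'a})) borel"
    by (rule measurable_compose[OF measurable_snd id])
  ultimately show "(\<lambda>p. fst p *\<^sub>R snd p) \<in> borel_measurable (borel_on {0<..} \<Otimes>\<^sub>M borel_on (- {0 :: 'a}))"
    by measurable
qed (auto simp: space_pair_measure space_borel_on)

lemma measurable_scaleR_const:
  assumes "v \<noteq> 0"
  shows "(\<lambda>t. t *\<^sub>R v) \<in> measurable (borel_on {0<..}) (borel_on (- {0 :: 'a::euclidean_space}))"
  using assms by (intro measurable_restrict_space3) auto

text \<open>The image of \<open>c dt/t \<otimes> Q\<close> under \<open>(t, v) \<mapsto> t v\<close>.\<close>

definition uplift_intensity :: "real \<Rightarrow> 'a measure \<Rightarrow> 'a::euclidean_space measure" where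
  "uplift_intensity c Q =
     distr (eta_intensity c \<Otimes>\<^sub>M Q) (borel_on (- {0})) (\<lambda>p. fst p *\<^sub>R snd p)"

lemma sets_uplift_intensity [measurable_cong]: "sets (uplift_intensity c Q) = sets (borel_on (- {0}))"
  by (simp add: uplift_intensity_def)

lemma nn_integral_uplift_intensity:
  assumes Q: "sigma_finite_measure Q" "sets Q = sets (borel_on (- {0}))"
    and f: "f \<in> borel_measurable (borel_on (- {0}))"
  shows "(\<integral>\<^sup>+x. f x \<partial>uplift_intensity c Q) = (\<integral>\<^sup>+t. \<integral>\<^sup>+v. f (t *\<^sub>R v) \<partial>Q \<partial>eta_intensity c)"
proof -
  interpret Q: sigma_finite_measure Q by fact
  have m: "(\<lambda>p. fst p *\<^sub>R snd p) \<in> measurable (eta_intensity c \<Otimes>\<^sub>M Q) (borel_on (- {0}))"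
    using measurable_scaleR_pair
    by (simp cong: measurable_cong_sets sets_pair_measure_cong add: Q(2) sets_eta_intensity)
  have "(\<integral>\<^sup>+x. f x \<partial>uplift_intensity c Q) = (\<integral>\<^sup>+p. f (fst p *\<^sub>R snd p) \<partial>(eta_intensity c \<Otimes>\<^sub>M Q))"
    unfolding uplift_intensity_def using m f by (simp add: nn_integral_distr)
  also have "\<dots> = (\<integral>\<^sup>+t. \<integral>\<^sup>+v. f (t *\<^sub>R v) \<partial>Q \<partial>eta_intensity c)"
    using Q.nn_integral_fst[OF measurable_compose[OF m f]] by simp
  finally show ?thesis .
qed

text \<open>Polar form: for fixed v the factor \<open>\<parallel>v\<parallel>\<close> is absorbed into t by the scale invariance of \<open>dt/t\<close>.\<close>

lemma nn_integral_uplift_intensity_sphere: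
  assumes Q: "sigma_finite_measure Q" "sets Q = sets (borel_on (- {0}))" and c: "0 \<le> c"
    and f: "f \<in> borel_measurable (borel_on (- {0}))"
  shows "(\<integral>\<^sup>+x. f x \<partial>uplift_intensity c Q) =
    (\<integral>\<^sup>+v. \<integral>\<^sup>+t. f (t *\<^sub>R (v /\<^sub>R norm v)) \<partial>eta_intensity c \<partial>Q)"
proof -
  interpret Q: sigma_finite_measure Q by fact
  interpret eta: sigma_finite_measure "eta_intensity c" by (rule sigma_finite_eta_intensity[OF c])
  interpret pair_sigma_finite "eta_intensity c" Q ..
  have m: "(\<lambda>p. fst p *\<^sub>R snd p) \<in> measurable (eta_intensity c \<Otimes>\<^sub>M Q) (borel_on (- {0}))"
    using measurable_scaleR_pair
    by (simp cong: measurable_cong_sets sets_pair_measure_cong add: Q(2) sets_eta_intensity)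
  have "(\<integral>\<^sup>+x. f x \<partial>uplift_intensity c Q) = (\<integral>\<^sup>+v. \<integral>\<^sup>+t. f (t *\<^sub>R v) \<partial>eta_intensity c \<partial>Q)"
    unfolding nn_integral_uplift_intensity[OF Q f]
    using Fubini[OF measurable_compose[OF m f]] by simp
  also have "\<dots> = (\<integral>\<^sup>+v. \<integral>\<^sup>+t. f (t *\<^sub>R (v /\<^sub>R norm v)) \<partial>eta_intensity c \<partial>Q)"
  proof (rule nn_integral_cong)
    fix v assume "v \<in> space Q"
    then have v: "v \<noteq> 0"
      using sets_eq_imp_space_eq[OF Q(2)] by (simp add: space_borel_on)
    have "(\<lambda>t. f (t *\<^sub>R (v /\<^sub>R norm v))) \<in> borel_measurable (borel_on {0<..})"
      using v by (intro measurable_compose[OF measurable_scaleR_const f]) simp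
    note scale = eta_intensity_scale[where g = "\<lambda>t. f (t *\<^sub>R (v /\<^sub>R norm v))", OF this _ c]
    have "norm v * t * inverse (norm v) = t" for t
      using v by simp
    then have "(norm v * t) *\<^sub>R (v /\<^sub>R norm v) = t *\<^sub>R v" for t
      unfolding scaleR_scaleR by (simp only:)
    then    show "(\<integral>\<^sup>+t. f (t *\<^sub>R v) \<partial>eta_intensity c) = (\<integral>\<^sup>+t. f (t *\<^sub>R (v /\<^sub>R norm v)) \<partial>eta_intensity c)"
      using scale[of "norm v"] v by (simp only: zero_less_norm_iff simp_thms)
  qed
  finally show ?thesis .
qed

text \<open>Both sides have the same polar form, because normalization is idempotent.\<close>

lemma uplift_intensity_normalize:
  assumes Q: "prob_space Q" "sets Q = sets (borel_on (- {0}))" and c: "0 \<le> c"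
  shows "uplift_intensity c (distr Q (borel_on (- {0})) (\<lambda>v. v /\<^sub>R norm v)) = uplift_intensity c Q"
    (is "uplift_intensity c ?Q' = _")
proof (rule measure_eqI)
  interpret Q: prob_space Q by fact
  have m: "(\<lambda>v. v /\<^sub>R norm v) \<in> measurable Q (borel_on (- {0}))"
    unfolding measurable_cong_sets[OF Q(2) refl]
    by (intro measurable_restrict_space3) auto
  then interpret Q': prob_space ?Q' by (rule Q.prob_space_distr)
  interpret eta: sigma_finite_measure "eta_intensity c" by (rule sigma_finite_eta_intensity[OF c])
  fix A assume "A \<in> sets (uplift_intensity c ?Q')"
  then have A: "A \<in> sets (borel_on (- {0}))" by (simp add: sets_uplift_intensity)
  then have f: "(indicator A :: 'a \<Rightarrow> ennreal) \<in> borel_measurable (borel_on (- {0}))" by simp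
  have mm: "(\<lambda>v. \<integral>\<^sup>+t. indicator A (t *\<^sub>R (v /\<^sub>R norm v)) \<partial>eta_intensity c) \<in> borel_measurable (borel_on (- {0}))"
  proof (rule eta.borel_measurable_nn_integral)
    have "(\<lambda>p. (snd p, fst p /\<^sub>R norm (fst p))) \<in>
        measurable (borel_on (- {0 :: 'a}) \<Otimes>\<^sub>M eta_intensity c) (borel_on {0<..} \<Otimes>\<^sub>M borel_on (- {0}))"
      using measurable_compose[OF measurable_fst m]
      by (intro measurable_Pair) (simp_all cong: measurable_cong_sets add: Q(2) sets_eta_intensity measurable_snd'')
    from measurable_compose[OF measurable_compose[OF this measurable_scaleR_pair] f]
    show "(\<lambda>(v, t). indicator A (t *\<^sub>R (v /\<^sub>R norm v)) :: ennreal) \<in> borel_measurable (borel_on (- {0}) \<Otimes>\<^sub>M eta_intensity c)"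
      by (simp add: split_beta')
  qed
  have "(\<integral>\<^sup>+x. indicator A x \<partial>uplift_intensity c ?Q') =
      (\<integral>\<^sup>+v. \<integral>\<^sup>+t. indicator A (t *\<^sub>R (v /\<^sub>R norm v)) \<partial>eta_intensity c \<partial>?Q')"
    by (rule nn_integral_uplift_intensity_sphere[OF Q'.sigma_finite_measure_axioms _ c f]) simp
  also have "\<dots> = (\<integral>\<^sup>+v. \<integral>\<^sup>+t. indicator A (t *\<^sub>R ((v /\<^sub>R norm v) /\<^sub>R norm (v /\<^sub>R norm v))) \<partial>eta_intensity c \<partial>Q)"
    by (rule nn_integral_distr[OF m]) (use mm in simp)
  also have "\<dots> = (\<integral>\<^sup>+v. \<integral>\<^sup>+t. indicator A (t *\<^sub>R (v /\<^sub>R norm v)) \<partial>eta_intensity c \<partial>Q)"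
  proof (intro nn_integral_cong)
    fix v t assume "v \<in> space Q"
    then have "v \<noteq> 0"
      using sets_eq_imp_space_eq[OF Q(2)] by (simp add: space_borel_on)
    then have "(v /\<^sub>R norm v) /\<^sub>R norm (v /\<^sub>R norm v) = v /\<^sub>R norm v"
      by simp
    then show "indicator A (t *\<^sub>R ((v /\<^sub>R norm v) /\<^sub>R norm (v /\<^sub>R norm v))) =
        (indicator A (t *\<^sub>R (v /\<^sub>R norm v)) :: ennreal)"
      by (simp only:)
  qed
  also have "\<dots> = (\<integral>\<^sup>+x. indicator A x \<partial>uplift_intensity c Q)"
    by (rule nn_integral_uplift_intensity_sphere[OF Q.sigma_finite_measure_axioms Q(2) c f, symmetric])
  finally show "emeasure (uplift_intensity c ?Q') A = emeasure (uplift_intensity c Q) A"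
    using A by (simp add: sets_uplift_intensity)
qed (simp add: sets_uplift_intensity)

text \<open>In the polar form the mass of a shell is the mass under \<open>c dt/t\<close> of a compact interval of positive
  numbers, whatever the law of the marks is.\<close>

lemma locally_finite_uplift_intensity:
  assumes Q: "prob_space Q" "sets Q = sets (borel_on (- {0}))" and c: "0 \<le> c"
  shows "locally_finite_on (- {0}) (uplift_intensity c Q)"
  unfolding locally_finite_on_iff_shell
proof (intro conjI allI sets_uplift_intensity)
  interpret Q: prob_space Q by fact
  fix n
  let ?A = "- {0 :: 'a} \<inter> shell n"
  have A: "?A \<in> sets (borel_on (- {0}))" by (rule sets_Int_shell)
  then have f: "(indicator ?A :: 'a \<Rightarrow> ennreal) \<in> borel_measurable (borel_on (- {0}))" by simp
  have "emeasure (uplift_intensity c Q) ?A = (\<integral>\<^sup>+x. indicator ?A x \<partial>uplift_intensity c Q)"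
    using A by (simp add: sets_uplift_intensity)
  also have "\<dots> = (\<integral>\<^sup>+v. \<integral>\<^sup>+t. indicator ?A (t *\<^sub>R (v /\<^sub>R norm v)) \<partial>eta_intensity c \<partial>Q)"
    by (rule nn_integral_uplift_intensity_sphere[OF Q.sigma_finite_measure_axioms Q(2) c f])
  also have "\<dots> \<le> (\<integral>\<^sup>+v. \<integral>\<^sup>+t. indicator {1 / real (Suc n)..real (Suc n)} t \<partial>eta_intensity c \<partial>Q)"
  proof (intro nn_integral_mono)
    fix v t assume "v \<in> space Q" "t \<in> space (eta_intensity c)"
    then have "norm (t *\<^sub>R (v /\<^sub>R norm v)) = t"
      using sets_eq_imp_space_eq[OF Q(2)] by (simp add: space_borel_on space_eta_intensity)
    then show "indicator ?A (t *\<^sub>R (v /\<^sub>R norm v)) \<le> (indicator {1 / real (Suc n)..real (Suc n)} t :: ennreal)"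
      by (simp only: indicator_def shell_def Int_iff mem_Collect_eq atLeastAtMost_iff) auto
  qed
  also have "\<dots> = ennreal (c * (ln (real (Suc n)) - ln (1 / real (Suc n))))"
    using c by (subst eta_intensity_interval) (auto simp: field_simps Q.emeasure_space_1)
  finally show "emeasure (uplift_intensity c Q) ?A < \<infinity>" by (simp add: le_less_trans)
qed

lemma measurable_uplift_points:
  assumes "uplift_data c W V M Z Vs"
  shows "(\<lambda>\<omega>. Z k \<omega> *\<^sub>R Vs k \<omega>) \<in> measurable M (borel_on (- {0}))"
  using measurable_compose[OF measurable_Pair measurable_scaleR_pair, of "Z k" M "Vs k"] assms
  by (simp add: uplift_data_def)

section \<open>Marking: uplifted processes are Poisson\<close>

text \<open>Independence of the generated \<open>\<sigma>\<close>-algebras is the product form of the joint law, also for random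
  elements whose values have different types, such as the points and the marks.\<close>

lemma (in prob_space) indep_set_vimage_iff_distr_pair:
  assumes X [measurable]: "X \<in> measurable M S" and Y [measurable]: "Y \<in> measurable M T"
  shows "indep_set (sets (vimage_algebra (space M) X S)) (sets (vimage_algebra (space M) Y T)) \<longleftrightarrow>
    distr M S X \<Otimes>\<^sub>M distr M T Y = distr M (S \<Otimes>\<^sub>M T) (\<lambda>\<omega>. (X \<omega>, Y \<omega>))"
    (is "?indep \<longleftrightarrow> ?prod")
proof -
  interpret X: prob_space "distr M S X" by (rule prob_space_distr) measurable
  interpret Y: prob_space "distr M T Y" by (rule prob_space_distr) measurable
  have "X \<in> space M \<rightarrow> space S" "Y \<in> space M \<rightarrow> space T"
    by (simp_all add: Pi_iff measurable_space[OF X] measurable_space[OF Y])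
  then have sets: "sets (vimage_algebra (space M) X S) = {X -` A \<inter> space M |A. A \<in> sets S}"
    "sets (vimage_algebra (space M) Y T) = {Y -` A \<inter> space M |A. A \<in> sets T}"
    by (simp_all add: sets_vimage_algebra2)
  have joint: "emeasure (distr M (S \<Otimes>\<^sub>M T) (\<lambda>\<omega>. (X \<omega>, Y \<omega>))) (A \<times> B) =
      prob ((X -` A \<inter> space M) \<inter> (Y -` B \<inter> space M))" if "A \<in> sets S" "B \<in> sets T" for A B
  proof -
    have "(\<lambda>\<omega>. (X \<omega>, Y \<omega>)) -` (A \<times> B) \<inter> space M = (X -` A \<inter> space M) \<inter> (Y -` B \<inter> space M)"
      by auto
    then show ?thesis using that by (simp add: emeasure_distr emeasure_eq_measure)
  qed
  have single: "emeasure (distr M S X) A = prob (X -` A \<inter> space M)" if "A \<in> sets S" for A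
    using that by (simp add: emeasure_distr emeasure_eq_measure)
  have single': "emeasure (distr M T Y) B = prob (Y -` B \<inter> space M)" if "B \<in> sets T" for B
    using that by (simp add: emeasure_distr emeasure_eq_measure)
  show ?thesis
  proof
    assume ?indep
    then have "prob ((X -` A \<inter> space M) \<inter> (Y -` B \<inter> space M)) =
        prob (X -` A \<inter> space M) * prob (Y -` B \<inter> space M)" if "A \<in> sets S" "B \<in> sets T" for A B
      using that unfolding indep_sets2_eq sets by blast
    then show ?prod
      by (intro pair_measure_eqI X.sigma_finite_measure_axioms Y.sigma_finite_measure_axioms)
         (simp_all add: joint single single' ennreal_mult)
  next
    assume prod: ?prod
    have "prob ((X -` A \<inter> space M) \<inter> (Y -` B \<inter> space M)) =
        prob (X -` A \<inter> space M) * prob (Y -` B \<inter> space M)" if "A \<in> sets S" "B \<in> sets T" for A B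
      using joint[OF that] that Y.emeasure_pair_measure_Times[of A "distr M S X" B]
      by (simp add: prod single single' ennreal_mult[symmetric])
    then show ?indep
      unfolding indep_sets2_eq sets using X Y by (auto intro: measurable_sets)
  qed
qed

lemma measurable_sequence:
  "(\<And>k. X k \<in> measurable M (N k)) \<Longrightarrow> (\<lambda>\<omega> k. X k \<omega>) \<in> measurable M (PiM UNIV N)"
  by (intro measurable_PiM_single') (auto simp: PiE_iff dest: measurable_space)

text \<open>Given the points, the marks are independent with the law of V. Independence of the two sequences
  permits to fix the points, and independence of the marks then factorizes the inner expectation.\<close>

lemma uplift_data_integrate_marks:
  assumes D: "uplift_data c W V M Z Vs"
    and h: "(\<lambda>p. h (fst p) (snd p)) \<in> borel_measurable (borel_on {0<..} \<Otimes>\<^sub>M borel_on (- {0}))"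
  shows "(\<integral>\<^sup>+\<omega>. (\<Prod>k<n. h (Z k \<omega>) (Vs k \<omega>)) \<partial>M) =
    (\<integral>\<^sup>+\<omega>. (\<Prod>k<n. \<integral>\<^sup>+v. h (Z k \<omega>) v \<partial>distr W (borel_on (- {0})) V) \<partial>M)"
proof -
  interpret prob_space M using D by (simp add: uplift_data_def)
  define PZ :: "(nat \<Rightarrow> real) measure" where "PZ = PiM UNIV (\<lambda>_. borel_on {0<..})"
  define PV :: "(nat \<Rightarrow> 'b) measure" where "PV = PiM UNIV (\<lambda>_. borel_on (- {0}))"
  have Zm: "(\<lambda>\<omega> k. Z k \<omega>) \<in> measurable M PZ" and Vm: "(\<lambda>\<omega> k. Vs k \<omega>) \<in> measurable M PV"
    using D unfolding PZ_def PV_def by (auto intro!: measurable_sequence simp: uplift_data_def)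
  have indep: "distr M PZ (\<lambda>\<omega> k. Z k \<omega>) \<Otimes>\<^sub>M distr M PV (\<lambda>\<omega> k. Vs k \<omega>) =
      distr M (PZ \<Otimes>\<^sub>M PV) (\<lambda>\<omega>. (\<lambda>k. Z k \<omega>, \<lambda>k. Vs k \<omega>))"
    using D indep_set_vimage_iff_distr_pair[OF Zm Vm]
    by (simp only: uplift_data_def PZ_def PV_def)
  have Vk: "Vs k \<in> measurable M (borel_on (- {0}))"
    and law: "distr M (borel_on (- {0})) (Vs k) = distr W (borel_on (- {0})) V" for k
    using D by (simp_all add: uplift_data_def)
  interpret V: prob_space "distr M PV (\<lambda>\<omega> k. Vs k \<omega>)" by (rule prob_space_distr[OF Vm])
  define F where "F p = (\<Prod>k<n. h (fst p k) (snd p k))" for p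
  have Fm: "F \<in> borel_measurable (PZ \<Otimes>\<^sub>M PV)"
    unfolding F_def
  proof (intro borel_measurable_prod_ennreal)
    fix k
    have "(\<lambda>p. (fst p k, snd p k)) \<in> measurable (PZ \<Otimes>\<^sub>M PV) (borel_on {0<..} \<Otimes>\<^sub>M borel_on (- {0}))"
      unfolding PZ_def PV_def by measurable
    from measurable_compose[OF this h]
    show "(\<lambda>p. h (fst p k) (snd p k)) \<in> borel_measurable (PZ \<Otimes>\<^sub>M PV)" by simp
  qed
  have "(\<integral>\<^sup>+\<omega>. (\<Prod>k<n. h (Z k \<omega>) (Vs k \<omega>)) \<partial>M) =
      (\<integral>\<^sup>+p. F p \<partial>distr M (PZ \<Otimes>\<^sub>M PV) (\<lambda>\<omega>. (\<lambda>k. Z k \<omega>, \<lambda>k. Vs k \<omega>)))"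
    using nn_integral_distr[OF measurable_Pair[OF Zm Vm], of F] Fm by (simp add: F_def[of "(_, _)"])
  also have "\<dots> = (\<integral>\<^sup>+p. F p \<partial>(distr M PZ (\<lambda>\<omega> k. Z k \<omega>) \<Otimes>\<^sub>M distr M PV (\<lambda>\<omega> k. Vs k \<omega>)))"
    by (simp only: indep)
  also have "\<dots> = (\<integral>\<^sup>+z. \<integral>\<^sup>+v. F (z, v) \<partial>distr M PV (\<lambda>\<omega> k. Vs k \<omega>) \<partial>distr M PZ (\<lambda>\<omega> k. Z k \<omega>))"
    using Fm by (intro V.nn_integral_fst[symmetric]) simp
  also have "\<dots> = (\<integral>\<^sup>+z. (\<Prod>k<n. \<integral>\<^sup>+v. h (z k) v \<partial>distr W (borel_on (- {0})) V) \<partial>distr M PZ (\<lambda>\<omega> k. Z k \<omega>))"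
  proof (rule nn_integral_cong)
    fix z assume "z \<in> space (distr M PZ (\<lambda>\<omega> k. Z k \<omega>))"
    then have z: "z \<in> space PZ" by simp
    then have hz: "h (z k) \<in> borel_measurable (borel_on (- {0}))" for k
      using measurable_compose[OF measurable_Pair1' h, of "z k"]
      by (simp add: PZ_def space_PiM PiE_iff)
    have "(\<integral>\<^sup>+v. F (z, v) \<partial>distr M PV (\<lambda>\<omega> k. Vs k \<omega>)) = (\<integral>\<^sup>+\<omega>. (\<Prod>k<n. h (z k) (Vs k \<omega>)) \<partial>M)"
      using measurable_compose[OF measurable_Pair1'[OF z] Fm] Vm by (simp add: nn_integral_distr F_def)
    also have "\<dots> = (\<Prod>k<n. \<integral>\<^sup>+\<omega>. h (z k) (Vs k \<omega>) \<partial>M)"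
    proof (rule indep_vars_nn_integral)
      have "indep_vars (\<lambda>_. borel_on (- {0})) Vs {..<n}"
        using D by (simp add: uplift_data_def indep_vars_subset[where I = UNIV])
      then show "indep_vars (\<lambda>_. borel) (\<lambda>k \<omega>. h (z k) (Vs k \<omega>)) {..<n}"
        by (rule indep_vars_compose2) (rule hz)
    qed auto
    also have "\<dots> = (\<Prod>k<n. \<integral>\<^sup>+v. h (z k) v \<partial>distr W (borel_on (- {0})) V)"
    proof (intro prod.cong refl)
      fix k
      show "(\<integral>\<^sup>+\<omega>. h (z k) (Vs k \<omega>) \<partial>M) = (\<integral>\<^sup>+v. h (z k) v \<partial>distr W (borel_on (- {0})) V)"
        unfolding law[of k, symmetric] by (rule nn_integral_distr[OF Vk, symmetric]) (simp add: hz)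
    qed
    finally show "(\<integral>\<^sup>+v. F (z, v) \<partial>distr M PV (\<lambda>\<omega> k. Vs k \<omega>)) =
        (\<Prod>k<n. \<integral>\<^sup>+v. h (z k) v \<partial>distr W (borel_on (- {0})) V)" .
  qed
  also have "\<dots> = (\<integral>\<^sup>+\<omega>. (\<Prod>k<n. \<integral>\<^sup>+v. h (Z k \<omega>) v \<partial>distr W (borel_on (- {0})) V) \<partial>M)"
  proof (subst nn_integral_distr[OF Zm])
    interpret Q: prob_space "distr W (borel_on (- {0})) V"
      unfolding law[of 0, symmetric] by (rule prob_space_distr[OF Vk])
    have "(\<lambda>t. \<integral>\<^sup>+v. h t v \<partial>distr W (borel_on (- {0})) V) \<in> borel_measurable (borel_on {0<..})"
      using h by (intro Q.borel_measurable_nn_integral) (simp add: split_beta')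
    then have "(\<lambda>z. \<integral>\<^sup>+v. h (z k) v \<partial>distr W (borel_on (- {0})) V) \<in> borel_measurable PZ" for k
      by (rule measurable_compose[rotated]) (simp add: PZ_def)
    then show "(\<lambda>z. \<Prod>k<n. \<integral>\<^sup>+v. h (z k) v \<partial>distr W (borel_on (- {0})) V) \<in>
        borel_measurable (distr M PZ (\<lambda>\<omega> k. Z k \<omega>))"
      by (simp add: borel_measurable_prod_ennreal)
  qed simp
  finally show ?thesis .
qed

text \<open>Put \<open>G t = E e\<^sup>-\<^sup>f\<^sup>(\<^sup>t\<^sup>V\<^sup>)\<close> and \<open>g = - ln G\<close>. Integrating out the marks turns the
  Laplace functional of the uplifted process at f into that of the process on the half-line at g,
  where \<open>1 - e\<^sup>-\<^sup>g = 1 - G\<close> is the integral of \<open>1 - e\<^sup>-\<^sup>f\<^sup>(\<^sup>t\<^sup>v\<^sup>)\<close> over the marks.\<close>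

lemma poisson_laplace_uplift:
  assumes D: "uplift_data c W V M Z Vs"
  shows "poisson_laplace (- {0}) (uplift_intensity c (distr W (borel_on (- {0})) V)) M (uplift Z Vs)"
  unfolding poisson_laplace_def
proof
  define Q where "Q = distr W (borel_on (- {0})) V"
  interpret prob_space M using D by (simp add: uplift_data_def)
  have Zk: "Z k \<in> measurable M (borel_on {0<..})" and Vk: "Vs k \<in> measurable M (borel_on (- {0}))"
    and law: "distr M (borel_on (- {0})) (Vs k) = Q" for k
    using D by (simp_all add: uplift_data_def Q_def)
  interpret Q: prob_space Q
    unfolding law[of 0, symmetric] by (rule prob_space_distr[OF Vk])
  have sets_Q: "sets Q = sets (borel_on (- {0}))" by (simp add: Q_def)
  fix f :: "'b \<Rightarrow> ennreal" assume f: "f \<in> borel_measurable (borel_on (- {0}))"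
  define h where "h t v = expneg (f (t *\<^sub>R v))" for t v
  define G where "G t = (\<integral>\<^sup>+v. h t v \<partial>Q)" for t
  define g where "g t = neglog (G t)" for t
  have hm: "(\<lambda>p. h (fst p) (snd p)) \<in> borel_measurable (borel_on {0<..} \<Otimes>\<^sub>M borel_on (- {0}))"
    unfolding h_def by (intro measurable_compose[OF _ measurable_expneg] measurable_compose[OF measurable_scaleR_pair f])
  have Gm: "G \<in> borel_measurable (borel_on {0<..})"
    unfolding G_def using hm
    by (intro Q.borel_measurable_nn_integral)
       (simp add: split_beta' sets_Q cong: measurable_cong_sets sets_pair_measure_cong)
  have gm: "g \<in> borel_measurable (borel_on {0<..})"
    unfolding g_def by (rule measurable_compose[OF Gm measurable_neglog])
  have G1: "G t \<le> 1" for t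
  proof -
    have "G t \<le> (\<integral>\<^sup>+v. 1 \<partial>Q)"
      unfolding G_def h_def by (intro nn_integral_mono) simp
    then show ?thesis by (simp add: Q.emeasure_space_1)
  qed
  have hz: "h t \<in> borel_measurable Q" if "0 < t" for t
    using measurable_compose[OF measurable_Pair1' hm, of t] that
    by (simp add: space_borel_on cong: measurable_cong_sets[OF sets_Q refl])
  have points: "\<omega> \<in> space M \<Longrightarrow> Z k \<omega> *\<^sub>R Vs k \<omega> \<in> - {0}" "\<omega> \<in> space M \<Longrightarrow> Z k \<omega> \<in> {0<..}" for \<omega> k
    using measurable_space[OF measurable_uplift_points[OF D], of \<omega> k] measurable_space[OF Zk, of \<omega> k]
    by (simp_all add: space_borel_on)
  have limit: "(\<lambda>n. \<integral>\<^sup>+\<omega>. (\<Prod>k<n. expneg (x k \<omega>)) \<partial>M) \<longlonglongrightarrow> (\<integral>\<^sup>+\<omega>. expneg (\<Sum>k. x k \<omega>) \<partial>M)"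
    if [measurable]: "\<And>k. x k \<in> borel_measurable M" for x :: "nat \<Rightarrow> 'c \<Rightarrow> ennreal"
  proof (rule nn_integral_dominated_convergence[where w="\<lambda>_. 1"])
    show "AE \<omega> in M. (\<lambda>n. \<Prod>k<n. expneg (x k \<omega>)) \<longlonglongrightarrow> expneg (\<Sum>k. x k \<omega>)"
      by (intro AE_I2 expneg_suminf)
    show "AE \<omega> in M. (\<Prod>k<n. expneg (x k \<omega>)) \<le> 1" for n
      by (intro AE_I2 prod_le_1) auto
  qed (auto simp: emeasure_space_1)
  have "(\<lambda>n. \<integral>\<^sup>+\<omega>. (\<Prod>k<n. expneg (f (Z k \<omega> *\<^sub>R Vs k \<omega>))) \<partial>M) \<longlonglongrightarrow>
      (\<integral>\<^sup>+\<omega>. expneg (\<Sum>k. f (Z k \<omega> *\<^sub>R Vs k \<omega>)) \<partial>M)"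
    by (intro limit measurable_compose[OF measurable_uplift_points[OF D] f])
  moreover have "(\<lambda>n. \<integral>\<^sup>+\<omega>. (\<Prod>k<n. expneg (g (Z k \<omega>))) \<partial>M) \<longlonglongrightarrow>
      (\<integral>\<^sup>+\<omega>. expneg (\<Sum>k. g (Z k \<omega>)) \<partial>M)"
    by (intro limit measurable_compose[OF Zk gm])
  moreover have "(\<integral>\<^sup>+\<omega>. (\<Prod>k<n. expneg (f (Z k \<omega> *\<^sub>R Vs k \<omega>))) \<partial>M) = (\<integral>\<^sup>+\<omega>. (\<Prod>k<n. expneg (g (Z k \<omega>))) \<partial>M)" for n
    using uplift_data_integrate_marks[OF D hm, of n]
    by (simp add: g_def expneg_neglog[OF G1]) (simp add: h_def G_def Q_def)
  ultimately have "(\<integral>\<^sup>+\<omega>. expneg (\<Sum>k. f (Z k \<omega> *\<^sub>R Vs k \<omega>)) \<partial>M) = (\<integral>\<^sup>+\<omega>. expneg (\<Sum>k. g (Z k \<omega>)) \<partial>M)"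
    by (simp add: LIMSEQ_unique)
  also have "\<dots> = (\<integral>\<^sup>+\<omega>. expneg (\<integral>\<^sup>+t. g t \<partial>dirac_sum {0<..} (\<lambda>k. Z k \<omega>)) \<partial>M)"
    using points(2) gm by (intro nn_integral_cong) (simp add: nn_integral_dirac_sum)
  also have "\<dots> = expneg (\<integral>\<^sup>+t. (1 - expneg (g t)) \<partial>eta_intensity c)"
  proof -
    have "poisson_laplace {0<..} (eta_intensity c) M (\<lambda>\<omega>. dirac_sum {0<..} (\<lambda>k. Z k \<omega>))"
      using D by (intro poisson_process_imp_laplace) (simp only: uplift_data_def)
    then show ?thesis using gm by (simp only: poisson_laplace_def)
  qed
  also have "(\<integral>\<^sup>+t. (1 - expneg (g t)) \<partial>eta_intensity c) =
      (\<integral>\<^sup>+t. \<integral>\<^sup>+v. (1 - expneg (f (t *\<^sub>R v))) \<partial>Q \<partial>eta_intensity c)"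
  proof (rule nn_integral_cong)
    fix t assume "t \<in> space (eta_intensity c)"
    then have t: "0 < t" by (simp add: space_eta_intensity)
    have "G t \<noteq> \<top>" using G1[of t] by (auto simp: top_unique)
    then have "(\<integral>\<^sup>+v. (1 - h t v) \<partial>Q) = (\<integral>\<^sup>+v. 1 \<partial>Q) - (\<integral>\<^sup>+v. h t v \<partial>Q)"
      using hz[OF t] by (intro nn_integral_diff) (auto simp: h_def[abs_def] G_def)
    then show "1 - expneg (g t) = (\<integral>\<^sup>+v. (1 - expneg (f (t *\<^sub>R v))) \<partial>Q)"
      unfolding g_def expneg_neglog[OF G1] by (simp add: G_def h_def Q.emeasure_space_1)
  qed
  also have "\<dots> = (\<integral>\<^sup>+x. (1 - expneg (f x)) \<partial>uplift_intensity c Q)"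
  proof (rule nn_integral_uplift_intensity[OF Q.sigma_finite_measure_axioms sets_Q, symmetric])
    show "(\<lambda>x. 1 - expneg (f x)) \<in> borel_measurable (borel_on (- {0}))"
      using f by measurable
  qed
  also have "(\<integral>\<^sup>+\<omega>. expneg (\<Sum>k. f (Z k \<omega> *\<^sub>R Vs k \<omega>)) \<partial>M) =
      (\<integral>\<^sup>+\<omega>. expneg (\<integral>\<^sup>+x. f x \<partial>uplift Z Vs \<omega>) \<partial>M)"
    unfolding uplift_def
    by (intro nn_integral_cong) (simp only: nn_integral_dirac_sum[OF points(1) f])
  finally show "(\<integral>\<^sup>+\<omega>. expneg (\<integral>\<^sup>+x. f x \<partial>uplift Z Vs \<omega>) \<partial>M) =
      expneg (\<integral>\<^sup>+x. (1 - expneg (f x)) \<partial>uplift_intensity c (distr W (borel_on (- {0})) V))"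
    unfolding Q_def .
qed

lemma poisson_process_uplift:
  assumes D: "uplift_data c W V M Z Vs" and c: "0 \<le> c"
  shows "poisson_process (- {0}) (uplift_intensity c (distr W (borel_on (- {0})) V)) M (uplift Z Vs)"
proof (rule laplace_imp_poisson_process)
  have Vk: "Vs k \<in> measurable M (borel_on (- {0}))"
    and law: "distr M (borel_on (- {0})) (Vs k) = distr W (borel_on (- {0})) V" for k
    using D by (simp_all add: uplift_data_def)
  show M: "prob_space M" using D by (simp add: uplift_data_def)
  show "uplift Z Vs \<in> measurable M (measures_on (- {0}))"
    unfolding uplift_def by (intro measurable_dirac_sum measurable_uplift_points[OF D])
  show "AE \<omega> in M. counting_on (- {0}) (uplift Z Vs \<omega>)"
    by (simp add: uplift_def counting_on_dirac_sum)
  have "prob_space (distr W (borel_on (- {0})) V)"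
    unfolding law[of 0, symmetric] by (rule prob_space.prob_space_distr[OF M Vk])
  then show "locally_finite_on (- {0}) (uplift_intensity c (distr W (borel_on (- {0})) V))"
    using c by (intro locally_finite_uplift_intensity) auto
qed (rule poisson_laplace_uplift[OF D])

section \<open>Scale-invariant intensities in polar coordinates\<close>

lemma measurable_scaleR_punctured:
  "0 < t \<Longrightarrow> (\<lambda>x. t *\<^sub>R x) \<in> measurable (borel_on (- {0 :: 'a::euclidean_space})) (borel_on (- {0}))"
  by (intro measurable_restrict_space3) auto

text \<open>Scaling N by t scales its intensity, and equal void probabilities force equal intensities.\<close>

lemma scale_invariant_intensity:
  fixes \<Lambda> :: "'a::euclidean_space measure"
  assumes P: "poisson_process (- {0}) \<Lambda> M N" and inv: "scale_invariant (- {0}) M N" and t: "0 < t"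
  shows "distr \<Lambda> (borel_on (- {0})) (\<lambda>x. t *\<^sub>R x) = \<Lambda>"
proof (rule measure_eqI)
  let ?S = "- {0 :: 'a}" and ?N = "\<lambda>\<omega>. distr (N \<omega>) (borel_on (- {0})) (\<lambda>x. t *\<^sub>R x)"
  have sets_\<Lambda>: "sets \<Lambda> = sets (borel_on ?S)"
    using P by (simp only: poisson_process_def locally_finite_on_def)
  have N: "N \<in> measurable M (measures_on ?S)"
    using P by (simp only: poisson_process_def point_process_def)
  have "same_distribution ?S M ?N M N"
    using inv t by (simp only: scale_invariant_def)
  then have Nt: "?N \<in> measurable M (measures_on ?S)"
    and eq: "distr M (measures_on ?S) ?N = distr M (measures_on ?S) N"
    by (simp_all only: same_distribution_def point_process_def)
  show "sets (distr \<Lambda> (borel_on ?S) (\<lambda>x. t *\<^sub>R x)) = sets \<Lambda>"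
    by (simp add: sets_\<Lambda>)
  fix A assume "A \<in> sets (distr \<Lambda> (borel_on ?S) (\<lambda>x. t *\<^sub>R x))"
  then have A: "A \<in> sets (borel_on ?S)" by simp
  define B where "B = (\<lambda>x. t *\<^sub>R x) -` A \<inter> ?S"
  have B: "B \<in> sets (borel_on ?S)"
    using measurable_sets[OF measurable_scaleR_punctured[OF t] A] by (simp add: B_def space_borel_on)
  have pre: "emeasure (distr \<mu> (borel_on ?S) (\<lambda>x. t *\<^sub>R x)) A = emeasure \<mu> B"
    if \<mu>: "sets \<mu> = sets (borel_on ?S)" for \<mu>
    using measurable_scaleR_punctured[OF t] A sets_eq_imp_space_eq[OF \<mu>]
    by (subst emeasure_distr) (simp_all add: B_def space_borel_on cong: measurable_cong_sets[OF \<mu> refl])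
  have "(\<lambda>\<mu>. emeasure \<mu> A) \<in> borel_measurable (measures_on ?S)"
    by (rule measurable_emeasure_measures_on[OF A])
  from measurable_sets[OF this, of "{0}"]
  have E: "{\<mu>\<in>space (measures_on ?S). emeasure \<mu> A = 0} \<in> sets (measures_on ?S)"
    by (simp add: vimage_def Int_def conj_commute)
  have void: "emeasure (distr M (measures_on ?S) L) {\<mu>\<in>space (measures_on ?S). emeasure \<mu> A = 0} =
      emeasure M {\<omega>\<in>space M. emeasure (L \<omega>) A = 0}" if L: "L \<in> measurable M (measures_on ?S)" for L
    unfolding emeasure_distr[OF L E] using measurable_space[OF L]
    by (intro arg_cong[where f = "emeasure M"]) auto
  have "expneg (emeasure \<Lambda> B) = emeasure M {\<omega>\<in>space M. emeasure (N \<omega>) B = 0}"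
    by (rule void_probability[OF P B, symmetric])
  also have "\<dots> = emeasure M {\<omega>\<in>space M. emeasure (?N \<omega>) A = 0}"
    using pre point_process_sets(1)[OF N] by (intro arg_cong[where f = "emeasure M"]) auto
  also have "\<dots> = emeasure M {\<omega>\<in>space M. emeasure (N \<omega>) A = 0}"
    unfolding void[OF N, symmetric] void[OF Nt, symmetric] eq ..
  also have "\<dots> = expneg (emeasure \<Lambda> A)"
    by (rule void_probability[OF P A])
  finally have "emeasure \<Lambda> B = emeasure \<Lambda> A"
    by (rule expneg_inj)
  then show "emeasure (distr \<Lambda> (borel_on ?S) (\<lambda>x. t *\<^sub>R x)) A = emeasure \<Lambda> A"
    by (simp only: pre[OF sets_\<Lambda>])
qed

text \<open>With outer radius e, the dilations that take a given point into the annulus form a set of mass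
  exactly 1 under \<open>dt/t\<close>.\<close>

definition annulus :: "'a::euclidean_space set" where
  "annulus = {x. 1 \<le> norm x \<and> norm x \<le> exp 1}"

lemma sets_annulus [measurable]: "annulus \<in> sets borel"
  unfolding annulus_def by measurable

lemma measurable_indicator_annulus:
  "(indicator annulus :: 'a::euclidean_space \<Rightarrow> ennreal) \<in> borel_measurable (borel_on (- {0}))"
  by (intro measurable_restrict_space1) measurable

text \<open>By the choice of the annulus K, \<open>c \<integral> f d\<Lambda>\<close> is the double integral of \<open>f(x) 1\<^sub>K(x/t)\<close> with
  respect to \<open>\<Lambda>(dx)\<close> and \<open>c dt/t\<close>. Exchanging the integrals and substituting \<open>x = t y\<close>, which
  preserves \<open>\<Lambda>\<close>, gives the claim.\<close>

lemma scale_invariant_polar: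
  fixes \<Lambda> :: "'a::euclidean_space measure"
  assumes \<Lambda>: "locally_finite_on (- {0}) \<Lambda>"
    and inv: "\<And>t. 0 < t \<Longrightarrow> distr \<Lambda> (borel_on (- {0})) (\<lambda>x. t *\<^sub>R x) = \<Lambda>"
    and f: "f \<in> borel_measurable (borel_on (- {0}))" and c: "0 \<le> c"
  shows "(\<integral>\<^sup>+t. \<integral>\<^sup>+y. f (t *\<^sub>R y) * indicator annulus y \<partial>\<Lambda> \<partial>eta_intensity c) =
    ennreal c * (\<integral>\<^sup>+x. f x \<partial>\<Lambda>)"
proof -
  have sets_\<Lambda>: "sets \<Lambda> = sets (borel_on (- {0}))"
    using \<Lambda> by (simp only: locally_finite_on_def)
  have space_\<Lambda>: "space \<Lambda> = - {0}"
    using sets_eq_imp_space_eq[OF sets_\<Lambda>] by (simp add: space_borel_on)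
  interpret \<Lambda>: sigma_finite_measure \<Lambda> by (rule sigma_finite_locally_finite[OF \<Lambda>]) simp
  interpret eta: sigma_finite_measure "eta_intensity c" by (rule sigma_finite_eta_intensity[OF c])
  interpret pair_sigma_finite "eta_intensity c" \<Lambda> ..
  define F where "F t x = f x * indicator annulus (inverse t *\<^sub>R x)" for t x
  have Fm: "case_prod F \<in> borel_measurable (borel_on {0<..} \<Otimes>\<^sub>M borel_on (- {0}))"
  proof -
    have "(\<lambda>t :: real. inverse t) \<in> measurable (borel_on {0<..}) (borel_on {0<..})"
      by (intro measurable_restrict_space3) auto
    then have "(\<lambda>p. (inverse (fst p), snd p)) \<in>
        measurable (borel_on {0::real<..} \<Otimes>\<^sub>M borel_on (- {0 :: 'a})) (borel_on {0<..} \<Otimes>\<^sub>M borel_on (- {0}))"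
      by (intro measurable_Pair measurable_snd measurable_compose[OF measurable_fst])
    from measurable_compose[OF measurable_compose[OF this measurable_scaleR_pair] measurable_indicator_annulus]
    have "(\<lambda>p. indicator annulus (inverse (fst p) *\<^sub>R snd p) :: ennreal) \<in>
        borel_measurable (borel_on {0<..} \<Otimes>\<^sub>M borel_on (- {0 :: 'a}))"
      by simp
    moreover have "(\<lambda>p. f (snd p)) \<in> borel_measurable (borel_on {0::real<..} \<Otimes>\<^sub>M borel_on (- {0}))"
      by (rule measurable_compose[OF measurable_snd f])
    ultimately show ?thesis
      unfolding F_def split_beta' by (intro borel_measurable_times_ennreal)
  qed
  then have Fm': "case_prod F \<in> borel_measurable (eta_intensity c \<Otimes>\<^sub>M \<Lambda>)"
    by (simp cong: measurable_cong_sets sets_pair_measure_cong add: sets_\<Lambda> sets_eta_intensity)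
  have "(\<integral>\<^sup>+t. \<integral>\<^sup>+y. f (t *\<^sub>R y) * indicator annulus y \<partial>\<Lambda> \<partial>eta_intensity c) =
      (\<integral>\<^sup>+t. \<integral>\<^sup>+x. F t x \<partial>\<Lambda> \<partial>eta_intensity c)"
  proof (rule nn_integral_cong)
    fix t assume "t \<in> space (eta_intensity c)"
    then have t: "0 < t" by (simp add: space_eta_intensity)
    have Ft: "F t \<in> borel_measurable (borel_on (- {0}))"
      using measurable_compose[OF measurable_Pair1' Fm, of t] t by (simp add: space_borel_on)
    have "(\<integral>\<^sup>+x. F t x \<partial>\<Lambda>) = (\<integral>\<^sup>+x. F t x \<partial>distr \<Lambda> (borel_on (- {0})) (\<lambda>x. t *\<^sub>R x))"
      by (simp only: inv[OF t])
    also have "\<dots> = (\<integral>\<^sup>+y. F t (t *\<^sub>R y) \<partial>\<Lambda>)"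
      using measurable_scaleR_punctured[OF t] Ft
      by (subst nn_integral_distr) (simp_all cong: measurable_cong_sets[OF sets_\<Lambda> refl])
    also have "\<dots> = (\<integral>\<^sup>+y. f (t *\<^sub>R y) * indicator annulus y \<partial>\<Lambda>)"
      using t by (intro nn_integral_cong) (simp add: F_def)
    finally show "(\<integral>\<^sup>+y. f (t *\<^sub>R y) * indicator annulus y \<partial>\<Lambda>) = (\<integral>\<^sup>+x. F t x \<partial>\<Lambda>)" ..
  qed
  also have "\<dots> = (\<integral>\<^sup>+x. \<integral>\<^sup>+t. F t x \<partial>eta_intensity c \<partial>\<Lambda>)"
    by (rule Fubini'[OF Fm', symmetric])
  also have "\<dots> = (\<integral>\<^sup>+x. ennreal c * f x \<partial>\<Lambda>)"
  proof (rule nn_integral_cong)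
    fix x assume "x \<in> space \<Lambda>"
    then have x: "0 < norm x" by (simp add: space_\<Lambda>)
    \<comment> \<open>The dilations t that take a point of the annulus to x form an interval of logarithmic length 1.\<close>
    have "(\<integral>\<^sup>+t. F t x \<partial>eta_intensity c) =
        (\<integral>\<^sup>+t. f x * indicator {norm x / exp 1..norm x} t \<partial>eta_intensity c)"
    proof (rule nn_integral_cong)
      fix t assume "t \<in> space (eta_intensity c)"
      then have "0 < t" by (simp add: space_eta_intensity)
      then have "inverse t *\<^sub>R x \<in> annulus \<longleftrightarrow> t \<in> {norm x / exp 1..norm x}"
        by (auto simp: annulus_def field_simps)
      then show "F t x = f x * indicator {norm x / exp 1..norm x} t"
        by (simp only: F_def indicator_def)
    qed
    also have "\<dots> = f x * (\<integral>\<^sup>+t. indicator {norm x / exp 1..norm x} t \<partial>eta_intensity c)"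
    proof (rule nn_integral_cmult)
      have "(indicator {norm x / exp 1..norm x} :: real \<Rightarrow> ennreal) \<in> borel_measurable (borel_on {0<..})"
        by (intro measurable_restrict_space1) measurable
      then show "(indicator {norm x / exp 1..norm x} :: real \<Rightarrow> ennreal) \<in> borel_measurable (eta_intensity c)"
        by (simp only: measurable_cong_sets[OF sets_eta_intensity refl])
    qed
    also have "(\<integral>\<^sup>+t. indicator {norm x / exp 1..norm x} t \<partial>eta_intensity c) = ennreal c"
      using x c by (subst eta_intensity_interval) (auto simp: ln_div field_simps)
    finally show "(\<integral>\<^sup>+t. F t x \<partial>eta_intensity c) = ennreal c * f x"
      by (simp only: mult.commute)
  qed
  also have "\<dots> = ennreal c * (\<integral>\<^sup>+x. f x \<partial>\<Lambda>)"
    using f by (intro nn_integral_cmult) (simp only: measurable_cong_sets[OF sets_\<Lambda> refl])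
  finally show ?thesis .
qed

text \<open>Take for c the mass of the annulus, and for Q the normalized restriction of \<open>\<Lambda>\<close> to it. The mass is
  positive, since otherwise the polar formula with \<open>f = 1\<close> would make \<open>\<Lambda>\<close> vanish.\<close>

lemma scale_invariant_eq_uplift_intensity:
  fixes \<Lambda> :: "'a::euclidean_space measure"
  assumes \<Lambda>: "locally_finite_on (- {0}) \<Lambda>"
    and inv: "\<And>t. 0 < t \<Longrightarrow> distr \<Lambda> (borel_on (- {0})) (\<lambda>x. t *\<^sub>R x) = \<Lambda>"
    and nonzero: "emeasure \<Lambda> (- {0}) \<noteq> 0"
  obtains c Q where "0 < c" "prob_space Q" "sets Q = sets (borel_on (- {0}))"
    "\<Lambda> = uplift_intensity c Q"
proof -
  have sets_\<Lambda>: "sets \<Lambda> = sets (borel_on (- {0}))"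
    using \<Lambda> by (simp only: locally_finite_on_def)
  have space_\<Lambda>: "space \<Lambda> = - {0}"
    using sets_eq_imp_space_eq[OF sets_\<Lambda>] by (simp add: space_borel_on)
  interpret \<Lambda>: sigma_finite_measure \<Lambda> by (rule sigma_finite_locally_finite[OF \<Lambda>]) simp
  have annulus_\<Lambda>: "annulus \<in> sets \<Lambda>"
  proof -
    have "annulus \<subseteq> - {0 :: 'a}" by (auto simp: annulus_def)
    then have "annulus = - {0 :: 'a} \<inter> annulus" by blast
    then show ?thesis
      unfolding sets_\<Lambda> sets_restrict_space using sets_annulus by blast
  qed
  have "bounded_away (annulus :: 'a set)"
    by (auto simp: bounded_away_def bounded_iff annulus_def intro: exI[of _ 1])
  then have "emeasure \<Lambda> annulus < \<infinity>"
    using \<Lambda> annulus_\<Lambda> unfolding locally_finite_on_def by blast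
  then have fin: "emeasure \<Lambda> annulus \<noteq> \<top>" by simp
  have nz: "emeasure \<Lambda> annulus \<noteq> 0"
  proof
    assume z: "emeasure \<Lambda> annulus = 0"
    have "emeasure \<Lambda> (- {0}) = ennreal 1 * (\<integral>\<^sup>+x. 1 \<partial>\<Lambda>)"
      by (simp add: space_\<Lambda>)
    also have "\<dots> = (\<integral>\<^sup>+t. \<integral>\<^sup>+y. 1 * indicator annulus y \<partial>\<Lambda> \<partial>eta_intensity 1)"
      by (rule scale_invariant_polar[OF \<Lambda> inv, symmetric]) auto
    also have "\<dots> = 0"
      using annulus_\<Lambda> z by simp
    finally show False using nonzero by simp
  qed
  define c where "c = measure \<Lambda> annulus"
  have c: "ennreal c = emeasure \<Lambda> annulus"
    using fin by (simp add: c_def emeasure_eq_ennreal_measure)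
  then have "0 < c" using nz by (cases "0 < c") (auto simp: ennreal_neg not_less)
  define Q where "Q = uniform_measure \<Lambda> annulus"
  interpret Q: prob_space Q
    unfolding Q_def using nz fin by (intro prob_space_uniform_measure) auto
  have sets_Q: "sets Q = sets (borel_on (- {0}))"
    by (simp add: Q_def sets_\<Lambda>)
  have "uplift_intensity c Q = \<Lambda>"
  proof (rule measure_eqI)
    fix A assume "A \<in> sets (uplift_intensity c Q)"
    then have A: "A \<in> sets (borel_on (- {0}))" by (simp add: sets_uplift_intensity)
    then have f: "(indicator A :: 'a \<Rightarrow> ennreal) \<in> borel_measurable (borel_on (- {0}))" by simp
    have "emeasure (uplift_intensity c Q) A = (\<integral>\<^sup>+x. indicator A x \<partial>uplift_intensity c Q)"
      using A by (simp add: sets_uplift_intensity)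
    also have "\<dots> = (\<integral>\<^sup>+t. \<integral>\<^sup>+v. indicator A (t *\<^sub>R v) \<partial>Q \<partial>eta_intensity c)"
      by (rule nn_integral_uplift_intensity[OF Q.sigma_finite_measure_axioms sets_Q f])
    also have "\<dots> = (\<integral>\<^sup>+t. (\<integral>\<^sup>+v. indicator A (t *\<^sub>R v) * indicator annulus v \<partial>\<Lambda>) *
        inverse (emeasure \<Lambda> annulus) \<partial>eta_intensity c)"
    proof (rule nn_integral_cong)
      fix t assume "t \<in> space (eta_intensity c)"
      then have t: "0 < t" by (simp add: space_eta_intensity)
      have "(\<lambda>v. indicator A (t *\<^sub>R v) :: ennreal) \<in> borel_measurable \<Lambda>"
        unfolding measurable_cong_sets[OF sets_\<Lambda> refl]
        by (rule measurable_compose[OF measurable_scaleR_punctured[OF t] f])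
      then show "(\<integral>\<^sup>+v. indicator A (t *\<^sub>R v) \<partial>Q) =
          (\<integral>\<^sup>+v. indicator A (t *\<^sub>R v) * indicator annulus v \<partial>\<Lambda>) * inverse (emeasure \<Lambda> annulus)"
        unfolding Q_def
        by (subst nn_integral_uniform_measure[OF _ annulus_\<Lambda>]) (simp_all add: divide_ennreal_def)
    qed
    also have "\<dots> = (\<integral>\<^sup>+t. \<integral>\<^sup>+v. indicator A (t *\<^sub>R v) * indicator annulus v \<partial>\<Lambda> \<partial>eta_intensity c) *
        inverse (emeasure \<Lambda> annulus)"
    proof (rule nn_integral_multc)
      have "(\<lambda>p. indicator A (fst p *\<^sub>R snd p) * indicator annulus (snd p) :: ennreal) \<in>
          borel_measurable (borel_on {0<..} \<Otimes>\<^sub>M borel_on (- {0}))"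
        by (intro borel_measurable_times_ennreal measurable_compose[OF measurable_scaleR_pair f]
            measurable_compose[OF measurable_snd measurable_indicator_annulus])
      then have "(\<lambda>(t, v). indicator A (t *\<^sub>R v) * indicator annulus v :: ennreal) \<in>
          borel_measurable (eta_intensity c \<Otimes>\<^sub>M \<Lambda>)"
        by (simp cong: measurable_cong_sets sets_pair_measure_cong
            add: sets_\<Lambda> sets_eta_intensity split_beta')
      then show "(\<lambda>t. \<integral>\<^sup>+v. indicator A (t *\<^sub>R v) * indicator annulus v \<partial>\<Lambda>) \<in> borel_measurable (eta_intensity c)"
        by (rule \<Lambda>.borel_measurable_nn_integral)
    qed
    also have "\<dots> = ennreal c * (\<integral>\<^sup>+x. indicator A x \<partial>\<Lambda>) * inverse (emeasure \<Lambda> annulus)"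
      using \<open>0 < c\<close> by (subst scale_invariant_polar[OF \<Lambda> inv f]) auto
    also have "\<dots> = emeasure \<Lambda> A"
      using ennreal_mult_divide_eq[OF nz fin, of "emeasure \<Lambda> A"] A
      by (simp add: c sets_\<Lambda> divide_ennreal_def mult.commute)
    finally show "emeasure (uplift_intensity c Q) A = emeasure \<Lambda> A" .
  qed (simp add: sets_uplift_intensity sets_\<Lambda>)
  with that[OF \<open>0 < c\<close> Q.prob_space_axioms sets_Q] show ?thesis by simp
qed

text \<open>Both processes are Poisson, and their intensities agree since V and its direction have the same
  image intensity.\<close>

lemma uplift_depends_on_direction:
  fixes V :: "'w \<Rightarrow> 'a::euclidean_space"
  assumes c: "0 \<le> c" and W: "prob_space W" and V: "V \<in> measurable W (borel_on (- {0}))"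
    and D: "uplift_data c W V M Z Vs" "uplift_data c W (\<lambda>w. V w /\<^sub>R norm (V w)) M' Z' Us"
  shows "same_distribution (- {0}) M (uplift Z Vs) M' (uplift Z' Us)"
proof -
  have "(\<lambda>v. v /\<^sub>R norm v) \<in> measurable (borel_on (- {0 :: 'a})) (borel_on (- {0}))"
    by (intro measurable_restrict_space3) auto
  then have "distr W (borel_on (- {0})) (\<lambda>w. V w /\<^sub>R norm (V w)) =
      distr (distr W (borel_on (- {0})) V) (borel_on (- {0})) (\<lambda>v. v /\<^sub>R norm v)"
    using V by (simp add: distr_distr comp_def)
  then have "uplift_intensity c (distr W (borel_on (- {0})) (\<lambda>w. V w /\<^sub>R norm (V w))) =
      uplift_intensity c (distr W (borel_on (- {0})) V)"
    using c by (simp only: uplift_intensity_normalize[OF prob_space.prob_space_distr[OF W V] sets_distr])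
  with poisson_process_uplift[OF D(1) c] poisson_process_uplift[OF D(2) c]
  show ?thesis
    by (auto intro: poisson_process_unique)
qed

section \<open>Existence of an enumerated Poisson process on the half-line\<close>

lemma nn_integral_PiM_prod:
  fixes P :: "nat \<Rightarrow> 'a measure" and g :: "nat \<Rightarrow> 'a \<Rightarrow> ennreal"
  assumes P: "\<And>i. prob_space (P i)" and g: "\<And>i. g i \<in> borel_measurable (P i)"
  shows "(\<integral>\<^sup>+x. (\<Prod>i<n. g i (x i)) \<partial>PiM UNIV P) = (\<Prod>i<n. \<integral>\<^sup>+y. g i y \<partial>P i)"
proof -
  interpret PP: prob_space "PiM UNIV P" by (rule prob_space_PiM[OF P])
  have "PP.indep_vars P (\<lambda>i x. x i) UNIV"
    by (subst PP.indep_vars_iff_distr_eq_PiM) (simp_all add: distr_PiM_component P restrict_UNIV)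
  then have "PP.indep_vars P (\<lambda>i x. x i) {..<n}"
    by (rule PP.indep_vars_subset) auto
  then have "PP.indep_vars (\<lambda>_. borel) (\<lambda>i x. g i (x i)) {..<n}"
    by (rule PP.indep_vars_compose2) (rule g)
  then have "(\<integral>\<^sup>+x. (\<Prod>i<n. g i (x i)) \<partial>PiM UNIV P) = (\<Prod>i<n. \<integral>\<^sup>+x. g i (x i) \<partial>PiM UNIV P)"
    by (intro PP.indep_vars_nn_integral) auto
  also have "\<dots> = (\<Prod>i<n. \<integral>\<^sup>+y. g i y \<partial>P i)"
  proof (intro prod.cong refl)
    fix i
    have "(\<integral>\<^sup>+y. g i y \<partial>P i) = (\<integral>\<^sup>+y. g i y \<partial>distr (PiM UNIV P) (P i) (\<lambda>x. x i))"
      by (simp add: distr_PiM_component P)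
    also have "\<dots> = (\<integral>\<^sup>+x. g i (x i) \<partial>PiM UNIV P)"
      by (rule nn_integral_distr) (simp_all add: g)
    finally show "(\<integral>\<^sup>+x. g i (x i) \<partial>PiM UNIV P) = (\<integral>\<^sup>+y. g i y \<partial>P i)" ..
  qed
  finally show ?thesis .
qed

text \<open>The partition of the half-line into the intervals \<open>[e\<^sup>i, e\<^sup>i\<^sup>+\<^sup>1)\<close>, i an integer, indexed by natural
  numbers. Each of them has mass 1 under \<open>dt/t\<close>.\<close>

definition block :: "nat \<Rightarrow> real set" where
  "block n = {exp (real_of_int (int_decode n))..<exp (real_of_int (int_decode n) + 1)}"

lemma sets_block [measurable]: "block n \<in> sets borel"
  by (simp add: block_def)

lemma disjoint_block: "m \<noteq> n \<Longrightarrow> block m \<inter> block n = {}"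
proof -
  assume "m \<noteq> n"
  then have "int_decode m \<noteq> int_decode n"
    by (metis int_decode_inverse)
  then consider "int_decode m + 1 \<le> int_decode n" | "int_decode n + 1 \<le> int_decode m"
    by linarith
  then show ?thesis
  proof cases
    case 1
    then have "exp (real_of_int (int_decode m) + 1) \<le> exp (real_of_int (int_decode n))"
      by simp
    then show ?thesis by (auto simp: block_def)
  next
    case 2
    then have "exp (real_of_int (int_decode n) + 1) \<le> exp (real_of_int (int_decode m))"
      by simp
    then show ?thesis by (auto simp: block_def)
  qed
qed

lemma ex_block: "0 < t \<Longrightarrow> \<exists>n. t \<in> block n"
proof
  assume t: "0 < t"
  have fl: "real_of_int \<lfloor>ln t\<rfloor> \<le> ln t" "ln t < real_of_int \<lfloor>ln t\<rfloor> + 1"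
    by linarith+
  then show "t \<in> block (int_encode \<lfloor>ln t\<rfloor>)"
    using t fl(2) fl(1)[unfolded ln_ge_iff[OF t]] exp_ln[OF t] exp_less_cancel_iff[of "ln t" "real_of_int \<lfloor>ln t\<rfloor> + 1"]
    by (simp add: block_def del: exp_less_cancel_iff)
qed

definition block_law :: "nat \<Rightarrow> real measure" where
  "block_law n = density (eta_intensity 1) (indicator (block n))"

lemma sets_block_law [measurable_cong]: "sets (block_law n) = sets (borel_on {0<..})"
  by (simp add: block_law_def sets_eta_intensity)

lemma space_block_law: "space (block_law n) = {0<..}"
  by (simp add: block_law_def space_eta_intensity)

lemma measurable_indicator_block:
  "(indicator (block n) :: real \<Rightarrow> ennreal) \<in> borel_measurable (borel_on {0<..})"
  by (intro measurable_restrict_space1) measurable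

lemma prob_space_block_law: "prob_space (block_law n)"
proof (rule prob_spaceI)
  define a where "a = exp (real_of_int (int_decode n))"
  have a: "0 < a" "exp 1 * a = exp (real_of_int (int_decode n) + 1)"
    by (simp_all add: a_def exp_add mult.commute)
  have ind: "(indicator A :: real \<Rightarrow> ennreal) \<in> borel_measurable (borel_on {0<..})" if "A \<in> sets borel" for A
    using that by (intro measurable_restrict_space1 borel_measurable_indicator)
  have "emeasure (block_law n) (space (block_law n)) = (\<integral>\<^sup>+t. indicator (block n) t \<partial>eta_intensity 1)"
  proof -
    have "(indicator (block n) :: real \<Rightarrow> ennreal) \<in> borel_measurable (eta_intensity 1)"
      using measurable_indicator_block by (simp only: measurable_cong_sets[OF sets_eta_intensity refl])
    moreover have "space (block_law n) \<in> sets (eta_intensity 1)"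
      using sets.top[of "eta_intensity 1"] by (simp add: space_block_law space_eta_intensity)
    ultimately show ?thesis
      unfolding block_law_def
      by (subst emeasure_density) (auto intro!: nn_integral_cong simp: indicator_def)
  qed
  also have "\<dots> = (\<integral>\<^sup>+t. indicator {a..exp 1 * a} t \<partial>eta_intensity 1)"
  proof -
    \<comment> \<open>The half-open block and the closed interval differ by one endpoint, a Lebesgue null set.\<close>
    have "AE t in lborel. t \<noteq> exp 1 * a"
      by (rule AE_lborel_singleton)
    then have "AE t in lborel. ennreal (1 / t) * (indicator (block n) t * indicator {0<..} t) =
        ennreal (1 / t) * (indicator {a..exp 1 * a} t * indicator {0<..} t)"
      by eventually_elim (auto simp: block_def a(2)[symmetric] a_def[symmetric] indicator_def)
    then show ?thesis
      by (simp add: nn_integral_eta_intensity ind cong: nn_integral_cong_AE)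
  qed
  also have "\<dots> = 1"
    using a(1) by (subst eta_intensity_interval) (auto simp: ln_mult)
  finally show "emeasure (block_law n) (space (block_law n)) = 1" .
qed

lemma suminf_block_law:
  assumes g: "g \<in> borel_measurable (borel_on {0<..})" and c: "0 \<le> c"
  shows "(\<Sum>n. ennreal c * (\<integral>\<^sup>+t. g t \<partial>block_law n)) = (\<integral>\<^sup>+t. g t \<partial>eta_intensity c)"
proof -
  have gm: "g \<in> borel_measurable (eta_intensity b)" for b
    using g by (simp only: measurable_cong_sets[OF sets_eta_intensity refl])
  have im: "(indicator (block n) :: real \<Rightarrow> ennreal) \<in> borel_measurable (eta_intensity b)" for b n
    using measurable_indicator_block by (simp only: measurable_cong_sets[OF sets_eta_intensity refl])
  have "(\<Sum>n. ennreal c * (\<integral>\<^sup>+t. g t \<partial>block_law n)) =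
      ennreal c * (\<Sum>n. \<integral>\<^sup>+t. indicator (block n) t * g t \<partial>eta_intensity 1)"
    using gm im by (simp add: block_law_def nn_integral_density)
  also have "(\<Sum>n. \<integral>\<^sup>+t. indicator (block n) t * g t \<partial>eta_intensity 1) =
      (\<integral>\<^sup>+t. (\<Sum>n. indicator (block n) t * g t) \<partial>eta_intensity 1)"
    by (intro nn_integral_suminf[symmetric] borel_measurable_times_ennreal gm im)
  also have "\<dots> = (\<integral>\<^sup>+t. g t \<partial>eta_intensity 1)"
  proof (rule nn_integral_cong)
    fix t assume "t \<in> space (eta_intensity 1)"
    then obtain m where m: "t \<in> block m"
      using ex_block by (auto simp: space_eta_intensity)
    have "(\<Sum>n. indicator (block n) t * g t) = (\<Sum>n\<in>{m}. indicator (block n) t * g t)"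
      using disjoint_block m by (intro suminf_finite) (auto simp: indicator_def)
    then show "(\<Sum>n. indicator (block n) t * g t) = g t" using m by simp
  qed
  also have "ennreal c * \<dots> = (\<integral>\<^sup>+t. g t \<partial>eta_intensity c)"
  proof -
    have g': "(\<lambda>t. g t * indicator {0<..} t) \<in> borel_measurable borel"
      using g by (subst (asm) borel_measurable_restrict_space_iff_ennreal) auto
    have "ennreal c * (\<integral>\<^sup>+t. g t \<partial>eta_intensity 1) =
        (\<integral>\<^sup>+t. ennreal c * (ennreal (1 / t) * (g t * indicator {0<..} t)) \<partial>lborel)"
      unfolding nn_integral_eta_intensity[OF g]
      by (rule nn_integral_cmult[symmetric], rule borel_measurable_times_ennreal) (use g' in simp_all)
    also have "\<dots> = (\<integral>\<^sup>+t. ennreal (c / t) * (g t * indicator {0<..} t) \<partial>lborel)"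
    proof (rule nn_integral_cong)
      fix t :: real
      show "ennreal c * (ennreal (1 / t) * (g t * indicator {0<..} t)) =
          ennreal (c / t) * (g t * indicator {0<..} t)"
      proof (cases "0 < t")
        case True
        then have "ennreal c * ennreal (1 / t) = ennreal (c / t)"
          using c by (simp add: ennreal_mult[symmetric])
        then show ?thesis by (simp only: mult.assoc[symmetric])
      qed simp
    qed
    finally show ?thesis by (simp only: nn_integral_eta_intensity[OF g])
  qed
  finally show ?thesis .
qed

text \<open>A Poisson number K together with an infinite sequence of independent points in the block, of which
  only the first K will be used.\<close>

definition block_sample :: "real \<Rightarrow> nat \<Rightarrow> (nat \<times> (nat \<Rightarrow> real)) measure" where
  "block_sample c n = measure_pmf (poisson_pmf c) \<Otimes>\<^sub>M PiM UNIV (\<lambda>_. block_law n)"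

definition samples :: "real \<Rightarrow> (nat \<Rightarrow> nat \<times> (nat \<Rightarrow> real)) measure" where
  "samples c = PiM UNIV (block_sample c)"

lemma prob_space_block_points: "prob_space (PiM UNIV (\<lambda>_. block_law n))"
  by (intro prob_space_PiM prob_space_block_law)

lemma prob_space_block_sample: "prob_space (block_sample c n)"
proof -
  interpret A: prob_space "PiM UNIV (\<lambda>_ :: nat. block_law n)" by (rule prob_space_block_points)
  interpret pair_prob_space "measure_pmf (poisson_pmf c)" "PiM UNIV (\<lambda>_ :: nat. block_law n)" ..
  show ?thesis unfolding block_sample_def by (rule prob_space_axioms)
qed

lemma prob_space_samples: "prob_space (samples c)"
  unfolding samples_def by (intro prob_space_PiM prob_space_block_sample)

lemma measurable_sample_count:
  "(\<lambda>\<omega>. fst (\<omega> n)) \<in> measurable (samples c) (count_space UNIV)"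
proof -
  have "(\<lambda>b. fst b) \<in> measurable (block_sample c n) (count_space UNIV)"
    unfolding block_sample_def by measurable
  then show ?thesis
    unfolding samples_def by (rule measurable_compose[rotated]) simp
qed

lemma measurable_sample_point:
  "(\<lambda>\<omega>. snd (\<omega> n) j) \<in> measurable (samples c) (borel_on {0<..})"
proof -
  have "(\<lambda>b. snd b j) \<in> measurable (block_sample c n) (block_law n)"
    unfolding block_sample_def by measurable
  then have "(\<lambda>b. snd b j) \<in> measurable (block_sample c n) (borel_on {0<..})"
    by (simp only: measurable_cong_sets[OF refl sets_block_law])
  then show ?thesis
    unfolding samples_def by (rule measurable_compose[rotated]) simp
qed

text \<open>Given \<open>K = k\<close> the expectation is \<open>a\<^sup>k\<close> with \<open>a = \<integral> e\<^sup>-\<^sup>f d\<mu>\<close>, where \<open>\<mu>\<close> is the law of one point;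
  averaging over K gives the generating function of the Poisson law at a.\<close>

lemma laplace_block_sample:
  assumes c: "0 < c" and f: "f \<in> borel_measurable (borel_on {0<..})"
  shows "(\<integral>\<^sup>+b. expneg (\<Sum>j<fst b. f (snd b j)) \<partial>block_sample c n) =
    expneg (ennreal c * (\<integral>\<^sup>+t. (1 - expneg (f t)) \<partial>block_law n))"
proof -
  interpret B: prob_space "block_law n" by (rule prob_space_block_law)
  interpret X: prob_space "PiM UNIV (\<lambda>_ :: nat. block_law n)" by (rule prob_space_block_points)
  have fm: "f \<in> borel_measurable (block_law n)"
    using f by (simp only: measurable_cong_sets[OF sets_block_law refl])
  define a where "a = (\<integral>\<^sup>+t. expneg (f t) \<partial>block_law n)"
  have "a \<le> (\<integral>\<^sup>+t. 1 \<partial>block_law n)"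
    unfolding a_def by (intro nn_integral_mono) simp
  then have a: "a \<le> 1" by (simp add: B.emeasure_space_1)
  have fj: "(\<lambda>b :: nat \<times> (nat \<Rightarrow> real). f (snd b j)) \<in> borel_measurable (count_space UNIV \<Otimes>\<^sub>M PiM UNIV (\<lambda>_. block_law n))" for j
    using fm by measurable
  have "(\<lambda>b :: nat \<times> (nat \<Rightarrow> real). \<Sum>j<fst b. f (snd b j)) \<in> borel_measurable (count_space UNIV \<Otimes>\<^sub>M PiM UNIV (\<lambda>_. block_law n))"
    by (rule measurable_compose_countable[where g = "\<lambda>b :: nat \<times> (nat \<Rightarrow> real). fst b"
        and f = "\<lambda>k (b :: nat \<times> (nat \<Rightarrow> real)). \<Sum>j<k. f (snd b j)"])
       (auto intro!: borel_measurable_sum fj)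
  then have m: "(\<lambda>b. expneg (\<Sum>j<fst b. f (snd b j))) \<in>
      borel_measurable (measure_pmf (poisson_pmf c) \<Otimes>\<^sub>M PiM UNIV (\<lambda>_. block_law n))"
    by (simp cong: measurable_cong_sets sets_pair_measure_cong)
  have "(\<integral>\<^sup>+b. expneg (\<Sum>j<fst b. f (snd b j)) \<partial>block_sample c n) =
      (\<integral>\<^sup>+k. \<integral>\<^sup>+x. expneg (\<Sum>j<k. f (x j)) \<partial>PiM UNIV (\<lambda>_. block_law n) \<partial>measure_pmf (poisson_pmf c))"
    unfolding block_sample_def using X.nn_integral_fst[OF m] by simp
  also have "\<dots> = (\<integral>\<^sup>+k. a ^ k \<partial>measure_pmf (poisson_pmf c))"
    using fm by (simp add: expneg_sum a_def
      nn_integral_PiM_prod[OF prob_space_block_law, of "\<lambda>_ t. expneg (f t)"])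
  also have "\<dots> = expneg (ennreal c * (1 - a))"
    by (rule nn_integral_power_poisson_pmf[OF c a])
  also have "1 - a = (\<integral>\<^sup>+t. (1 - expneg (f t)) \<partial>block_law n)"
  proof -
    have "a \<noteq> \<top>" using a by (auto simp: top_unique)
    then show ?thesis
      using fm by (subst nn_integral_diff) (auto simp: a_def B.emeasure_space_1)
  qed
  finally show ?thesis .
qed

text \<open>The blocks are independent, so the exponents of the single blocks add up.\<close>

lemma laplace_samples:
  assumes c: "0 < c" and f: "f \<in> borel_measurable (borel_on {0<..})"
  shows "(\<integral>\<^sup>+\<omega>. expneg (\<Sum>n. \<Sum>j<fst (\<omega> n). f (snd (\<omega> n) j)) \<partial>samples c) =
    expneg (\<integral>\<^sup>+t. (1 - expneg (f t)) \<partial>eta_intensity c)"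
proof -
  interpret prob_space "samples c" by (rule prob_space_samples)
  have Ym: "(\<lambda>\<omega>. \<Sum>j<fst (\<omega> n). f (snd (\<omega> n) j)) \<in> borel_measurable (samples c)" for n
    by (rule measurable_compose_countable[OF _ measurable_sample_count])
       (intro borel_measurable_sum measurable_compose[OF measurable_sample_point f])
  have bm: "(\<lambda>b. expneg (\<Sum>j<fst b. f (snd b j))) \<in> borel_measurable (block_sample c n)" for n
  proof -
    have "(\<lambda>b. \<Sum>j<fst b. f (snd b j)) \<in> borel_measurable (block_sample c n)"
    proof (rule measurable_compose_countable[where g = "\<lambda>b :: nat \<times> (nat \<Rightarrow> real). fst b"
        and f = "\<lambda>k (b :: nat \<times> (nat \<Rightarrow> real)). \<Sum>j<k. f (snd b j)"])
      show "fst \<in> measurable (block_sample c n) (count_space UNIV)"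
        unfolding block_sample_def by measurable
      have fm: "f \<in> borel_measurable (block_law n)"
        using f by (simp only: measurable_cong_sets[OF sets_block_law refl])
      show "(\<lambda>b. \<Sum>j<k. f (snd b j)) \<in> borel_measurable (block_sample c n)" for k
        unfolding block_sample_def using fm by measurable
    qed
    then show ?thesis by measurable
  qed
  have "(\<lambda>m. \<integral>\<^sup>+\<omega>. (\<Prod>n<m. expneg (\<Sum>j<fst (\<omega> n). f (snd (\<omega> n) j))) \<partial>samples c) \<longlonglongrightarrow>
      (\<integral>\<^sup>+\<omega>. expneg (\<Sum>n. \<Sum>j<fst (\<omega> n). f (snd (\<omega> n) j)) \<partial>samples c)"
  proof (rule nn_integral_dominated_convergence[where w="\<lambda>_. 1"])
    show "(\<lambda>\<omega>. \<Prod>n<m. expneg (\<Sum>j<fst (\<omega> n). f (snd (\<omega> n) j))) \<in> borel_measurable (samples c)" for m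
      by (intro borel_measurable_prod_ennreal measurable_compose[OF Ym measurable_expneg])
    show "(\<lambda>\<omega>. expneg (\<Sum>n. \<Sum>j<fst (\<omega> n). f (snd (\<omega> n) j))) \<in> borel_measurable (samples c)"
      by (intro borel_measurable_suminf_order Ym measurable_compose[OF _ measurable_expneg])
    show "AE \<omega> in samples c. (\<lambda>m. \<Prod>n<m. expneg (\<Sum>j<fst (\<omega> n). f (snd (\<omega> n) j))) \<longlonglongrightarrow>
        expneg (\<Sum>n. \<Sum>j<fst (\<omega> n). f (snd (\<omega> n) j))"
      by (intro AE_I2 expneg_suminf)
    show "AE \<omega> in samples c. (\<Prod>n<m. expneg (\<Sum>j<fst (\<omega> n). f (snd (\<omega> n) j))) \<le> 1" for m
      by (intro AE_I2 prod_le_1) auto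
  qed (auto simp: emeasure_space_1)
  moreover have "(\<integral>\<^sup>+\<omega>. (\<Prod>n<m. expneg (\<Sum>j<fst (\<omega> n). f (snd (\<omega> n) j))) \<partial>samples c) =
      (\<Prod>n<m. expneg (ennreal c * (\<integral>\<^sup>+t. (1 - expneg (f t)) \<partial>block_law n)))" for m
    unfolding samples_def
    using nn_integral_PiM_prod[OF prob_space_block_sample, of "\<lambda>_ b. expneg (\<Sum>j<fst b. f (snd b j))", OF bm]
    by (simp only: laplace_block_sample[OF c f])
  moreover have "(\<lambda>m. \<Prod>n<m. expneg (ennreal c * (\<integral>\<^sup>+t. (1 - expneg (f t)) \<partial>block_law n))) \<longlonglongrightarrow>
      expneg (\<integral>\<^sup>+t. (1 - expneg (f t)) \<partial>eta_intensity c)"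
  proof -
    have "(\<lambda>t. 1 - expneg (f t)) \<in> borel_measurable (borel_on {0<..})"
      using f by measurable
    from suminf_block_law[OF this less_imp_le[OF c]] show ?thesis
      by (metis expneg_suminf)
  qed
  ultimately show ?thesis
    by (simp add: LIMSEQ_unique)
qed

definition sample_point :: "(nat \<Rightarrow> nat \<times> (nat \<Rightarrow> real)) \<Rightarrow> nat \<Rightarrow> real" where
  "sample_point \<omega> i = snd (\<omega> (fst (prod_decode i))) (snd (prod_decode i))"

text \<open>The codes of those points that are used.\<close>

definition active :: "(nat \<Rightarrow> nat \<times> (nat \<Rightarrow> real)) \<Rightarrow> nat set" where
  "active \<omega> = {i. snd (prod_decode i) < fst (\<omega> (fst (prod_decode i)))}"

text \<open>The value 1 on the null set where only finitely many points are used keeps the enumeration inside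
  the half-line.\<close>

definition eta_point :: "nat \<Rightarrow> (nat \<Rightarrow> nat \<times> (nat \<Rightarrow> real)) \<Rightarrow> real" where
  "eta_point k \<omega> = (if infinite (active \<omega>) then sample_point \<omega> (enumerate (active \<omega>) k) else 1)"

lemma suminf_active:
  fixes f :: "real \<Rightarrow> ennreal"
  shows "(\<Sum>i. indicator (active \<omega>) i * f (sample_point \<omega> i)) =
    (\<Sum>n. \<Sum>j<fst (\<omega> n). f (snd (\<omega> n) j))"
proof -
  define F where "F p = (if snd p < fst (\<omega> (fst p)) then f (snd (\<omega> (fst p)) (snd p)) else 0)" for p
  have "(\<Sum>j<fst (\<omega> n). f (snd (\<omega> n) j)) = (\<Sum>j. F (n, j))" for n
    by (subst suminf_finite[of "{..<fst (\<omega> n)}"]) (auto simp: F_def)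
  from suminf_ennreal_2dimen[OF this]
  have "(\<Sum>i. F (prod_decode i)) = (\<Sum>n. \<Sum>j<fst (\<omega> n). f (snd (\<omega> n) j))" .
  moreover have "F (prod_decode i) = indicator (active \<omega>) i * f (sample_point \<omega> i)" for i
    by (simp add: F_def active_def sample_point_def)
  ultimately show ?thesis by simp
qed

lemma suminf_eta_point:
  fixes f :: "real \<Rightarrow> ennreal"
  assumes inf: "infinite (active \<omega>)"
  shows "(\<Sum>k. f (eta_point k \<omega>)) = (\<Sum>n. \<Sum>j<fst (\<omega> n). f (snd (\<omega> n) j))"
proof -
  have "(\<Sum>k. f (eta_point k \<omega>)) = (\<integral>\<^sup>+k. f (sample_point \<omega> (enumerate (active \<omega>) k)) \<partial>count_space UNIV)"
    using inf by (simp add: eta_point_def nn_integral_count_space_nat)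
  also have "\<dots> = (\<integral>\<^sup>+i. f (sample_point \<omega> i) \<partial>count_space (active \<omega>))"
    by (rule nn_integral_bij_count_space[OF bij_enumerate[OF inf]])
  also have "\<dots> = (\<Sum>i. indicator (active \<omega>) i * f (sample_point \<omega> i))"
    by (simp add: nn_integral_count_space_indicator nn_integral_count_space_nat[symmetric] mult.commute)
  finally show ?thesis by (simp only: suminf_active)
qed

lemma pred_active: "Measurable.pred (samples c) (\<lambda>\<omega>. i \<in> active \<omega>)"
  using measurable_sample_count[of "fst (prod_decode i)" c]
  unfolding active_def by simp

text \<open>Agrees with \<^const>\<open>enumerate\<close> on infinite sets; the description by least elements makes
  measurability evident.\<close>

primrec next_active :: "nat \<Rightarrow> (nat \<Rightarrow> nat \<times> (nat \<Rightarrow> real)) \<Rightarrow> nat" where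
  "next_active 0 \<omega> = (LEAST i. i \<in> active \<omega>)"
| "next_active (Suc k) \<omega> = (LEAST i. i \<in> active \<omega> \<and> next_active k \<omega> < i)"

lemma next_active_eq_enumerate: "infinite (active \<omega>) \<Longrightarrow> next_active k \<omega> = enumerate (active \<omega>) k"
  by (induction k) (simp_all add: enumerate_0 enumerate_Suc'' del: enumerate_Suc)

lemma measurable_next_active: "next_active k \<in> measurable (samples c) (count_space UNIV)"
proof (induction k)
  case 0
  have "(\<lambda>\<omega>. LEAST i. i \<in> active \<omega>) \<in> measurable (samples c) (count_space UNIV)"
    by (intro measurable_Least pred_active)
  then show ?case by simp
next
  case (Suc k)
  note [measurable] = Suc pred_active
  have "(\<lambda>\<omega>. LEAST i. i \<in> active \<omega> \<and> next_active k \<omega> < i) \<in> measurable (samples c) (count_space UNIV)"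
    by measurable
  then show ?case by simp
qed

lemma measurable_eta_point: "eta_point k \<in> measurable (samples c) (borel_on {0<..})"
proof -
  note [measurable] = pred_active
  have "eta_point k = (\<lambda>\<omega>. if infinite (active \<omega>) then sample_point \<omega> (next_active k \<omega>) else 1)"
    by (auto simp: eta_point_def next_active_eq_enumerate)
  also have "\<dots> \<in> measurable (samples c) (borel_on {0<..})"
  proof (rule measurable_If)
    show "(\<lambda>\<omega>. sample_point \<omega> (next_active k \<omega>)) \<in> measurable (samples c) (borel_on {0<..})"
      by (rule measurable_compose_countable[OF _ measurable_next_active])
         (simp add: sample_point_def measurable_sample_point)
    show "{\<omega> \<in> space (samples c). infinite (active \<omega>)} \<in> sets (samples c)"
      by measurable
  qed (simp add: space_borel_on)
  finally show ?thesis .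
qed

text \<open>The Laplace functional at the constant function 1 vanishes because \<open>dt/t\<close> has infinite mass, so the
  number of points is almost surely infinite.\<close>

lemma AE_infinite_active:
  assumes c: "0 < c"
  shows "AE \<omega> in samples c. infinite (active \<omega>)"
proof -
  let ?s = "\<lambda>\<omega> :: nat \<Rightarrow> nat \<times> (nat \<Rightarrow> real). \<Sum>n. \<Sum>j<fst (\<omega> n). (1 :: ennreal)"
  have "(\<integral>\<^sup>+t. (1 - expneg 1) \<partial>eta_intensity c) =
      (\<Sum>n. ennreal c * (\<integral>\<^sup>+t. (1 - expneg 1) \<partial>block_law n))"
    using c by (intro suminf_block_law[symmetric]) auto
  also have "\<dots> = (\<integral>\<^sup>+n. ennreal c * (1 - expneg 1) \<partial>count_space (UNIV :: nat set))"
    by (subst nn_integral_count_space_nat)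
       (simp only: nn_integral_const prob_space.emeasure_space_1[OF prob_space_block_law] mult_1_right)
  also have "\<dots> = \<top>"
  proof -
    have "1 - expneg 1 \<noteq> (0 :: ennreal)"
      using expneg_le_1[of 1] expneg_eq_1_iff[of 1] antisym[OF expneg_le_1[of 1]]
      by (auto dest: ennreal_minus_eq_0)
    then show ?thesis using c by (simp add: ennreal_mult_eq_top_iff ennreal_mult_top)
  qed
  finally have "(\<integral>\<^sup>+\<omega>. expneg (?s \<omega>) \<partial>samples c) = 0"
    using laplace_samples[OF c, of "\<lambda>_. 1"] by simp
  moreover have "(\<lambda>\<omega>. expneg (?s \<omega>)) \<in> borel_measurable (samples c)"
  proof (rule measurable_compose[OF _ measurable_expneg], rule borel_measurable_suminf_order)
    show "(\<lambda>\<omega>. \<Sum>j<fst (\<omega> n). 1 :: ennreal) \<in> borel_measurable (samples c)" for n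
      by (rule measurable_compose_countable[OF _ measurable_sample_count]) simp
  qed
  ultimately have "AE \<omega> in samples c. expneg (?s \<omega>) = 0"
    by (simp add: nn_integral_0_iff_AE)
  then show ?thesis
  proof eventually_elim
    case (elim \<omega>)
    then have top: "?s \<omega> = \<top>"
      using expneg_inj[of "?s \<omega>" \<top>] by simp
    show ?case
    proof
      assume fin: "finite (active \<omega>)"
      have "?s \<omega> = (\<Sum>i. indicator (active \<omega>) i * 1)"
        by (rule suminf_active[symmetric])
      also have "\<dots> = (\<Sum>i\<in>active \<omega>. indicator (active \<omega>) i * 1)"
        by (rule suminf_finite[OF fin]) simp
      also have "\<dots> = of_nat (card (active \<omega>))" by simp
      also have "\<dots> < \<top>" by (rule of_nat_less_top)
      finally show False using top by simp
    qed
  qed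
qed

lemma poisson_process_eta_point:
  assumes c: "0 < c"
  shows "poisson_process {0<..} (eta_intensity c) (samples c) (\<lambda>\<omega>. dirac_sum {0<..} (\<lambda>k. eta_point k \<omega>))"
proof (rule laplace_imp_poisson_process)
  show "poisson_laplace {0<..} (eta_intensity c) (samples c) (\<lambda>\<omega>. dirac_sum {0<..} (\<lambda>k. eta_point k \<omega>))"
    unfolding poisson_laplace_def
  proof
    fix f :: "real \<Rightarrow> ennreal" assume f: "f \<in> borel_measurable (borel_on {0<..})"
    have "AE \<omega> in samples c. expneg (\<integral>\<^sup>+x. f x \<partial>dirac_sum {0<..} (\<lambda>k. eta_point k \<omega>)) =
        expneg (\<Sum>n. \<Sum>j<fst (\<omega> n). f (snd (\<omega> n) j))"
      using AE_infinite_active[OF c] AE_space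
    proof eventually_elim
      case (elim \<omega>)
      have "eta_point k \<omega> \<in> {0<..}" for k
        using measurable_space[OF measurable_eta_point elim(2)] by (simp add: space_borel_on)
      then show ?case
        by (simp only: nn_integral_dirac_sum[OF _ f] suminf_eta_point[OF elim(1)])
    qed
    then have "(\<integral>\<^sup>+\<omega>. expneg (\<integral>\<^sup>+x. f x \<partial>dirac_sum {0<..} (\<lambda>k. eta_point k \<omega>)) \<partial>samples c) =
        (\<integral>\<^sup>+\<omega>. expneg (\<Sum>n. \<Sum>j<fst (\<omega> n). f (snd (\<omega> n) j)) \<partial>samples c)"
      by (rule nn_integral_cong_AE)
    then show "(\<integral>\<^sup>+\<omega>. expneg (\<integral>\<^sup>+x. f x \<partial>dirac_sum {0<..} (\<lambda>k. eta_point k \<omega>)) \<partial>samples c) =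
        expneg (\<integral>\<^sup>+t. (1 - expneg (f t)) \<partial>eta_intensity c)"
      by (simp only: laplace_samples[OF c f])
  qed
  show "locally_finite_on {0<..} (eta_intensity c)"
    using c by (intro locally_finite_eta_intensity) simp
  show "(\<lambda>\<omega>. dirac_sum {0<..} (\<lambda>k. eta_point k \<omega>)) \<in> measurable (samples c) (measures_on {0<..})"
    by (intro measurable_dirac_sum measurable_eta_point)
qed (simp_all add: prob_space_samples counting_on_dirac_sum)

section \<open>Existence of uplifted processes\<close>

text \<open>Being Poisson depends only on the law: N is read as a function of a random element, which may be
  replaced by another one with the same law.\<close>

lemma poisson_process_transfer:
  fixes N :: "'k \<Rightarrow> 'c::euclidean_space measure"
  assumes X: "X \<in> measurable M K" and Y: "Y \<in> measurable M' K"
    and law: "distr M K X = distr M' K Y"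
    and N: "N \<in> measurable K (measures_on S)" and count: "\<And>z. counting_on S (N z)"
    and M': "prob_space M'" and P: "poisson_process S \<Lambda> M (\<lambda>\<omega>. N (X \<omega>))"
  shows "poisson_process S \<Lambda> M' (\<lambda>\<omega>. N (Y \<omega>))"
proof (rule laplace_imp_poisson_process[OF M'])
  show "locally_finite_on S \<Lambda>" using P by (simp only: poisson_process_def)
  show "(\<lambda>\<omega>. N (Y \<omega>)) \<in> measurable M' (measures_on S)"
    by (rule measurable_compose[OF Y N])
  show "poisson_laplace S \<Lambda> M' (\<lambda>\<omega>. N (Y \<omega>))"
    unfolding poisson_laplace_def
  proof
    fix f :: "'c \<Rightarrow> ennreal" assume f: "f \<in> borel_measurable (borel_on S)"
    have m: "(\<lambda>z. expneg (\<integral>\<^sup>+x. f x \<partial>N z)) \<in> borel_measurable K"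
      by (intro measurable_compose[OF _ measurable_expneg]
          measurable_compose[OF N measurable_nn_integral_measures_on[OF f]])
    have "(\<integral>\<^sup>+\<omega>. expneg (\<integral>\<^sup>+x. f x \<partial>N (Y \<omega>)) \<partial>M') = (\<integral>\<^sup>+z. expneg (\<integral>\<^sup>+x. f x \<partial>N z) \<partial>distr M' K Y)"
      using m by (simp add: nn_integral_distr[OF Y])
    also have "\<dots> = (\<integral>\<^sup>+\<omega>. expneg (\<integral>\<^sup>+x. f x \<partial>N (X \<omega>)) \<partial>M)"
      using m by (simp add: law[symmetric] nn_integral_distr[OF X])
    also have "\<dots> = expneg (\<integral>\<^sup>+x. (1 - expneg (f x)) \<partial>\<Lambda>)"
      using poisson_process_imp_laplace[OF P] f by (simp only: poisson_laplace_def)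
    finally show "(\<integral>\<^sup>+\<omega>. expneg (\<integral>\<^sup>+x. f x \<partial>N (Y \<omega>)) \<partial>M') = expneg (\<integral>\<^sup>+x. (1 - expneg (f x)) \<partial>\<Lambda>)" .
  qed
qed (use count in simp)

text \<open>The probability space is the space of sequences of pairs (point, mark), under the joint law of the
  enumerated points and an independent sequence of independent copies of U.\<close>

lemma uplift_data_exists:
  fixes U :: "'w \<Rightarrow> 'a::euclidean_space"
  assumes c: "0 < c" and W: "prob_space W" and U: "U \<in> measurable W (borel_on (- {0}))"
  obtains M :: "(nat \<Rightarrow> real \<times> 'a) measure" and Z Us where "uplift_data c W U M Z Us"
proof -
  define \<sigma> where "\<sigma> = distr W (borel_on (- {0})) U"
  have prob_\<sigma>: "prob_space \<sigma>" unfolding \<sigma>_def by (rule prob_space.prob_space_distr[OF W U])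
  have sets_\<sigma>: "sets \<sigma> = sets (borel_on (- {0}))" by (simp add: \<sigma>_def)
  define PZ :: "(nat \<Rightarrow> real) measure" where "PZ = PiM UNIV (\<lambda>_. borel_on {0<..})"
  define PV :: "(nat \<Rightarrow> 'a) measure" where "PV = PiM UNIV (\<lambda>_. borel_on (- {0}))"
  define marks :: "(nat \<Rightarrow> 'a) measure" where "marks = PiM UNIV (\<lambda>_. \<sigma>)"
  define PM :: "(nat \<Rightarrow> real \<times> 'a) measure" where "PM = PiM UNIV (\<lambda>_. borel_on {0<..} \<Otimes>\<^sub>M borel_on (- {0}))"
  have sets_marks: "sets marks = sets PV"
    unfolding marks_def PV_def by (intro sets_PiM_cong) (simp_all add: sets_\<sigma>)
  interpret S: prob_space "samples c" by (rule prob_space_samples)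
  interpret V: prob_space marks unfolding marks_def by (intro prob_space_PiM prob_\<sigma>)
  interpret SV: pair_prob_space "samples c" marks ..
  define T :: "(nat \<Rightarrow> nat \<times> (nat \<Rightarrow> real)) \<times> (nat \<Rightarrow> 'a) \<Rightarrow> nat \<Rightarrow> real \<times> 'a" where
    "T p k = (eta_point k (fst p), snd p k)" for p k
  define M where "M = distr (samples c \<Otimes>\<^sub>M marks) PM T"
  define Z :: "nat \<Rightarrow> (nat \<Rightarrow> real \<times> 'a) \<Rightarrow> real" where "Z k m = fst (m k)" for k m
  define Us :: "nat \<Rightarrow> (nat \<Rightarrow> real \<times> 'a) \<Rightarrow> 'a" where "Us k m = snd (m k)" for k m
  have mark_k: "(\<lambda>u. u k) \<in> measurable marks (borel_on (- {0}))" for k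
    unfolding measurable_cong_sets[OF sets_marks refl] PV_def by simp
  have T: "T \<in> measurable (samples c \<Otimes>\<^sub>M marks) PM"
    unfolding PM_def T_def[abs_def]
    by (intro measurable_sequence measurable_Pair measurable_compose[OF measurable_fst measurable_eta_point]
        measurable_compose[OF measurable_snd mark_k])
  interpret M: prob_space M unfolding M_def by (rule SV.prob_space_distr[OF T])
  have sets_M: "sets M = sets PM" by (simp add: M_def)
  have Zk_PM: "Z k \<in> measurable PM (borel_on {0<..})" and Uk_PM: "Us k \<in> measurable PM (borel_on (- {0}))" for k
    unfolding Z_def[abs_def] Us_def[abs_def] PM_def by measurable
  then have Zk: "Z k \<in> measurable M (borel_on {0<..})" and Uk: "Us k \<in> measurable M (borel_on (- {0}))" for k
    by (simp_all only: measurable_cong_sets[OF sets_M refl])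
  have Zs: "(\<lambda>m k. Z k m) \<in> measurable M PZ" and Vs: "(\<lambda>m k. Us k m) \<in> measurable M PV"
    unfolding PZ_def PV_def by (intro measurable_sequence Zk Uk)+
  have eta_seq: "(\<lambda>\<omega> k. eta_point k \<omega>) \<in> measurable (samples c) PZ"
    unfolding PZ_def by (intro measurable_sequence measurable_eta_point)
  have id_V: "(\<lambda>u. u) \<in> measurable marks PV"
    by (rule measurable_ident_sets[OF sets_marks])
  have distr_V: "distr marks PV (\<lambda>u. u) = marks"
    by (rule distr_id2[OF sets_marks[symmetric]])
  have joint: "distr M (PZ \<Otimes>\<^sub>M PV) (\<lambda>m. (\<lambda>k. Z k m, \<lambda>k. Us k m)) =
      distr (samples c) PZ (\<lambda>\<omega> k. eta_point k \<omega>) \<Otimes>\<^sub>M marks"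
  proof -
    have "distr M (PZ \<Otimes>\<^sub>M PV) (\<lambda>m. (\<lambda>k. Z k m, \<lambda>k. Us k m)) =
        distr (samples c \<Otimes>\<^sub>M marks) (PZ \<Otimes>\<^sub>M PV) ((\<lambda>m. (\<lambda>k. Z k m, \<lambda>k. Us k m)) \<circ> T)"
      unfolding M_def using Zs Vs
      by (intro distr_distr T measurable_Pair) (simp_all only: measurable_cong_sets[OF sets_M refl])
    also have "(\<lambda>m. (\<lambda>k. Z k m, \<lambda>k. Us k m)) \<circ> T = (\<lambda>(\<omega>, u). (\<lambda>k. eta_point k \<omega>, u))"
      by (auto simp: fun_eq_iff Z_def Us_def T_def)
    also have "distr (samples c \<Otimes>\<^sub>M marks) (PZ \<Otimes>\<^sub>M PV) \<dots> =
        distr (samples c) PZ (\<lambda>\<omega> k. eta_point k \<omega>) \<Otimes>\<^sub>M distr marks PV (\<lambda>u. u)"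
      by (intro pair_measure_distr[symmetric] eta_seq id_V)
         (simp add: distr_V V.sigma_finite_measure_axioms)
    finally show ?thesis by (simp only: distr_V)
  qed
  interpret E: prob_space "distr (samples c) PZ (\<lambda>\<omega> k. eta_point k \<omega>)"
    by (rule S.prob_space_distr[OF eta_seq])
  have law_Z: "distr M PZ (\<lambda>m k. Z k m) = distr (samples c) PZ (\<lambda>\<omega> k. eta_point k \<omega>)"
  proof (rule measure_eqI)
    fix A assume "A \<in> sets (distr M PZ (\<lambda>m k. Z k m))"
    then have A: "A \<in> sets PZ" by simp
    have "emeasure (distr M PZ (\<lambda>m k. Z k m)) A =
        emeasure (distr M (PZ \<Otimes>\<^sub>M PV) (\<lambda>m. (\<lambda>k. Z k m, \<lambda>k. Us k m))) (A \<times> space PV)"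
      using A Zs Vs measurable_space[OF Vs]
      by (simp add: emeasure_distr) (intro arg_cong[where f = "emeasure M"], auto)
    also have "\<dots> = emeasure (distr (samples c) PZ (\<lambda>\<omega> k. eta_point k \<omega>)) A"
      unfolding joint sets_eq_imp_space_eq[OF sets_marks, symmetric]
      using A by (subst V.emeasure_pair_measure_Times) (simp_all add: V.emeasure_space_1)
    finally show "emeasure (distr M PZ (\<lambda>m k. Z k m)) A =
        emeasure (distr (samples c) PZ (\<lambda>\<omega> k. eta_point k \<omega>)) A" .
  qed simp
  have law_V: "distr M PV (\<lambda>m k. Us k m) = marks"
  proof (rule measure_eqI)
    fix B assume "B \<in> sets (distr M PV (\<lambda>m k. Us k m))"
    then have B: "B \<in> sets PV" by simp
    have "emeasure (distr M PV (\<lambda>m k. Us k m)) B =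
        emeasure (distr M (PZ \<Otimes>\<^sub>M PV) (\<lambda>m. (\<lambda>k. Z k m, \<lambda>k. Us k m))) (space PZ \<times> B)"
      using B Zs Vs measurable_space[OF Zs]
      by (simp add: emeasure_distr) (intro arg_cong[where f = "emeasure M"], auto)
    also have "\<dots> = emeasure marks B"
      unfolding joint using B E.emeasure_space_1 sets.top[of "distr (samples c) PZ (\<lambda>\<omega> k. eta_point k \<omega>)"]
      by (subst V.emeasure_pair_measure_Times) (simp_all add: sets_marks)
    finally show "emeasure (distr M PV (\<lambda>m k. Us k m)) B = emeasure marks B" .
  qed (simp add: sets_marks)
  have law_Uk: "distr M (borel_on (- {0})) (Us k) = \<sigma>" for k
  proof -
    have "distr M (borel_on (- {0})) (Us k) = distr (distr M PV (\<lambda>m k. Us k m)) (borel_on (- {0})) (\<lambda>u. u k)"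
      using Vs by (subst distr_distr) (simp_all add: PV_def comp_def)
    also have "\<dots> = distr marks \<sigma> (\<lambda>u. u k)"
      unfolding law_V by (rule distr_cong) (simp_all add: sets_\<sigma>)
    also have "\<dots> = \<sigma>"
      unfolding marks_def by (rule distr_PiM_component[OF prob_\<sigma>]) simp
    finally show ?thesis .
  qed
  have "uplift_data c W U M Z Us"
    unfolding uplift_data_def
  proof (intro conjI allI)
    show "prob_space M" by (rule M.prob_space_axioms)
    show "Z k \<in> measurable M (borel_on {0<..})" for k by (rule Zk)
    show "Us k \<in> measurable M (borel_on (- {0}))" for k by (rule Uk)
    show "distr M (borel_on (- {0})) (Us k) = distr W (borel_on (- {0})) U" for k
      by (simp only: law_Uk \<sigma>_def)
    show "poisson_process {0<..} (eta_intensity c) M (\<lambda>m. dirac_sum {0<..} (\<lambda>k. Z k m))"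
    proof (rule poisson_process_transfer[OF eta_seq Zs law_Z[symmetric]])
      show "(\<lambda>z. dirac_sum {0<..} z) \<in> measurable PZ (measures_on {0<..})"
        using measurable_dirac_sum[of "\<lambda>k z. z k" PZ "{0<..}"] by (simp add: PZ_def)
    qed (simp_all add: M.prob_space_axioms counting_on_dirac_sum poisson_process_eta_point[OF c])
    show "M.indep_vars (\<lambda>_. borel_on (- {0})) Us UNIV"
      by (subst M.indep_vars_iff_distr_eq_PiM)
         (simp_all add: Uk law_Uk law_V[unfolded PV_def] restrict_UNIV marks_def)
    show "M.indep_set
        (sets (vimage_algebra (space M) (\<lambda>m k. Z k m) (\<Pi>\<^sub>M k\<in>UNIV. borel_on {0<..})))
        (sets (vimage_algebra (space M) (\<lambda>m k. Us k m) (\<Pi>\<^sub>M k\<in>UNIV. borel_on (- {0}))))"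
    proof -
      have "distr M PZ (\<lambda>m k. Z k m) \<Otimes>\<^sub>M distr M PV (\<lambda>m k. Us k m) =
          distr M (PZ \<Otimes>\<^sub>M PV) (\<lambda>m. (\<lambda>k. Z k m, \<lambda>k. Us k m))"
        by (simp only: law_Z law_V joint)
      from M.indep_set_vimage_iff_distr_pair[OF Zs Vs, THEN iffD2, OF this]
      show ?thesis unfolding PZ_def PV_def .
    qed
  qed
  then show ?thesis by (rule that)
qed

section \<open>Scale-invariant Poisson processes are uplifted processes\<close>

text \<open>The intensity is that of a process uplifted by marks with law Q, hence also that of the process
  uplifted by the directions of such marks, which are unit vectors; Poisson processes with equal
  intensities have the same distribution. Here the random vector is \<open>U v = v / \<parallel>v\<parallel>\<close>
  on the probability space Q itself.\<close>

lemma scale_invariant_poisson_is_uplift: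
  fixes N :: "'m \<Rightarrow> 'a::euclidean_space measure"
  assumes P: "poisson_process (- {0}) \<Lambda> M N" and inv: "scale_invariant (- {0}) M N"
    and nonzero: "\<not> (AE \<omega> in M. emeasure (N \<omega>) (- {0}) = 0)"
  shows "\<exists>c>0. \<exists>(W :: 'a measure) U (M' :: (nat \<Rightarrow> real \<times> 'a) measure) Z Us.
    prob_space W \<and> U \<in> measurable W (borel_on (sphere 0 1)) \<and>
    uplift_data c W U M' Z Us \<and> same_distribution (- {0}) M N M' (uplift Z Us)"
proof -
  have N: "N \<in> measurable M (measures_on (- {0}))" and M: "prob_space M"
    and \<Lambda>: "locally_finite_on (- {0}) \<Lambda>"
    using P by (simp_all only: poisson_process_def point_process_def)
  interpret M: prob_space M by fact
  have S: "- {0 :: 'a} \<in> sets (borel_on (- {0}))"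
    using sets.top[of "borel_on (- {0 :: 'a})"] by (simp only: space_borel_on)
  have "emeasure \<Lambda> (- {0}) \<noteq> 0"
  proof
    assume "emeasure \<Lambda> (- {0}) = 0"
    then have "emeasure M {\<omega>\<in>space M. emeasure (N \<omega>) (- {0}) = 0} = 1"
      using void_probability[OF P S] by simp
    moreover have "{\<omega>\<in>space M. emeasure (N \<omega>) (- {0}) = 0} \<in> M.events"
      using measurable_count[OF N S] by measurable
    ultimately have "AE \<omega> in M. emeasure (N \<omega>) (- {0}) = 0"
      by (simp add: M.emeasure_eq_measure M.prob_Collect_eq_1)
    with nonzero show False ..
  qed
  from scale_invariant_eq_uplift_intensity[OF \<Lambda> scale_invariant_intensity[OF P inv] this]
  obtain c Q where c: "0 < c" and Q: "prob_space Q" "sets Q = sets (borel_on (- {0}))"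
    and \<Lambda>_eq: "\<Lambda> = uplift_intensity c Q" by metis
  define U where "U v = v /\<^sub>R norm v" for v :: 'a
  have U: "U \<in> measurable Q (borel_on (sphere 0 1))" "U \<in> measurable Q (borel_on (- {0}))"
    unfolding U_def[abs_def] measurable_cong_sets[OF Q(2) refl]
    by (intro measurable_restrict_space3; auto)+
  obtain M' :: "(nat \<Rightarrow> real \<times> 'a) measure" and Z Us where D: "uplift_data c Q U M' Z Us"
    using uplift_data_exists[OF c Q(1) U(2)] by metis
  have "poisson_process (- {0}) (uplift_intensity c (distr Q (borel_on (- {0})) U)) M' (uplift Z Us)"
    using c by (intro poisson_process_uplift[OF D]) simp
  also have "uplift_intensity c (distr Q (borel_on (- {0})) U) = \<Lambda>"
    unfolding U_def[abs_def] \<Lambda>_eq using c by (intro uplift_intensity_normalize Q) simp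
  finally have "same_distribution (- {0}) M N M' (uplift Z Us)"
    by (rule poisson_process_unique[OF P])
  with c Q(1) U(1) D show ?thesis by blast
qed

theorem lemma5p1:
  shows
    "(\<forall>(M :: 'm measure) (N :: 'm \<Rightarrow> (real ^ 'd) measure) \<Lambda>.
        poisson_process (- {0}) \<Lambda> M N \<and> scale_invariant (- {0}) M N \<and>
        \<not> (AE \<omega> in M. emeasure (N \<omega>) (- {0}) = 0) \<longrightarrow>
        (\<exists>c>0. \<exists>(W :: (real ^ 'd) measure) U
            (M' :: (nat \<Rightarrow> real \<times> (real ^ 'd)) measure) Z Us.
           prob_space W \<and> U \<in> measurable W (borel_on (sphere 0 1)) \<and>
           uplift_data c W U M' Z Us \<and>
           same_distribution (- {0}) M N M' (uplift Z Us)))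
     \<and>
     (\<forall>c>0. \<forall>(W :: 'w measure) (V :: 'w \<Rightarrow> real ^ 'd)
         (M :: 'a measure) Z Vs (M' :: 'b measure) Z' Us.
        prob_space W \<and> V \<in> measurable W (borel_on (- {0})) \<and>
        uplift_data c W V M Z Vs \<and>
        (\<forall>a b. 0 < a \<and> a < b \<longrightarrow>
           (\<integral>\<^sup>+ \<omega>. (\<Sum>k. indicator {a..b} (Z k \<omega> * norm (Vs k \<omega>))) \<partial>M) < \<infinity>) \<and>
        uplift_data c W (\<lambda>w. V w /\<^sub>R norm (V w)) M' Z' Us \<longrightarrow>
        same_distribution (- {0}) M (uplift Z Vs) M' (uplift Z' Us))"
  by (intro conjI allI impI; elim conjE)
     (blast intro: scale_invariant_poisson_is_uplift uplift_depends_on_direction less_imp_le)+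

end
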